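(* Let $n\ge 2$, let $\alpha\in\mathbb{R}$ with $\alpha>(1-n)/2$, and let $1<p<\infty$. Suppose that the spherical maximal operator $\mathfrak{m}^\alpha$ of order $\alpha$ is bounded on $L^p(\mathbb{H}^n)$. Then: (1) if $1<p\le 2$, one must have $\alpha>1-n+\dfrac{n}{p}$; (2) if $2<p<\infty$, one must have $\alpha\ge\max\left\{\dfrac1p-\dfrac{n-1}{2},\ -\dfrac{n-1}{p}\right\}$.
   Context: On $\mathbb{R}^{n+1}$ let $[z,w]=z_0w_0-z_1w_1-\cdots-z_nw_n$ and $[z]:=[z,z]$. The hyperbolic space is $\mathbb{H}^n=\{z=(z_0,z')\in\mathbb{R}^{n+1}:[z]=1,\ z_0>0\}$, with the Riemannian metric induced by the Minkowski metric $[\cdot,\cdot]$, the associated Riemannian measure $dz$, and geodesic distance $d(z,w)=\operatorname{arcosh}([z,w])$. $B_t(z)$ is the geodesic ball with center $z$ and radius $t$. For $t>0$, $\operatorname{Re}\alpha>0$ and a test function $f$, define $$M_t^\alpha(f)(z)=2e^t\left(\frac{e^t-1}{\sinh t}\right)^{n-2}\frac{1}{(e^t-1)^{2\alpha+n-2}}\,\frac{1}{\Gamma(\alpha)}\int_{B_t(z)}[e^tz-w]^{\alpha-1}f(w)\,dw .$$ (Here $[e^tz-w]=2e^t(\cosh t-\cosh d(z,w))>0$ for $w\in B_t(z)$.) For complex $\alpha$ with $\operatorname{Re}\alpha>(1-n)/2$, $M_t^\alpha(f)(z)$ is defined by analytic continuation in $\alpha$. The spherical maximal operator of order $\alpha$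 is $\mathfrak{m}^\alpha(f)(z)=\sup_{t>0}|M_t^\alpha(f)(z)|$. "$\mathfrak{m}^\alpha$ is bounded on $L^p(\mathbb{H}^n)$" means that there is a constant $C$ such that $\|\mathfrak{m}^\alpha(f)\|_{L^p(\mathbb{H}^n)}\le C\|f\|_{L^p(\mathbb{H}^n)}$ for all $f\in C_c^\infty(\mathbb{H}^n)$. *)

theory Defs
  imports "HOL-Complex_Analysis.Complex_Analysis"
begin

text \<open>
  Throughout, the dimension is n = CARD('n), and the vector space of dimension n + 1 is modelled as
  \<open>real \<times> (real ^ 'n)\<close>, a point being a pair (z0, z').
\<close>

type_synonym 'n mspace = "real \<times> (real ^ 'n)"

definition mink :: "'n::finite mspace \<Rightarrow> 'n mspace \<Rightarrow> real" where
  "mink z w = fst z * fst w - (\<Sum>i\<in>UNIV. snd z $ i * snd w $ i)"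

definition hyp :: "'n::finite mspace set" where
  "hyp = {z. mink z z = 1 \<and> fst z > 0}"

definition hdist :: "'n::finite mspace \<Rightarrow> 'n mspace \<Rightarrow> real" where
  "hdist z w = arcosh (mink z w)"

definition hball :: "real \<Rightarrow> 'n::finite mspace \<Rightarrow> 'n mspace set" where
  "hball t z = {w \<in> hyp. hdist z w < t}"

text \<open>
  Hyperbolic space is the graph of \<open>sqrt (1 + |x|\<^sup>2)\<close>, so the map below is a global chart
  (a diffeomorphism from the whole coordinate space onto \<open>hyp\<close>).
\<close>

definition hchart :: "real ^ 'n::finite \<Rightarrow> 'n mspace" where
  "hchart x = (sqrt (1 + (norm x)\<^sup>2), x)"

text \<open>
  The Gram matrix in this chart of the induced Riemannian metric. With the signature (+,-,...,-) the
  Minkowski form is negative definite on the tangent spaces of \<open>hyp\<close>, so the metric is its negative.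
\<close>

definition hgram :: "real ^ 'n::finite \<Rightarrow> real ^ 'n ^ 'n" where
  "hgram x = (\<chi> i j. - mink (frechet_derivative hchart (at x) (axis i 1))
                           (frechet_derivative hchart (at x) (axis j 1)))"

text \<open>The Riemannian measure, as a Borel measure on the ambient space concentrated on \<open>hyp\<close>.\<close>

definition hmeasure :: "'n::finite mspace measure" where
  "hmeasure = distr (density lborel (\<lambda>x. ennreal (sqrt (det (hgram x))))) borel hchart"

text \<open>\<open>Ck k g\<close>: g is k times continuously differentiable on the whole space.\<close>

primrec Ck :: "nat \<Rightarrow> ('a::euclidean_space \<Rightarrow> complex) \<Rightarrow> bool" where
  "Ck 0 g = continuous_on UNIV g"
| "Ck (Suc k) g =
     ((\<forall>x. g differentiable (at x)) \<and> (\<forall>v. Ck k (\<lambda>x. frechet_derivative g (at x) v)))"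

text \<open>
  Test functions are given on the ambient space, but only their values on \<open>hyp\<close> matter. As \<open>hyp\<close> is
  closed, the ambient closure of the support coincides with its closure relative to \<open>hyp\<close>.
\<close>

definition test_fun :: "('n::finite mspace \<Rightarrow> complex) \<Rightarrow> bool" where
  "test_fun f \<longleftrightarrow> (\<forall>k. Ck k (f \<circ> hchart)) \<and> compact (closure {z \<in> hyp. f z \<noteq> 0})"

text \<open>The defining integral, meaningful for \<open>Re \<alpha> > 0\<close>.\<close>

definition M_int :: "('n::finite mspace \<Rightarrow> complex) \<Rightarrow> real \<Rightarrow> 'n mspace \<Rightarrow> complex \<Rightarrow> complex" where
  "M_int f t z \<alpha> =
     of_real (2 * exp t * ((exp t - 1) / sinh t) ^ (CARD('n) - 2))
     * (1 / (of_real (exp t - 1) powr (2 * \<alpha> + of_nat CARD('n) - 2)))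
     * (1 / Gamma \<alpha>)
     * (LINT w:hball t z|hmeasure.
          of_real (mink (exp t *\<^sub>R z - w) (exp t *\<^sub>R z - w)) powr (\<alpha> - 1) * f w)"

text \<open>
  Its analytic continuation to the half plane \<open>Re \<alpha> > (1 - n)/2\<close>. The half plane is connected, so
  the value does not depend on the choice of the continuation.
\<close>

definition M_op :: "complex \<Rightarrow> real \<Rightarrow> ('n::finite mspace \<Rightarrow> complex) \<Rightarrow> 'n mspace \<Rightarrow> complex" where
  "M_op \<alpha> t f z =
     (THE c. \<exists>F. F holomorphic_on {s. Re s > (1 - real CARD('n)) / 2}
               \<and> (\<forall>s. Re s > 0 \<longrightarrow> F s = M_int f t z s)
               \<and> c = F \<alpha>)"

definition max_op :: "complex \<Rightarrow> ('n::finite mspace \<Rightarrow> complex) \<Rightarrow> 'n mspace \<Rightarrow> ennreal" where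
  "max_op \<alpha> f z = (SUP t\<in>{0<..}. ennreal (norm (M_op \<alpha> t f z)))"

definition epowr :: "ennreal \<Rightarrow> real \<Rightarrow> ennreal" where
  "epowr x p = (if x = \<infinity> then \<infinity> else ennreal (enn2real x powr p))"

definition Lp_norm :: "real \<Rightarrow> ('n::finite mspace \<Rightarrow> ennreal) \<Rightarrow> ennreal" where
  "Lp_norm p g = epowr (\<integral>\<^sup>+ z. epowr (g z) p \<partial>hmeasure) (1 / p)"

text \<open>The argument \<open>TYPE('n)\<close> only carries the dimension.\<close>

definition max_op_bounded :: "'n::finite itself \<Rightarrow> complex \<Rightarrow> real \<Rightarrow> bool" where
  "max_op_bounded _ \<alpha> p \<longleftrightarrow>
     (\<exists>C::real. \<forall>f::'n mspace \<Rightarrow> complex. test_fun f \<longrightarrow>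
        Lp_norm p (max_op \<alpha> f) \<le> ennreal C * Lp_norm p (\<lambda>z. ennreal (norm (f z))))"

end

theory Submission
  imports Defs
begin

text \<open>
  Write \<open>u = cosh t - [z, w]\<close>. Up to a positive factor the mean of order \<open>\<alpha>\<close> is the integral of
  \<open>u\<^sub>+\<^sup>\<alpha>\<^sup>-\<^sup>1 / \<Gamma>(\<alpha>)\<close> against \<open>f\<close>. If \<open>Y u = 1\<close> for a vector field \<open>Y\<close> near the support of \<open>f\<close>, then
  integration by parts along \<open>Y\<close> gives \<open>\<integral> u\<^sub>+\<^sup>\<alpha>\<^sup>+\<^sup>k\<^sup>-\<^sup>1 / \<Gamma>(\<alpha> + k) (Y*)\<^sup>k f\<close>, which is the analytic
  continuation to \<open>Re \<alpha> > -k\<close>.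

  For \<open>p > 2\<close> only \<open>\<alpha> < 0\<close> matters. Averaging over \<open>cosh t\<close> against a Riemann-Liouville kernel turns the
  continued means into means of order 1, so for \<open>f \<ge> 0\<close> with \<open>[z, w]\<close> confined to an interval of length
  \<open>\<epsilon>\<close> on the support, the maximal function at \<open>z\<close> is at least of order \<open>\<epsilon>\<^sup>\<alpha>\<^sup>-\<^sup>1 \<integral> f\<close>. Taking for \<open>f\<close> a
  thin shell around a sphere, with \<open>z\<close> near its centre, and a thin cap, with \<open>z\<close> in a tube orthogonal
  to it, yields the two conditions.

  For \<open>p \<le> 2\<close> the inequality is strict, so pieces of \<open>K\<close> dyadic scales at one point \<open>P\<close> are superposed;
  in the critical case each contributes the same amount to the continued mean with \<open>t = d(z, P)\<close>, and
  \<open>K \<lesssim> K\<^sup>1\<^sup>/\<^sup>p\<close> is absurd for large \<open>K\<close>. To rule out cancellation, \<open>Y\<close> is taken along rotations in a plane,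
  under which \<open>1 / X u\<close> is a cosecant, hence completely monotone; if the profile of \<open>f\<close> is completely
  monotone up to order \<open>k\<close> inside the ball, then \<open>(Y*)\<^sup>k f\<close> is positive there.
\<close>

subsection \<open>Smooth functions\<close>

text \<open>For \<alpha> < 0 the kernel is a distribution, so f \<ge> 0 alone gives no lower bound
  for the continued mean. Averaging over the radius restores positivity, but it only shows that some
  radius in the window is good; several scales cannot be added this way, since each would choose its
  own radius. At the endpoint all pieces are therefore evaluated at the one radius for which the
  sphere passes through P, and cancellation is excluded pointwise. The radius depends on z but P
  does not, so one test function serves a fixed set of z of positive measure. A piece of height
  l^(n/p) on a cube of side about 1/l has norm about 1. After k + 1 integrations by parts the kernel
  contributes l^(-(\<alpha>+k)), the derivatives l^(k+1) and the volume l^(-n), in total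
  l^(1-\<alpha>+n/p-n); the exponent is nonnegative exactly when \<alpha> \<le> 1-n+n/p. Positivity
  asks that all derivatives of the profile up to order k + 1 have one sign where the ball meets the
  support, hence a profile that is flat at the edge of its support, such as exp(-1/s) for small
  s.\<close>

primrec Ck_on :: "nat \<Rightarrow> 'a::euclidean_space set \<Rightarrow> ('a \<Rightarrow> 'b::real_normed_vector) \<Rightarrow> bool" where
  "Ck_on 0 S g = continuous_on S g"
| "Ck_on (Suc k) S g =
     ((\<forall>x\<in>S. g differentiable (at x)) \<and> (\<forall>v. Ck_on k S (\<lambda>x. frechet_derivative g (at x) v)))"

definition smooth_on :: "'a::euclidean_space set \<Rightarrow> ('a \<Rightarrow> 'b::real_normed_vector) \<Rightarrow> bool" where
  "smooth_on S g \<longleftrightarrow> (\<forall>k. Ck_on k S g)"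

lemma frechet_derivative_cong_open:
  assumes "open S" "x \<in> S" "\<And>x. x \<in> S \<Longrightarrow> f x = g x"
  shows "frechet_derivative f (at x) = frechet_derivative g (at x)"
proof -
  have "(f has_derivative D) (at x) \<longleftrightarrow> (g has_derivative D) (at x)" for D
    using assms has_derivative_transform_within_open[of f D x UNIV S g]
      has_derivative_transform_within_open[of g D x UNIV S f] by auto
  then show ?thesis by (simp add: frechet_derivative_def)
qed

lemma Ck_on_cong:
  assumes "open S" "\<And>x. x \<in> S \<Longrightarrow> f x = g x"
  shows "Ck_on k S f \<longleftrightarrow> Ck_on k S g"
  using assms(2)
proof (induction k arbitrary: f g)
  case 0
  then show ?case by (auto cong: continuous_on_cong)
next
  case (Suc k)
  have "f differentiable (at x) \<longleftrightarrow> g differentiable (at x)" if "x \<in> S" for x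
    using assms(1) Suc.prems that has_derivative_transform_within_open[of f _ x UNIV S g]
      has_derivative_transform_within_open[of g _ x UNIV S f] unfolding differentiable_def by metis
  moreover have "Ck_on k S (\<lambda>x. frechet_derivative f (at x) v)
      \<longleftrightarrow> Ck_on k S (\<lambda>x. frechet_derivative g (at x) v)" for v
    using frechet_derivative_cong_open[OF assms(1) _ Suc.prems] by (intro Suc.IH) auto
  ultimately show ?case by simp
qed

lemma Ck_on_SucI:
  assumes "open S" "\<And>x. x \<in> S \<Longrightarrow> (g has_derivative D x) (at x)" "\<And>v. Ck_on k S (\<lambda>x. D x v)"
  shows "Ck_on (Suc k) S g"
proof -
  have "frechet_derivative g (at x) = D x" if "x \<in> S" for x
    using frechet_derivative_at[OF assms(2)[OF that]] by simp
  then have "Ck_on k S (\<lambda>x. frechet_derivative g (at x) v)" for v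
    using Ck_on_cong[OF assms(1), of "\<lambda>x. frechet_derivative g (at x) v" "\<lambda>x. D x v" k] assms(3) by simp
  then show ?thesis using assms(2) by (auto simp: differentiable_def)
qed

lemma Ck_on_SucD: "Ck_on (Suc k) S g \<Longrightarrow> Ck_on k S g"
proof (induction k arbitrary: g)
  case 0
  then show ?case
    by (auto intro!: continuous_at_imp_continuous_on differentiable_imp_continuous_within)
next
  case (Suc k)
  then show ?case by simp
qed

lemma Ck_on_has_derivative:
  "Ck_on (Suc k) S g \<Longrightarrow> x \<in> S \<Longrightarrow> (g has_derivative frechet_derivative g (at x)) (at x)"
  using frechet_derivative_works by auto

lemma Ck_on_const: "Ck_on k S (\<lambda>x. c)"
  by (induction k arbitrary: c) (auto simp: frechet_derivative_const)

lemma Ck_on_bounded_linear: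
  assumes "open S" "bounded_linear L"
  shows "Ck_on k S L"
proof (cases k)
  case 0
  then show ?thesis using linear_continuous_on[OF assms(2)] by simp
next
  case (Suc j)
  then show ?thesis
    using Ck_on_SucI[OF assms(1) bounded_linear.has_derivative[OF assms(2) has_derivative_ident]]
      Ck_on_const by blast
qed

lemma Ck_on_compose_linear:
  assumes "open S" "bounded_linear L"
  shows "Ck_on k S g \<Longrightarrow> Ck_on k S (\<lambda>x. L (g x))"
proof (induction k arbitrary: g)
  case 0
  then show ?case using bounded_linear.continuous_on[OF assms(2)] by auto
next
  case (Suc k)
  show ?case
    by (rule Ck_on_SucI[OF assms(1) bounded_linear.has_derivative[OF assms(2) Ck_on_has_derivative[OF Suc.prems]]])
      (use Suc in auto)
qed

lemma Ck_on_add: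
  assumes "open S"
  shows "Ck_on k S f \<Longrightarrow> Ck_on k S g \<Longrightarrow> Ck_on k S (\<lambda>x. f x + g x)"
proof (induction k arbitrary: f g)
  case 0
  then show ?case by (auto intro: continuous_intros)
next
  case (Suc k)
  show ?case
    by (rule Ck_on_SucI[OF assms has_derivative_add[OF Ck_on_has_derivative[OF Suc.prems(1)]
              Ck_on_has_derivative[OF Suc.prems(2)]]])
      (use Suc in auto)
qed

lemma Ck_on_mult:
  fixes f g :: "'a::euclidean_space \<Rightarrow> real"
  assumes "open S"
  shows "Ck_on k S f \<Longrightarrow> Ck_on k S g \<Longrightarrow> Ck_on k S (\<lambda>x. f x * g x)"
proof (induction k arbitrary: f g)
  case 0
  then show ?case by (auto intro: continuous_intros)
next
  case (Suc k)
  have "Ck_on k S f" "Ck_on k S g" using Suc.prems Ck_on_SucD by auto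
  then show ?case
    using Suc by (intro Ck_on_SucI[OF assms has_derivative_mult[OF Ck_on_has_derivative[OF Suc.prems(1)]
              Ck_on_has_derivative[OF Suc.prems(2)]]] Ck_on_add[OF assms]) auto
qed

text \<open>The derivatives enter as a family \<open>\<phi>\<close>: differentiating
  \<open>\<phi> j (g x)\<close> produces \<open>\<phi> (Suc j) (g x)\<close>, so the induction on
  the order runs over all \<open>j\<close> at once and uses only closure under products.\<close>

lemma Ck_on_compose_real:
  fixes g :: "'a::euclidean_space \<Rightarrow> real" and \<phi> :: "nat \<Rightarrow> real \<Rightarrow> real"
  assumes "open S" "\<And>j y. y \<in> U \<Longrightarrow> (\<phi> j has_real_derivative \<phi> (Suc j) y) (at y)" "g ` S \<subseteq> U"
  shows "Ck_on k S g \<Longrightarrow> Ck_on k S (\<lambda>x. \<phi> j (g x))"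
proof (induction k arbitrary: j)
  case 0
  have "continuous_on (g ` S) (\<phi> j)"
    using assms(2,3) by (intro continuous_at_imp_continuous_on) (meson DERIV_isCont subsetD)
  then show ?case using 0 continuous_on_compose[of S g "\<phi> j"] by (simp add: o_def)
next
  case (Suc k)
  have k: "Ck_on k S g" using Suc.prems Ck_on_SucD by auto
  show ?case
  proof (rule Ck_on_SucI[OF assms(1)])
    fix x assume "x \<in> S"
    then show "((\<lambda>x. \<phi> j (g x)) has_derivative
        (\<lambda>v. \<phi> (Suc j) (g x) * frechet_derivative g (at x) v)) (at x)"
      using DERIV_compose_FDERIV[OF assms(2) Ck_on_has_derivative[OF Suc.prems]] assms(3)
      by (auto simp: mult.commute)
  next
    fix v
    show "Ck_on k S (\<lambda>x. \<phi> (Suc j) (g x) * frechet_derivative g (at x) v)"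
      using Suc.prems by (intro Ck_on_mult[OF assms(1)] Suc.IH k) auto
  qed
qed

lemma Ck_on_Un:
  assumes "open S" "open T"
  shows "Ck_on k S g \<Longrightarrow> Ck_on k T g \<Longrightarrow> Ck_on k (S \<union> T) g"
proof (induction k arbitrary: g)
  case 0
  then show ?case using continuous_on_open_Un[OF assms] by simp
next
  case (Suc k)
  show ?case
    unfolding Ck_on.simps
  proof (intro conjI allI ballI)
    show "g differentiable (at x)" if "x \<in> S \<union> T" for x
      using that Suc.prems by auto
    show "Ck_on k (S \<union> T) (\<lambda>x. frechet_derivative g (at x) v)" for v
      using Suc.prems by (intro Suc.IH) (simp_all del: split_paired_All)
  qed
qed

lemma Ck_on_subset: "Ck_on k S g \<Longrightarrow> T \<subseteq> S \<Longrightarrow> Ck_on k T g"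
  by (induction k arbitrary: g) (auto intro: continuous_on_subset)

lemma Ck_complex_of_real: "Ck_on k UNIV g \<Longrightarrow> Ck k (\<lambda>x. complex_of_real (g x))"
proof -
  assume "Ck_on k UNIV g"
  then have "Ck_on k UNIV (\<lambda>x. complex_of_real (g x))"
    by (rule Ck_on_compose_linear[OF open_UNIV bounded_linear_of_real])
  moreover have "Ck k f \<longleftrightarrow> Ck_on k UNIV f" for f :: "'a \<Rightarrow> complex"
    by (induction k arbitrary: f) auto
  ultimately show ?thesis by simp
qed

lemma smooth_on_const [intro]: "smooth_on S (\<lambda>x. c)"
  by (simp add: smooth_on_def Ck_on_const)

lemma smooth_on_bounded_linear: "open S \<Longrightarrow> bounded_linear L \<Longrightarrow> smooth_on S L"
  by (simp add: smooth_on_def Ck_on_bounded_linear)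

lemma smooth_on_inner [intro]: "open S \<Longrightarrow> smooth_on S (\<lambda>x. x \<bullet> a)"
  using smooth_on_bounded_linear[OF _ bounded_linear_inner_left] by blast

lemma smooth_on_nth [intro]: "open S \<Longrightarrow> smooth_on S (\<lambda>x::real^'n. x $ i)"
  using smooth_on_bounded_linear[OF _ bounded_linear_vec_nth] by blast

lemma smooth_on_add [intro]:
  "open S \<Longrightarrow> smooth_on S f \<Longrightarrow> smooth_on S g \<Longrightarrow> smooth_on S (\<lambda>x. f x + g x)"
  by (simp add: smooth_on_def Ck_on_add)

lemma smooth_on_mult [intro]:
  fixes f g :: "'a::euclidean_space \<Rightarrow> real"
  shows "open S \<Longrightarrow> smooth_on S f \<Longrightarrow> smooth_on S g \<Longrightarrow> smooth_on S (\<lambda>x. f x * g x)"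
  by (simp add: smooth_on_def Ck_on_mult)

lemma smooth_on_minus [intro]:
  fixes f :: "'a::euclidean_space \<Rightarrow> real"
  shows "open S \<Longrightarrow> smooth_on S f \<Longrightarrow> smooth_on S (\<lambda>x. - f x)"
  using smooth_on_mult[of S "\<lambda>x. -1" f] by auto

lemma smooth_on_diff [intro]:
  fixes f g :: "'a::euclidean_space \<Rightarrow> real"
  shows "open S \<Longrightarrow> smooth_on S f \<Longrightarrow> smooth_on S g \<Longrightarrow> smooth_on S (\<lambda>x. f x - g x)"
  using smooth_on_add[of S f "\<lambda>x. - g x"] by auto

lemma smooth_on_power [intro]:
  fixes f :: "'a::euclidean_space \<Rightarrow> real"
  shows "open S \<Longrightarrow> smooth_on S f \<Longrightarrow> smooth_on S (\<lambda>x. f x ^ k)"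
  by (induction k) auto

lemma smooth_on_sum [intro]:
  "open S \<Longrightarrow> (\<And>i. i \<in> I \<Longrightarrow> smooth_on S (f i)) \<Longrightarrow> smooth_on S (\<lambda>x. \<Sum>i\<in>I. f i x)"
  by (induction I rule: infinite_finite_induct) auto

lemma smooth_on_norm2 [intro]: "open S \<Longrightarrow> smooth_on S (\<lambda>x. (norm x)\<^sup>2)"
proof -
  assume "open S"
  then have "smooth_on S (\<lambda>x::'a. \<Sum>b\<in>Basis. (x \<bullet> b) * (x \<bullet> b))"
    by (intro smooth_on_sum smooth_on_mult smooth_on_inner)
  moreover have "(norm x)\<^sup>2 = (\<Sum>b\<in>Basis. (x \<bullet> b) * (x \<bullet> b))" for x :: 'a
    by (simp add: power2_norm_eq_inner flip: euclidean_inner)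
  ultimately show ?thesis by simp
qed

lemma smooth_on_compose_real:
  assumes "open S" "smooth_on S g" "\<And>j y. y \<in> U \<Longrightarrow> (\<phi> j has_real_derivative \<phi> (Suc j) y) (at y)" "g ` S \<subseteq> U"
  shows "smooth_on S (\<lambda>x. \<phi> j (g x))"
  using assms Ck_on_compose_real[of S U \<phi> g] by (simp add: smooth_on_def)

lemma smooth_on_powr [intro]:
  fixes g :: "'a::euclidean_space \<Rightarrow> real"
  assumes "open S" "smooth_on S g" "\<And>x. x \<in> S \<Longrightarrow> g x > 0"
  shows "smooth_on S (\<lambda>x. g x powr r)"
proof -
  define \<phi> where "\<phi> j y = (\<Prod>i<j. r - real i) * y powr (r - real j)" for j y
  have "(\<phi> j has_real_derivative \<phi> (Suc j) y) (at y)" if "y \<in> {0<..}" for j y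
    using that unfolding \<phi>_def
    by (auto intro!: derivative_eq_intros simp: powr_diff powr_add field_simps powr_minus)
  from smooth_on_compose_real[where \<phi> = \<phi> and j = 0, OF assms(1,2) this] assms(3) show ?thesis
    by (auto simp: \<phi>_def image_subset_iff)
qed

lemma smooth_on_cong:
  "open S \<Longrightarrow> (\<And>x. x \<in> S \<Longrightarrow> f x = g x) \<Longrightarrow> smooth_on S f \<longleftrightarrow> smooth_on S g"
  using Ck_on_cong by (metis smooth_on_def)

lemma smooth_on_divide [intro]:
  fixes f g :: "'a::euclidean_space \<Rightarrow> real"
  assumes "open S" "smooth_on S f" "smooth_on S g" "\<And>x. x \<in> S \<Longrightarrow> g x > 0"
  shows "smooth_on S (\<lambda>x. f x / g x)"
proof -
  have eq: "f x / g x = f x * g x powr (-1)" if "x \<in> S" for x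
    using assms(4)[OF that] by (simp add: powr_minus divide_inverse)
  have "smooth_on S (\<lambda>x. f x * g x powr (-1))" by (intro smooth_on_mult smooth_on_powr assms)
  then show ?thesis
    using smooth_on_cong[OF assms(1), of "\<lambda>x. f x / g x" "\<lambda>x. f x * g x powr (-1)", OF eq]
    by (simp only:)
qed

lemma smooth_on_sqrt [intro]:
  fixes g :: "'a::euclidean_space \<Rightarrow> real"
  assumes "open S" "smooth_on S g" "\<And>x. x \<in> S \<Longrightarrow> g x > 0"
  shows "smooth_on S (\<lambda>x. sqrt (g x))"
proof -
  have "smooth_on S (\<lambda>x. g x powr (1/2))" using assms by auto
  then show ?thesis
    using smooth_on_cong[OF assms(1), of "\<lambda>x. g x powr (1/2)" "\<lambda>x. sqrt (g x)"] assms(3)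
    by (simp add: powr_half_sqrt less_imp_le)
qed

lemma smooth_on_Un:
  "open S \<Longrightarrow> open T \<Longrightarrow> smooth_on S g \<Longrightarrow> smooth_on T g \<Longrightarrow> smooth_on (S \<union> T) g"
  by (simp add: smooth_on_def Ck_on_Un)

lemma smooth_on_subset: "smooth_on S g \<Longrightarrow> T \<subseteq> S \<Longrightarrow> smooth_on T g"
  using Ck_on_subset[of _ S g T] by (simp add: smooth_on_def)

text \<open>Extension by zero: \<open>S\<close> and the complement of \<open>C\<close> are open and
  cover the space. This is how fields and quotients that are smooth only near the support enter
  global integrals.\<close>

lemma smooth_on_UNIV_extend:
  assumes "open S" "closed C" "C \<subseteq> S" "smooth_on S g" "\<And>x. x \<notin> C \<Longrightarrow> g x = 0"
  shows "smooth_on UNIV g"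
proof -
  have C: "open (- C)" using assms(2) by (simp add: open_Compl)
  have "smooth_on (- C) g"
    using smooth_on_cong[OF C, of g "\<lambda>x. 0"] smooth_on_const[of "- C" 0] assms(5) by simp
  then have "smooth_on (S \<union> - C) g" by (rule smooth_on_Un[OF assms(1) C assms(4)])
  moreover have "S \<union> - C = UNIV" using assms(3) by auto
  ultimately show ?thesis by simp
qed

lemma smooth_on_frechet_derivative [intro]:
  "smooth_on S g \<Longrightarrow> smooth_on S (\<lambda>x. frechet_derivative g (at x) v)"
  unfolding smooth_on_def
proof
  fix k
  assume "\<forall>k. Ck_on k S g"
  then have "Ck_on (Suc k) S g" by (rule spec)
  then show "Ck_on k S (\<lambda>x. frechet_derivative g (at x) v)" by simp
qed

lemma smooth_on_has_derivative:
  "smooth_on S g \<Longrightarrow> x \<in> S \<Longrightarrow> (g has_derivative frechet_derivative g (at x)) (at x)"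
  unfolding smooth_on_def by (drule spec[of _ "Suc 0"], rule Ck_on_has_derivative)

lemma smooth_on_continuous_on: "smooth_on S g \<Longrightarrow> continuous_on S g"
  unfolding smooth_on_def by (drule spec[of _ 0]) simp

subsection \<open>A flat bump function\<close>

text \<open>For s > 0 the j-th derivative of exp(-1/s) is P_j(1/s) exp(-1/s); in y = 1/s the
  recursion reads P_(j+1) = y^2 (P_j - P_j').\<close>

fun bump_poly :: "nat \<Rightarrow> real poly" where
  "bump_poly 0 = 1"
| "bump_poly (Suc j) = monom 1 2 * (bump_poly j - pderiv (bump_poly j))"

definition bumpd :: "nat \<Rightarrow> real \<Rightarrow> real" where
  "bumpd j s = (if s > 0 then poly (bump_poly j) (1 / s) * exp (- (1 / s)) else 0)"

abbreviation bump :: "real \<Rightarrow> real" where "bump \<equiv> bumpd 0"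

lemma poly_times_exp_tendsto_0: "((\<lambda>y::real. poly p y * exp (- y)) \<longlongrightarrow> 0) at_top"
proof -
  have "((\<lambda>y. \<Sum>i\<le>degree p. coeff p i * (y ^ i / exp y)) \<longlongrightarrow> (\<Sum>i\<le>degree p. coeff p i * 0)) at_top"
    by (intro tendsto_intros tendsto_power_div_exp_0)
  then show ?thesis by (simp add: poly_altdef sum_distrib_right exp_minus divide_inverse mult.assoc)
qed

lemma bumpd_tendsto_0: "((\<lambda>s. poly p (1 / s) * exp (- (1 / s)) :: real) \<longlongrightarrow> 0) (at_right 0)"
proof -
  have "filterlim (\<lambda>s::real. 1 / s) at_top (at_right 0)"
    using filterlim_inverse_at_top_right by (simp add: inverse_eq_divide)
  from filterlim_compose[OF poly_times_exp_tendsto_0 this] show ?thesis .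
qed

text \<open>At the flat point the right difference quotient is again a polynomial in 1/s times
  exp(-1/s), with one more factor 1/s, so it tends to 0.\<close>

lemma bumpd_has_derivative: "(bumpd j has_real_derivative bumpd (Suc j) s) (at s)"
proof -
  consider "s < 0" | "s > 0" | "s = 0" by linarith
  then show ?thesis
  proof cases
    case 1
    have "((\<lambda>_. 0) has_real_derivative bumpd (Suc j) s) (at s)"
      using 1 by (simp add: bumpd_def)
    then show ?thesis
      by (rule has_field_derivative_transform_within_open[of _ _ _ "{..<0}"]) (use 1 in \<open>auto simp: bumpd_def\<close>)
  next
    case 2
    have "((\<lambda>s. poly (bump_poly j) (1 / s) * exp (- (1 / s))) has_real_derivative
        (poly (bump_poly j) (1 / s) * (exp (- (1 / s)) * (1 / s\<^sup>2))
          + - (1 / s\<^sup>2) * poly (pderiv (bump_poly j)) (1 / s) * exp (- (1 / s)))) (at s)"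
      using 2 by (auto intro!: derivative_eq_intros DERIV_chain2[OF poly_DERIV] simp: power2_eq_square divide_inverse)
    also have "(poly (bump_poly j) (1 / s) * (exp (- (1 / s)) * (1 / s\<^sup>2))
          + - (1 / s\<^sup>2) * poly (pderiv (bump_poly j)) (1 / s) * exp (- (1 / s))) = bumpd (Suc j) s"
      using 2 by (simp add: bumpd_def poly_monom field_simps)
    finally show ?thesis
      by (rule has_field_derivative_transform_within_open[of _ _ _ "{0<..}"]) (use 2 in \<open>auto simp: bumpd_def\<close>)
  next
    case 3
    have "((\<lambda>h. (bumpd j (0 + h) - bumpd j 0) / h) \<longlongrightarrow> 0) (at_right 0)"
    proof (rule Lim_transform_eventually)
      show "((\<lambda>s. poly (monom 1 1 * bump_poly j) (1 / s) * exp (- (1 / s)) :: real) \<longlongrightarrow> 0) (at_right 0)"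
        by (rule bumpd_tendsto_0)
      show "\<forall>\<^sub>F s in at_right 0. poly (monom 1 1 * bump_poly j) (1 / s) * exp (- (1 / s))
          = (bumpd j (0 + s) - bumpd j 0) / s"
        by (auto simp: eventually_at_filter bumpd_def poly_monom)
    qed
    moreover have "((\<lambda>h. (bumpd j (0 + h) - bumpd j 0) / h) \<longlongrightarrow> 0) (at_left 0)"
    proof (rule Lim_transform_eventually[OF tendsto_const])
      show "\<forall>\<^sub>F h in at_left 0. 0 = (bumpd j (0 + h) - bumpd j 0) / h"
        by (auto simp: eventually_at_filter bumpd_def)
    qed
    ultimately have "((\<lambda>h. (bumpd j (0 + h) - bumpd j 0) / h) \<longlongrightarrow> 0) (at 0)"
      by (simp add: filterlim_split_at)
    then show ?thesis using 3 by (simp add: DERIV_def bumpd_def)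
  qed
qed

lemma smooth_on_bump [intro]:
  fixes g :: "'a::euclidean_space \<Rightarrow> real"
  assumes "open S" "smooth_on S g" shows "smooth_on S (\<lambda>x. bumpd j (g x))"
  by (rule smooth_on_compose_real[where \<phi> = bumpd and U = UNIV, OF assms bumpd_has_derivative]) simp

lemma bumpd_eq_0: "s \<le> 0 \<Longrightarrow> bumpd j s = 0" by (simp add: bumpd_def)

lemma bump_pos: "s > 0 \<Longrightarrow> bump s > 0" by (simp add: bumpd_def)

lemma bump_nonneg: "bump s \<ge> 0" by (simp add: bumpd_def)

lemma bump_le_1: "bump s \<le> 1" by (simp add: bumpd_def)

lemma bump_mono: "s \<le> r \<Longrightarrow> bump s \<le> bump r"
  by (auto simp: bumpd_def frac_le)

text \<open>Subtracting the derivative does not touch the top coefficient and the factor y^2 is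
  monic. Hence every P_j is positive for large y, that is, every derivative of \<open>bump\<close>
  is positive just to the right of 0.\<close>

lemma bump_poly_lead_coeff: "lead_coeff (bump_poly j) > 0"
proof (induction j)
  case (Suc j)
  let ?p = "bump_poly j"
  have pd: "coeff (pderiv ?p) i = 0" if "i \<ge> degree ?p" for i
    using that by (simp add: coeff_pderiv coeff_eq_0)
  then have "degree (?p - pderiv ?p) = degree ?p"
    using Suc by (intro antisym degree_le le_degree) (auto simp: coeff_eq_0)
  then have "lead_coeff (?p - pderiv ?p) = lead_coeff ?p" using pd by simp
  then show ?case using Suc by (simp add: lead_coeff_mult degree_monom_eq)
qed simp

text \<open>Close to the flat point, all derivatives of the bump up to a given order have the same sign;
  this is what makes the test function of the endpoint argument completely monotone along the flow.\<close>

lemma bumpd_pos_near_0: "\<exists>s>0. \<forall>j\<le>k. \<forall>r. 0 < r \<and> r \<le> s \<longrightarrow> bumpd j r > 0"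
proof -
  have "\<exists>N. \<forall>y\<ge>N. poly (bump_poly j) y > 0" for j
    using poly_pinfty_gt_lc[OF bump_poly_lead_coeff[of j]] bump_poly_lead_coeff[of j]
    by (meson less_le_trans)
  then obtain N where N: "\<And>j y. y \<ge> N j \<Longrightarrow> poly (bump_poly j) y > 0" by metis
  define M where "M = Max (insert 1 (N ` {..k}))"
  have M: "N j \<le> M" "1 \<le> M" if "j \<le> k" for j
    unfolding M_def using that by (auto intro!: Max_ge simp del: Max_insert)
  have "bumpd j r > 0" if "j \<le> k" "0 < r" "r \<le> 1 / M" for j r
  proof -
    have "M \<le> 1 / r" using that M[OF that(1)] by (simp add: field_simps)
    then show ?thesis using M[OF that(1)] N[of j "1 / r"] that by (simp add: bumpd_def)
  qed
  then show ?thesis using M[of 0] by (intro exI[of _ "1 / M"]) auto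
qed

subsection \<open>Integration by parts along a vector field\<close>

lemma integral_lborel_continuous_compact:
  fixes f :: "'a::euclidean_space \<Rightarrow> 'b::euclidean_space"
  assumes "continuous_on UNIV f" "\<And>x. x \<notin> cbox a b \<Longrightarrow> f x = 0"
  shows "integrable lborel f" "integral\<^sup>L lborel f = integral (cbox a b) f"
    "f integrable_on cbox a b"
proof -
  have eq: "(\<lambda>x. indicator (cbox a b) x *\<^sub>R f x) = f"
    using assms(2) by (auto simp: indicator_def)
  have "continuous_on (cbox a b) f" using assms(1) continuous_on_subset by blast
  from borel_integrable_compact[OF compact_cbox this]
  have s: "set_integrable lborel (cbox a b) f" by (simp add: set_integrable_def)
  then show "integrable lborel f" by (simp add: set_integrable_def eq)
  show "integral\<^sup>L lborel f = integral (cbox a b) f"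
    using set_borel_integral_eq_integral(2)[OF s] by (simp add: set_lebesgue_integral_def eq)
  show "f integrable_on cbox a b"
    by (rule set_borel_integral_eq_integral(1)[OF s])
qed

lemma compact_subset_cbox:
  fixes C :: "'a::euclidean_space set"
  assumes "compact C" obtains a b where "C \<subseteq> cbox a b"
  using bounded_subset_cbox_symmetric[OF compact_imp_bounded[OF assms]] by metis

lemma integrable_continuous_compact:
  fixes f :: "'a::euclidean_space \<Rightarrow> 'b::euclidean_space"
  assumes "continuous_on UNIV f" "compact C" "\<And>x. x \<notin> C \<Longrightarrow> f x = 0"
  shows "integrable lborel f"
proof -
  obtain a b where "C \<subseteq> cbox a b" by (rule compact_subset_cbox[OF assms(2)])
  then show ?thesis using assms(3) by (intro integral_lborel_continuous_compact(1)[OF assms(1)]) blast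
qed

lemma integral_lborel_translate:
  fixes f :: "'a::euclidean_space \<Rightarrow> 'b::euclidean_space"
  assumes "continuous_on UNIV f"
  shows "integral\<^sup>L lborel (\<lambda>x. f (x + c)) = integral\<^sup>L lborel f"
proof -
  have [measurable]: "f \<in> borel_measurable borel"
    using assms by (rule borel_measurable_continuous_onI)
  have "integral\<^sup>L lborel f = integral\<^sup>L (distr lborel borel ((+) c)) f"
    using lborel_distr_plus[of c] by simp
  also have "\<dots> = integral\<^sup>L lborel (\<lambda>x. f (c + x))"
    by (subst integral_distr) auto
  finally show ?thesis by (simp add: add.commute)
qed

text \<open>By translation invariance the integral of \<open>G (x + s *\<^sub>R e)\<close> does not
  depend on s; differentiating under the integral at s = 0 gives the claim.\<close>

lemma integral_partial_derivative_eq_0: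
  fixes G :: "'a::euclidean_space \<Rightarrow> complex"
  assumes D: "\<And>x. (G has_derivative D x) (at x)" and cont: "continuous_on UNIV (\<lambda>x. D x e)"
    and C: "compact C" "\<And>x. x \<notin> C \<Longrightarrow> G x = 0"
  shows "integral\<^sup>L lborel (\<lambda>x. D x e) = 0" "\<And>x. x \<notin> C \<Longrightarrow> D x e = 0"
proof -
  show D0: "D x e = 0" if "x \<notin> C" for x
  proof -
    have "open (- C)" using C(1) by (simp add: compact_imp_closed open_Compl)
    then have "(G has_derivative (\<lambda>_. 0)) (at x)"
      by (rule has_derivative_transform_within_open[OF has_derivative_const]) (use that C(2) in auto)
    then show ?thesis using has_derivative_unique[OF D] by metis
  qed
  obtain r where r: "\<And>x. x \<in> C \<Longrightarrow> norm x \<le> r"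
    using compact_imp_bounded[OF C(1)] by (auto simp: bounded_iff)
  \<comment> \<open>The box contains the supports of all translates by \<open>s *\<^sub>R e\<close>
    with s between -1 and 1, so the whole family lives on one compact domain.\<close>
  obtain a b where ab: "cball 0 (r + norm e) \<subseteq> cbox a (b :: 'a)"
    by (rule compact_subset_cbox[OF compact_cball])
  have out: "x + s *\<^sub>R e \<notin> C" if "x \<notin> cbox a b" "s \<in> {-1..1}" for x s
  proof
    assume "x + s *\<^sub>R e \<in> C"
    then have "norm (x + s *\<^sub>R e) \<le> r" by (rule r)
    moreover have "norm x \<le> norm (x + s *\<^sub>R e) + norm (s *\<^sub>R e)"
      by (metis add_diff_cancel_right' norm_triangle_ineq4)
    moreover have "norm (s *\<^sub>R e) \<le> norm e"
      using that by (auto simp: abs_le_iff intro: mult_left_le_one_le)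
    ultimately have "x \<in> cball 0 (r + norm e)" by simp
    then show False using ab that by blast
  qed
  have cG: "continuous_on UNIV G"
    using D by (intro continuous_at_imp_continuous_on ballI has_derivative_continuous) auto
  define \<phi> where "\<phi> s = integral (cbox a b) (\<lambda>x. G (x + s *\<^sub>R e))" for s
  have cGs: "continuous_on UNIV (\<lambda>x. G (x + s *\<^sub>R e))" for s
    by (rule continuous_on_compose2[OF cG]) (auto intro!: continuous_intros)
  have \<phi>: "\<phi> s = integral\<^sup>L lborel G" if "s \<in> {-1..1}" for s
    using integral_lborel_continuous_compact(2)[OF cGs, of a b s] C(2) out[OF _ that]
      integral_lborel_translate[OF cG] by (simp add: \<phi>_def)
  have "(\<phi> has_vector_derivative integral (cbox a b) (\<lambda>x. D (x + 0 *\<^sub>R e) e)) (at 0 within {-1..1})"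
    unfolding \<phi>_def
  proof (rule leibniz_rule_vector_derivative)
    fix s :: real and x
    have "((\<lambda>s. G (x + s *\<^sub>R e)) has_derivative (\<lambda>h. D (x + s *\<^sub>R e) (h *\<^sub>R e))) (at s)"
      by (rule has_derivative_compose[OF _ D]) (auto intro!: derivative_eq_intros)
    then show "((\<lambda>s. G (x + s *\<^sub>R e)) has_vector_derivative D (x + s *\<^sub>R e) e) (at s within {-1..1})"
      unfolding has_vector_derivative_def
      using linear_cmul[OF has_derivative_linear[OF D]] by (simp add: has_derivative_at_withinI)
  next
    fix s :: real
    show "(\<lambda>x. G (x + s *\<^sub>R e)) integrable_on cbox a b"
      by (rule integrable_continuous, rule continuous_on_subset[OF cGs]) simp
  next
    have "continuous_on ({-1..1} \<times> cbox a b) (\<lambda>p. D (snd p + fst p *\<^sub>R e) e)"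
      by (rule continuous_on_compose2[OF cont]) (auto intro!: continuous_intros)
    then show "continuous_on ({-1..1} \<times> cbox a b) (\<lambda>(s, x). D (x + s *\<^sub>R e) e)"
      by (simp add: case_prod_unfold)
  qed auto
  moreover have "(\<phi> has_vector_derivative 0) (at 0 within {-1..1})"
    by (rule has_vector_derivative_transform[OF _ _ has_vector_derivative_const]) (use \<phi> in auto)
  ultimately have "integral (cbox a b) (\<lambda>x. D (x + 0 *\<^sub>R e) e) = 0"
    using vector_derivative_unique_within[of 0 "{-1..1::real}"] by (simp add: trivial_limit_within islimpt_Icc)
  moreover have "integral\<^sup>L lborel (\<lambda>x. D x e) = integral (cbox a b) (\<lambda>x. D x e)"
    using out[of _ 0] D0 by (intro integral_lborel_continuous_compact(2)[OF cont]) auto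
  ultimately show "integral\<^sup>L lborel (\<lambda>x. D x e) = 0" by simp
qed

text \<open>The formal adjoint -div (h Y) of differentiation along \<open>Y\<close>. The product is
  differentiated as a whole, so \<open>Y\<close> may be singular away from the support of
  \<open>h\<close>.\<close>

definition vf_adjoint :: "('a::euclidean_space \<Rightarrow> 'a) \<Rightarrow> ('a \<Rightarrow> real) \<Rightarrow> 'a \<Rightarrow> real" where
  "vf_adjoint Y h x = - (\<Sum>e\<in>Basis. frechet_derivative (\<lambda>x. h x * (Y x \<bullet> e)) (at x) e)"

text \<open>The divergence of K(u) h Y integrates to zero, and it equals K'(u) (Y u) h + K(u) div (h
  Y) with Y u = 1 on the support. For \<open>K\<close> to be C^1 is enough, which admits truncated
  powers.\<close>

lemma integral_by_parts_vf:
  fixes u h :: "'a::euclidean_space \<Rightarrow> real" and K K' :: "real \<Rightarrow> complex"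
  assumes u: "smooth_on UNIV u" and hY: "\<And>e. e \<in> Basis \<Longrightarrow> smooth_on UNIV (\<lambda>x. h x * (Y x \<bullet> e))"
    and C: "compact C" "\<And>x. x \<notin> C \<Longrightarrow> h x = 0"
    and Yu: "\<And>x. x \<in> C \<Longrightarrow> frechet_derivative u (at x) (Y x) = 1"
    and h: "smooth_on UNIV h"
    and K: "\<And>r. (K has_vector_derivative K' r) (at r)" "continuous_on UNIV K'"
  shows "integral\<^sup>L lborel (\<lambda>x. K' (u x) * of_real (h x))
       = integral\<^sup>L lborel (\<lambda>x. K (u x) * of_real (vf_adjoint Y h x))"
proof -
  define Du where "Du x = frechet_derivative u (at x)" for x
  define Dh where "Dh e x = frechet_derivative (\<lambda>x. h x * (Y x \<bullet> e)) (at x)" for e x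
  have Du: "(u has_derivative Du x) (at x)" for x
    using smooth_on_has_derivative[OF u] by (simp add: Du_def)
  have Dh: "((\<lambda>x. h x * (Y x \<bullet> e)) has_derivative Dh e x) (at x)" if "e \<in> Basis" for e x
    using smooth_on_has_derivative[OF hY[OF that]] by (simp add: Dh_def)
  define G where "G e x = K (u x) * of_real (h x * (Y x \<bullet> e))" for e x
  define D where "D e x v = (Du x v *\<^sub>R K' (u x)) * of_real (h x * (Y x \<bullet> e)) + K (u x) * of_real (Dh e x v)"
    for e x v
  have cu: "continuous_on UNIV u" by (rule smooth_on_continuous_on[OF u])
  have cK: "continuous_on UNIV K"
    using K(1) by (intro continuous_at_imp_continuous_on ballI has_vector_derivative_continuous) auto
  have cKu: "continuous_on UNIV (\<lambda>x. K (u x))" "continuous_on UNIV (\<lambda>x. K' (u x))"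
    by (rule continuous_on_compose2[OF cK cu], simp, rule continuous_on_compose2[OF K(2) cu], simp)
  have cD: "continuous_on UNIV (\<lambda>x. D e x e)" if "e \<in> Basis" for e
    unfolding D_def Du_def Dh_def
    by (intro continuous_intros cKu continuous_on_of_real smooth_on_continuous_on
        smooth_on_frechet_derivative u hY[OF that] continuous_on_scaleR)
  have DG: "(G e has_derivative D e x) (at x)" if "e \<in> Basis" for e x
  proof -
    have "((\<lambda>x. K (u x)) has_derivative (\<lambda>v. Du x v *\<^sub>R K' (u x))) (at x)"
      by (rule has_derivative_compose[OF Du K(1)[unfolded has_vector_derivative_def]])
    from has_derivative_mult[OF this bounded_linear.has_derivative[OF bounded_linear_of_real Dh[OF that]]]
    show ?thesis
      unfolding G_def D_def by (rule has_derivative_eq_rhs) (auto simp: algebra_simps)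
  qed
  have G0: "G e x = 0" if "x \<notin> C" for e x using C(2)[OF that] by (simp add: G_def)
  have int: "integrable lborel (\<lambda>x. D e x e)" if "e \<in> Basis" for e
    by (rule integrable_continuous_compact[OF cD[OF that] C(1)
          integral_partial_derivative_eq_0(2)[OF DG[OF that] cD[OF that] C(1) G0]])
  have "0 = (\<Sum>e\<in>Basis. integral\<^sup>L lborel (\<lambda>x. D e x e))"
    using integral_partial_derivative_eq_0(1)[OF DG cD C(1) G0] by simp
  also have "\<dots> = integral\<^sup>L lborel (\<lambda>x. \<Sum>e\<in>Basis. D e x e)"
    by (rule Bochner_Integration.integral_sum[symmetric]) (rule int)
  also have "(\<lambda>x. \<Sum>e\<in>Basis. D e x e)
      = (\<lambda>x. K' (u x) * of_real (h x) - K (u x) * of_real (vf_adjoint Y h x))"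
  proof
    fix x
    have "(\<Sum>e\<in>Basis. Du x e * (h x * (Y x \<bullet> e))) = h x"
    proof (cases "x \<in> C")
      case True
      have "Du x (Y x) = Du x (\<Sum>e\<in>Basis. (Y x \<bullet> e) *\<^sub>R e)" by (simp add: euclidean_representation)
      also have "\<dots> = (\<Sum>e\<in>Basis. (Y x \<bullet> e) * Du x e)"
        using has_derivative_linear[OF Du] by (simp add: linear_sum linear_cmul)
      finally have "(\<Sum>e\<in>Basis. (Y x \<bullet> e) * Du x e) = 1" using Yu[OF True] by (simp add: Du_def)
      then have "h x * (\<Sum>e\<in>Basis. (Y x \<bullet> e) * Du x e) = h x" by simp
      then show ?thesis by (simp add: sum_distrib_left ac_simps)
    qed (simp add: C(2))
    then have "K' (u x) * of_real (\<Sum>e\<in>Basis. Du x e * (h x * (Y x \<bullet> e))) = K' (u x) * of_real (h x)"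
      by simp
    moreover have "(\<Sum>e\<in>Basis. Dh e x e) = - vf_adjoint Y h x"
      by (simp add: vf_adjoint_def Dh_def)
    then have "K (u x) * of_real (\<Sum>e\<in>Basis. Dh e x e) = K (u x) * of_real (- vf_adjoint Y h x)" by simp
    ultimately show "(\<Sum>e\<in>Basis. D e x e) = K' (u x) * of_real (h x) - K (u x) * of_real (vf_adjoint Y h x)"
      unfolding D_def sum.distrib by (simp add: sum_distrib_left scaleR_conv_of_real ac_simps)
  qed
  also have "integral\<^sup>L lborel \<dots> = integral\<^sup>L lborel (\<lambda>x. K' (u x) * of_real (h x))
      - integral\<^sup>L lborel (\<lambda>x. K (u x) * of_real (vf_adjoint Y h x))"
  proof (rule Bochner_Integration.integral_diff)
    have ca: "continuous_on UNIV (\<lambda>x. vf_adjoint Y h x)"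
      unfolding vf_adjoint_def
      by (intro continuous_intros smooth_on_continuous_on smooth_on_frechet_derivative hY)
    have "vf_adjoint Y h x = 0" if "x \<notin> C" for x
    proof -
      have o: "open (- C)" using C(1) by (simp add: compact_imp_closed open_Compl)
      have "frechet_derivative (\<lambda>x. h x * (Y x \<bullet> e)) (at x) = frechet_derivative (\<lambda>x. 0) (at x)" for e
        by (rule frechet_derivative_cong_open[OF o]) (use that C(2) in auto)
      then show ?thesis by (simp add: vf_adjoint_def frechet_derivative_const)
    qed
    then show "integrable lborel (\<lambda>x. K (u x) * of_real (vf_adjoint Y h x))"
      by (intro integrable_continuous_compact[OF _ C(1)] continuous_intros cKu ca) auto
    show "integrable lborel (\<lambda>x. K' (u x) * of_real (h x))"
      using C(2) by (intro integrable_continuous_compact[OF _ C(1)] continuous_intros cKu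
          smooth_on_continuous_on h) auto
  qed
  finally show ?thesis by simp
qed

subsection \<open>Analytic continuation of truncated powers\<close>

text \<open>This vanishes for \<open>r \<le> 0\<close>, because \<open>0 powr s = 0\<close> for every \<open>s\<close>.\<close>

definition tpow :: "complex \<Rightarrow> real \<Rightarrow> complex" where
  "tpow s r = of_real (max r 0) powr s"

lemma tpow_nonpos: "r \<le> 0 \<Longrightarrow> tpow s r = 0" by (simp add: tpow_def max_def)

lemma tpow_pos: "r > 0 \<Longrightarrow> tpow s r = of_real r powr s" by (simp add: tpow_def)

lemma norm_tpow: "norm (tpow s r) = max r 0 powr Re s"
  unfolding tpow_def by (subst norm_powr_real_powr) auto

lemma tpow_of_real: "tpow (of_real s) r = of_real (max r 0 powr s)"
  unfolding tpow_def by (subst powr_of_real) auto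

lemma tendsto_tpow:
  assumes "(f \<longlongrightarrow> s) F" "(g \<longlongrightarrow> r) F" "Re s > 0"
  shows "((\<lambda>x. tpow (f x) (g x)) \<longlongrightarrow> tpow s r) F"
proof -
  have "((\<lambda>x. complex_of_real (max (g x) 0)) \<longlongrightarrow> of_real (max r 0)) F"
    by (intro tendsto_of_real tendsto_max assms tendsto_const)
  moreover have "complex_of_real (max r 0) \<notin> \<real>\<^sub>\<le>\<^sub>0 \<or> complex_of_real (max r 0) = 0 \<and> Re s > 0"
    using assms(3) by (auto simp: max_def)
  ultimately show ?thesis
    unfolding tpow_def using assms(1) tendsto_powr_complex' by blast
qed

lemma continuous_on_tpow: "Re s > 0 \<Longrightarrow> continuous_on A (tpow s)"
  unfolding continuous_on_def by (auto intro!: tendsto_tpow tendsto_intros)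

text \<open>Away from 0 this is the usual rule; at 0 the difference quotient has norm at most
  |r|^(Re s - 1), which tends to 0 because Re s > 1.\<close>

lemma tpow_has_vector_derivative:
  assumes "Re s > 1"
  shows "(tpow s has_vector_derivative s * tpow (s - 1) r) (at r)"
proof -
  consider "r < 0" | "r > 0" | "r = 0" by linarith
  then show ?thesis
  proof cases
    case 1
    show ?thesis
      by (rule has_vector_derivative_transform_within_open[of "\<lambda>_. 0" _ _ "{..<0}"])
        (use 1 in \<open>auto simp: tpow_nonpos\<close>)
  next
    case 2
    have "(complex_of_real has_vector_derivative 1) (at r)"
      using has_vector_derivative_of_real[OF DERIV_ident, where 'a = complex] by simp
    moreover have "((\<lambda>z. z powr s) has_field_derivative s * of_real r powr (s - 1)) (at (of_real r))"
      using 2 by (intro has_field_derivative_powr) simp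
    ultimately have "((\<lambda>r. of_real r powr s) has_vector_derivative 1 * (s * of_real r powr (s - 1))) (at r)"
      using field_vector_diff_chain_at[of complex_of_real 1 r "\<lambda>z. z powr s"] by (simp add: o_def)
    then have "((\<lambda>r. of_real r powr s) has_vector_derivative s * tpow (s - 1) r) (at r)"
      using 2 by (simp add: tpow_pos)
    then show ?thesis
      by (rule has_vector_derivative_transform_within_open[of "\<lambda>r. of_real r powr s" _ _ "{0<..}"])
        (use 2 in \<open>auto simp: tpow_pos\<close>)
  next
    case 3
    have "((\<lambda>h. norm (tpow s h) / \<bar>h\<bar>) \<longlongrightarrow> 0) (at 0)"
    proof (rule Lim_transform_eventually)
      have "((\<lambda>h. max h 0 powr (Re s - 1)) \<longlongrightarrow> max 0 0 powr (Re s - 1)) (at (0::real))"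
        using assms by (intro tendsto_powr' tendsto_max tendsto_intros) auto
      then show "((\<lambda>h. max h 0 powr (Re s - 1)) \<longlongrightarrow> 0) (at (0::real))" using assms by simp
      show "\<forall>\<^sub>F h in at 0. max h 0 powr (Re s - 1) = norm (tpow s h) / \<bar>h\<bar>"
        by (auto simp: eventually_at_filter norm_tpow max_def powr_diff)
    qed
    then show ?thesis
      using 3 by (auto simp: has_vector_derivative_def has_derivative_at tpow_nonpos
          bounded_linear_zero)
  qed
qed

lemma tpow_has_field_derivative:
  "((\<lambda>s. tpow s r) has_field_derivative tpow s r * of_real (ln (max r 0))) (at s within A)"
proof (cases "r > 0")
  case True
  have "((\<lambda>s. of_real r powr s) has_field_derivative Ln (of_real r) * of_real r powr s) (at s within A)"
    using True by (intro has_field_derivative_at_within[OF has_field_derivative_powr_right]) auto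
  then show ?thesis using True by (simp add: tpow_pos Ln_of_real mult.commute)
qed (simp add: tpow_nonpos not_less)

text \<open>This allows differentiation in the exponent under the integral. Near r = 0 the power
  absorbs the logarithm: with \<sigma> = Re s at the limit point, nearby exponents exceed
  \<sigma>/2, the logarithm costs \<sigma>/4, and r^(\<sigma>/4) survives.\<close>

lemma continuous_on_tpow_ln:
  "continuous_on ({s. Re s > 0} \<times> UNIV) (\<lambda>(s, r). tpow s r * of_real (ln (max r 0)))"
proof -
  have "((\<lambda>p. tpow (fst p) (snd p) * of_real (ln (max (snd p) 0)))
      \<longlongrightarrow> tpow s0 r0 * of_real (ln (max r0 0))) (at (s0, r0) within A)"
    if "Re s0 > 0" for s0 :: complex and r0 A
  proof (cases "r0 > 0")
    case True
    have lim: "(fst \<longlongrightarrow> s0) (at (s0, r0) within A)" "(snd \<longlongrightarrow> r0) (at (s0, r0) within A)"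
      using tendsto_fst[OF tendsto_ident_at, of "(s0, r0)" A] tendsto_snd[OF tendsto_ident_at, of "(s0, r0)" A]
      by simp_all
    have "((\<lambda>p. ln (max (snd p) 0)) \<longlongrightarrow> ln (max r0 0)) (at (s0, r0) within A)"
      by (rule tendsto_ln[OF tendsto_max[OF lim(2) tendsto_const]]) (use True in auto)
    then show ?thesis
      by (rule tendsto_mult[OF tendsto_tpow[OF lim that] tendsto_of_real])
  next
    case False
    define \<sigma> where "\<sigma> = Re s0"
    have \<sigma>: "\<sigma> > 0" using that by (simp add: \<sigma>_def)
    have lim: "(fst \<longlongrightarrow> s0) (at (s0, r0) within A)" "(snd \<longlongrightarrow> r0) (at (s0, r0) within A)"
      using tendsto_fst[OF tendsto_ident_at, of "(s0, r0)" A] tendsto_snd[OF tendsto_ident_at, of "(s0, r0)" A]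
      by simp_all
    have "((\<lambda>p. tpow (fst p) (snd p) * of_real (ln (max (snd p) 0))) \<longlongrightarrow> 0) (at (s0, r0) within A)"
    proof (rule Lim_null_comparison)
      have "((\<lambda>p. max (snd p) 0 powr (\<sigma> / 4)) \<longlongrightarrow> max r0 0 powr (\<sigma> / 4)) (at (s0, r0) within A)"
        using \<sigma> False by (intro tendsto_powr' tendsto_max lim tendsto_intros) auto
      then have "((\<lambda>p. max (snd p) 0 powr (\<sigma> / 4)) \<longlongrightarrow> 0) (at (s0, r0) within A)"
        using \<sigma> False by (simp add: max_def split: if_splits)
      from tendsto_mult_right_zero[OF this, of "4 / \<sigma>"]
      show "((\<lambda>p. 4 / \<sigma> * max (snd p) 0 powr (\<sigma> / 4)) \<longlongrightarrow> 0) (at (s0, r0) within A)" .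
      have "\<forall>\<^sub>F p in at (s0, r0) within A. snd p < 1"
        using order_tendstoD(2)[OF lim(2), of 1] False by simp
      moreover have "\<forall>\<^sub>F p in at (s0, r0) within A. Re (fst p) > \<sigma> / 2"
        using order_tendstoD(1)[OF tendsto_Re[OF lim(1)], of "\<sigma> / 2"] \<sigma> by (simp add: \<sigma>_def)
      ultimately show "\<forall>\<^sub>F p in at (s0, r0) within A.
          norm (tpow (fst p) (snd p) * of_real (ln (max (snd p) 0))) \<le> 4 / \<sigma> * max (snd p) 0 powr (\<sigma> / 4)"
      proof eventually_elim
        case (elim p)
        show ?case
        proof (cases "snd p > 0")
          case True
          let ?r = "snd p"
          have "norm (tpow (fst p) ?r * of_real (ln (max ?r 0))) = ?r powr Re (fst p) * \<bar>ln ?r\<bar>"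
            using True by (simp add: norm_mult norm_tpow)
          also have "?r powr Re (fst p) \<le> ?r powr (\<sigma> / 2)"
            using elim True by (intro powr_mono') auto
          also have "\<bar>ln ?r\<bar> = ln (1 / ?r)" using elim True by (simp add: ln_div)
          also have "\<dots> \<le> (1 / ?r) powr (\<sigma> / 4) / (\<sigma> / 4)"
            using elim True \<sigma> by (intro ln_powr_bound) auto
          finally have "norm (tpow (fst p) ?r * of_real (ln (max ?r 0)))
              \<le> ?r powr (\<sigma> / 2) * ((1 / ?r) powr (\<sigma> / 4) / (\<sigma> / 4))"
            using elim True by (simp add: mult_left_mono)
          also have "\<dots> = 4 / \<sigma> * (?r powr (\<sigma> / 2) * ?r powr (- (\<sigma> / 4)))"
            using True by (simp add: powr_divide powr_minus field_simps)
          also have "?r powr (\<sigma> / 2) * ?r powr (- (\<sigma> / 4)) = ?r powr (\<sigma> / 4)"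
            by (simp flip: powr_add)
          finally show ?thesis using True by simp
        qed (simp add: tpow_nonpos)
      qed
    qed
    then show ?thesis using False by (simp add: tpow_nonpos)
  qed
  then show ?thesis by (auto simp: continuous_on_def case_prod_unfold)
qed

text \<open>A regularisation of \<open>r\<^sub>+\<^sup>s\<close> which is continuously differentiable even when \<open>Re s\<close> is small.\<close>

definition rpow :: "real \<Rightarrow> complex \<Rightarrow> real \<Rightarrow> complex" where
  "rpow \<delta> s r = of_real ((max r 0)\<^sup>2 + \<delta>) powr (s / 2)"

text \<open>Squaring makes the positive part continuously differentiable, so that
  \<open>rpow\<close> is C^1 for every exponent when \<delta> > 0.\<close>

lemma max_0_square_has_derivative: "((\<lambda>r. (max r 0)\<^sup>2) has_real_derivative 2 * max r 0) (at (r::real))"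
proof -
  consider "r < 0" | "r > 0" | "r = 0" by linarith
  then show ?thesis
  proof cases
    case 1
    show ?thesis
      by (rule has_field_derivative_transform_within_open[of "\<lambda>_. 0" _ _ "{..<0}"]) (use 1 in auto)
  next
    case 2
    show ?thesis
      by (rule has_field_derivative_transform_within_open[of "\<lambda>r. r\<^sup>2" _ _ "{0<..}"])
        (use 2 in \<open>auto intro!: derivative_eq_intros\<close>)
  next
    case 3
    have "((\<lambda>h. ((max (0 + h) 0)\<^sup>2 - (max 0 0)\<^sup>2) / h) \<longlongrightarrow> 0) (at (0::real))"
    proof (rule Lim_transform_eventually)
      have "((\<lambda>h. max h 0) \<longlongrightarrow> max 0 0) (at (0::real))" by (intro tendsto_intros)
      then show "((\<lambda>h. max h 0) \<longlongrightarrow> 0) (at (0::real))" by simp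
      show "\<forall>\<^sub>F h in at 0. max h 0 = ((max (0 + h) 0)\<^sup>2 - (max 0 0)\<^sup>2) / (h::real)"
        by (auto simp: eventually_at_filter max_def power2_eq_square)
    qed
    then show ?thesis using 3 by (simp add: DERIV_def)
  qed
qed

lemma rpow_has_vector_derivative:
  assumes "\<delta> > 0"
  shows "(rpow \<delta> s has_vector_derivative s * of_real (max r 0) * of_real ((max r 0)\<^sup>2 + \<delta>) powr (s / 2 - 1)) (at r)"
proof -
  have p: "(max r 0)\<^sup>2 + \<delta> > 0" using assms by (simp add: add_nonneg_pos)
  have "((\<lambda>r. (max r 0)\<^sup>2 + \<delta>) has_real_derivative 2 * max r 0) (at r)"
    using DERIV_add[OF max_0_square_has_derivative[of r] DERIV_const[of \<delta>]] by simp
  then have "((\<lambda>r. of_real ((max r 0)\<^sup>2 + \<delta>)) has_vector_derivative complex_of_real (2 * max r 0)) (at r)"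
    by (rule has_vector_derivative_of_real)
  from field_vector_diff_chain_at[OF this, of "\<lambda>z. z powr (s / 2)" "s / 2 * of_real ((max r 0)\<^sup>2 + \<delta>) powr (s / 2 - 1)"]
  have "((\<lambda>r. of_real ((max r 0)\<^sup>2 + \<delta>) powr (s / 2)) has_vector_derivative
      of_real (2 * max r 0) * (s / 2 * of_real ((max r 0)\<^sup>2 + \<delta>) powr (s / 2 - 1))) (at r)"
    using has_field_derivative_powr[of "of_real ((max r 0)\<^sup>2 + \<delta>)" "s / 2"] p
    by (simp add: o_def complex_nonpos_Reals_iff del: of_real_add)
  then show ?thesis by (simp add: rpow_def[abs_def] ac_simps)
qed

text \<open>\<open>y\<close> stands for [z, w] in coordinates and \<open>h\<close> for the test
  function times the Riemannian density. With Y y = -1 one has Y (v - y) = 1 for all v at once, so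
  one field and one sequence \<open>hs\<close> serve every radius.\<close>

locale transport =
  fixes y h :: "'a::euclidean_space \<Rightarrow> real" and Y :: "'a \<Rightarrow> 'a" and C S :: "'a set"
  assumes y_smooth: "smooth_on UNIV y" and S_open: "open S" and C_compact: "compact C"
    and C_subset: "C \<subseteq> S" and h_smooth: "smooth_on UNIV h" and h_supp: "\<And>x. x \<notin> C \<Longrightarrow> h x = 0"
    and h_nonneg: "\<And>x. h x \<ge> 0"
    and Y_smooth: "\<And>e. e \<in> Basis \<Longrightarrow> smooth_on S (\<lambda>x. Y x \<bullet> e)"
    and Y_y: "\<And>x. x \<in> C \<Longrightarrow> frechet_derivative y (at x) (Y x) = - 1"
begin

text \<open>Integrating by parts \<open>j\<close> times along \<open>Y\<close> raises the exponent of \<open>v - y\<close> by \<open>j\<close> and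
  replaces \<open>h\<close> by \<open>hs j\<close>.\<close>

definition hs :: "nat \<Rightarrow> 'a \<Rightarrow> real" where "hs j = (vf_adjoint Y ^^ j) h"

lemma hs_0 [simp]: "hs 0 = h" and hs_Suc: "hs (Suc j) = vf_adjoint Y (hs j)"
  by (simp_all add: hs_def)

lemma hs_smooth_supp: "smooth_on UNIV (hs j) \<and> (\<forall>x. x \<notin> C \<longrightarrow> hs j x = 0)"
proof (induction j)
  case 0
  then show ?case using h_smooth h_supp by simp
next
  case (Suc j)
  have cl: "closed C" "open (- C)" using C_compact by (auto simp: compact_imp_closed open_Compl)
  have "smooth_on S (\<lambda>x. hs j x * (Y x \<bullet> e))" if "e \<in> Basis" for e
    using Suc smooth_on_subset[of UNIV "hs j" S] by (intro smooth_on_mult S_open Y_smooth that) auto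
  then have *: "smooth_on UNIV (\<lambda>x. hs j x * (Y x \<bullet> e))" if "e \<in> Basis" for e
    using Suc that by (intro smooth_on_UNIV_extend[OF S_open cl(1) C_subset]) auto
  have "smooth_on UNIV (vf_adjoint Y (hs j))"
    unfolding vf_adjoint_def[abs_def]
    by (intro smooth_on_minus smooth_on_sum smooth_on_frechet_derivative * open_UNIV)
  moreover have "vf_adjoint Y (hs j) x = 0" if "x \<notin> C" for x
  proof -
    have "frechet_derivative (\<lambda>x. hs j x * (Y x \<bullet> e)) (at x) = frechet_derivative (\<lambda>x. 0) (at x)" for e
      by (rule frechet_derivative_cong_open[OF cl(2)]) (use that Suc in auto)
    then show ?thesis by (simp add: vf_adjoint_def frechet_derivative_const)
  qed
  ultimately show ?case by (simp add: hs_Suc)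
qed

lemmas hs_smooth = hs_smooth_supp[THEN conjunct1]
lemmas hs_supp = hs_smooth_supp[THEN conjunct2, rule_format]

lemma hs_Y_smooth: "e \<in> Basis \<Longrightarrow> smooth_on UNIV (\<lambda>x. hs j x * (Y x \<bullet> e))"
  using smooth_on_subset[OF hs_smooth, of S] hs_supp
  by (intro smooth_on_UNIV_extend[OF S_open compact_imp_closed[OF C_compact] C_subset]
      smooth_on_mult S_open Y_smooth) auto

lemma hs_continuous: "continuous_on A (hs j)"
  using smooth_on_continuous_on[OF hs_smooth] continuous_on_subset by blast

lemma y_continuous: "continuous_on A y"
  using smooth_on_continuous_on[OF y_smooth] continuous_on_subset by blast

definition J :: "complex \<Rightarrow> nat \<Rightarrow> real \<Rightarrow> complex" where
  "J s j v = integral\<^sup>L lborel (\<lambda>x. tpow s (v - y x) * of_real (hs j x))"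

lemma integrand_continuous:
  assumes "Re s > 0"
  shows "continuous_on UNIV (\<lambda>x. tpow s (v - y x) * of_real (hs j x))"
  by (intro continuous_intros hs_continuous
      continuous_on_compose2[OF continuous_on_tpow[OF assms, of UNIV]] y_continuous) auto

lemma u_props:
  "smooth_on UNIV (\<lambda>x. v - y x)"
  "x \<in> C \<Longrightarrow> frechet_derivative (\<lambda>x. v - y x) (at x) (Y x) = 1"
proof -
  show "smooth_on UNIV (\<lambda>x. v - y x)" using y_smooth by auto
  have "((\<lambda>x. v - y x) has_derivative (\<lambda>w. 0 - frechet_derivative y (at x) w)) (at x)"
    by (intro has_derivative_diff has_derivative_const smooth_on_has_derivative[OF y_smooth]) simp
  from frechet_derivative_at[OF this] Y_y
  show "x \<in> C \<Longrightarrow> frechet_derivative (\<lambda>x. v - y x) (at x) (Y x) = 1" by (metis diff_0 minus_minus)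
qed

lemma by_parts:
  fixes K K' :: "real \<Rightarrow> complex"
  assumes "\<And>r. (K has_vector_derivative K' r) (at r)" "continuous_on UNIV K'"
  shows "integral\<^sup>L lborel (\<lambda>x. K' (v - y x) * of_real (hs j x))
       = integral\<^sup>L lborel (\<lambda>x. K (v - y x) * of_real (hs (Suc j) x))"
  unfolding hs_Suc
  by (rule integral_by_parts_vf[OF u_props(1) hs_Y_smooth C_compact hs_supp u_props(2) hs_smooth assms])

lemma J_step: "Re s > 1 \<Longrightarrow> s * J (s - 1) j v = J s (Suc j) v"
  using by_parts[OF tpow_has_vector_derivative, of s v j]
  by (simp add: J_def mult.assoc continuous_on_mult_left continuous_on_tpow)

text \<open>For small \<open>Re s\<close> the kernel is singular; integrability comes from Fatou's lemma applied to the
  regularised kernels, which is where \<open>h \<ge> 0\<close> is used.\<close>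

lemma J_base:
  assumes "0 < Re s" "Re s \<le> 1"
  shows "integrable lborel (\<lambda>x. tpow (s - 1) (v - y x) * of_real (h x))" (is ?int)
    and "s * J (s - 1) 0 v = J s 1 v"
proof -
  define \<sigma> where "\<sigma> = Re s"
  have \<sigma>: "0 < \<sigma>" "\<sigma> \<le> 1" using assms by (auto simp: \<sigma>_def)
  obtain M where M: "\<And>x. x \<in> C \<Longrightarrow> \<bar>v - y x\<bar> \<le> M"
  proof -
    have "compact ((\<lambda>x. v - y x) ` C)"
      by (intro compact_continuous_image continuous_intros y_continuous C_compact)
    then have "bounded ((\<lambda>x. v - y x) ` C)" by (rule compact_imp_bounded)
    then show ?thesis using that unfolding bounded_iff by auto
  qed
  define u where "u x = v - y x" for x
  define \<delta> where "\<delta> i = inverse (real (Suc i))" for i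
  have \<delta>: "0 < \<delta> i" "\<delta> i \<le> 1" for i by (auto simp: \<delta>_def inverse_le_1_iff)
  have \<delta>0: "\<delta> \<longlonglongrightarrow> 0" unfolding \<delta>_def by (rule LIMSEQ_inverse_real_of_nat)
  have cu: "continuous_on UNIV u" unfolding u_def by (intro continuous_intros y_continuous)
  have [measurable]: "u \<in> borel_measurable borel" "h \<in> borel_measurable borel" "hs 1 \<in> borel_measurable borel"
    using cu hs_continuous[of UNIV 0] hs_continuous[of UNIV 1] by (auto intro: borel_measurable_continuous_onI)
  have sq: "0 < (max r 0)\<^sup>2 + \<delta> i" for i and r :: real using \<delta>(1)[of i] by (simp add: add_nonneg_pos)
  define w where "w z i r = z * of_real (max r 0) * of_real ((max r 0)\<^sup>2 + \<delta> i) powr (z / 2 - 1)"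
    for z :: complex and i r
  have w: "(rpow (\<delta> i) z has_vector_derivative w z i r) (at r)" for z i r
    unfolding w_def by (rule rpow_has_vector_derivative[OF \<delta>(1)])
  have cw: "continuous_on UNIV (w z i)" for z i
  proof -
    have nz: "complex_of_real ((max r 0)\<^sup>2 + \<delta> i) \<noteq> 0" for r
      using sq[of r i] by (simp del: of_real_add)
    show ?thesis
      unfolding w_def
      by (intro continuous_on_mult continuous_on_powr_complex continuous_on_of_real continuous_on_add
          continuous_on_power continuous_on_max continuous_on_const continuous_on_id)
        (use nz less_imp_le[OF sq[where i = i]] in \<open>auto simp del: of_real_add\<close>)
  qed
  have ibp: "integral\<^sup>L lborel (\<lambda>x. w z i (u x) * of_real (h x))
      = integral\<^sup>L lborel (\<lambda>x. rpow (\<delta> i) z (u x) * of_real (hs 1 x))" for z i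
    using by_parts[where j = 0 and v = v and K = "rpow (\<delta> i) z" and K' = "w z i", OF w cw]
    by (simp add: u_def)
  have crp: "continuous_on UNIV (rpow (\<delta> i) z)" for i z
    using w by (intro continuous_at_imp_continuous_on ballI has_vector_derivative_continuous) auto
  \<comment> \<open>A dominating function for the side on which the derivative has been moved to
    \<open>h\<close>; it is independent of the regularisation since \<delta> \<le> 1.\<close>
  define B where "B x = (M\<^sup>2 + 1) powr (\<sigma> / 2) * \<bar>hs 1 x\<bar>" for x
  have B: "norm (rpow (\<delta> i) z (u x) * of_real (hs 1 x)) \<le> B x" if "Re z = \<sigma>" for i z x
  proof (cases "x \<in> C")
    case True
    have "(max (u x) 0)\<^sup>2 \<le> M\<^sup>2"
      using M[OF True] by (intro power_mono) (auto simp: u_def)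
    then have "((max (u x) 0)\<^sup>2 + \<delta> i) powr (\<sigma> / 2) \<le> (M\<^sup>2 + 1) powr (\<sigma> / 2)"
      using \<sigma> \<delta>[of i] by (intro powr_mono2) auto
    moreover have "norm (rpow (\<delta> i) z (u x)) = ((max (u x) 0)\<^sup>2 + \<delta> i) powr (\<sigma> / 2)"
      unfolding rpow_def using sq[of "u x" i] that by (subst norm_powr_real_powr) auto
    ultimately show ?thesis by (simp add: B_def norm_mult mult_right_mono)
  qed (simp add: hs_supp B_def)
  have intB: "integrable lborel B"
    unfolding B_def by (rule integrable_continuous_compact[OF _ C_compact])
      (auto intro!: continuous_intros hs_continuous simp: hs_supp)
  have int_w: "integrable lborel (\<lambda>x. w z i (u x) * of_real (h x))" for z i
    by (rule integrable_continuous_compact[OF _ C_compact])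
      (use hs_continuous[of UNIV 0] in \<open>auto intro!: continuous_intros continuous_on_compose2[OF cw cu] simp: h_supp\<close>)
  define wr where "wr i r = \<sigma> * max r 0 * ((max r 0)\<^sup>2 + \<delta> i) powr (\<sigma> / 2 - 1)" for i r
  have w_real: "w (of_real \<sigma>) i r = of_real (wr i r)" for i r
  proof -
    have e: "complex_of_real \<sigma> / 2 - 1 = of_real (\<sigma> / 2 - 1)" by simp
    show ?thesis
      unfolding w_def wr_def e powr_of_real[OF less_imp_le[OF sq]] by (simp only: of_real_mult)
  qed
  have norm_w: "norm (w z i r) = norm z / \<sigma> * wr i r" if "Re z = \<sigma>" for z i r
  proof -
    have "norm (complex_of_real ((max r 0)\<^sup>2 + \<delta> i) powr (z / 2 - 1)) = ((max r 0)\<^sup>2 + \<delta> i) powr (\<sigma> / 2 - 1)"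
      using sq[of r i] that by (subst norm_powr_real_powr) auto
    then show ?thesis using \<sigma> by (simp add: w_def wr_def norm_mult)
  qed
  have wr_nonneg: "wr i r \<ge> 0" for i r using \<sigma> by (simp add: wr_def)
  \<comment> \<open>The exponent \<sigma>/2 - 1 is negative, so the regularised weight lies below
    its limit; the limit is then a dominating function as soon as it is known to be
    integrable.\<close>
  have wr_le: "wr i r \<le> \<sigma> * max r 0 powr (\<sigma> - 1)" for i r
  proof (cases "r > 0")
    case True
    have "(r\<^sup>2 + \<delta> i) powr (\<sigma> / 2 - 1) \<le> (r\<^sup>2) powr (\<sigma> / 2 - 1)"
      using True \<delta>(1)[of i] \<sigma> by (intro powr_mono2') auto
    also have "(r\<^sup>2) powr (\<sigma> / 2 - 1) = r powr (\<sigma> - 2)"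
      using True by (simp add: powr_powr flip: powr_numeral)
    finally have "wr i r \<le> \<sigma> * (r * r powr (\<sigma> - 2))"
      using True \<sigma> by (simp add: wr_def)
    also have "r * r powr (\<sigma> - 2) = r powr (\<sigma> - 1)"
      using True powr_add[of r 1 "\<sigma> - 2"] by simp
    finally show ?thesis using True by simp
  qed (simp add: wr_def max_def)
  have lim_base: "(\<lambda>i. (max r 0)\<^sup>2 + \<delta> i) \<longlonglongrightarrow> (max r 0)\<^sup>2" for r
    using tendsto_add[OF tendsto_const \<delta>0, of "(max r 0)\<^sup>2"] by simp
  have w_lim: "(\<lambda>i. w z i r) \<longlonglongrightarrow> z * tpow (z - 1) r" for z r
  proof (cases "r > 0")
    case True
    have np: "complex_of_real ((max r 0)\<^sup>2) \<notin> \<real>\<^sub>\<le>\<^sub>0"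
      using True by (simp add: complex_nonpos_Reals_iff del: of_real_power)
    have "(\<lambda>i. complex_of_real ((max r 0)\<^sup>2 + \<delta> i) powr (z / 2 - 1)) \<longlonglongrightarrow> of_real ((max r 0)\<^sup>2) powr (z / 2 - 1)"
      by (rule tendsto_powr_complex[OF np tendsto_of_real[OF lim_base] tendsto_const])
    then have "(\<lambda>i. w z i r) \<longlonglongrightarrow> z * of_real (max r 0) * of_real ((max r 0)\<^sup>2) powr (z / 2 - 1)"
      unfolding w_def by (intro tendsto_mult tendsto_const)
    moreover have "complex_of_real (max r 0) * of_real ((max r 0)\<^sup>2) powr (z / 2 - 1) = tpow (z - 1) r"
    proof -
      have "complex_of_real (r\<^sup>2) powr (z / 2 - 1) = exp ((z / 2 - 1) * of_real (ln (r\<^sup>2)))"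
        using True by (simp add: powr_def Ln_of_real del: of_real_power)
      also have "\<dots> = exp ((z - 2) * of_real (ln r))"
        using True by (simp add: ln_realpow algebra_simps)
      finally have "complex_of_real r * of_real (r\<^sup>2) powr (z / 2 - 1)
          = exp (of_real (ln r)) * exp ((z - 2) * of_real (ln r))"
        using True by (simp add: exp_of_real)
      also have "\<dots> = exp ((z - 1) * of_real (ln r))"
        by (simp flip: exp_add add: algebra_simps)
      also have "\<dots> = tpow (z - 1) r"
        using True by (simp add: tpow_pos powr_def Ln_of_real)
      finally show ?thesis using True by simp
    qed
    ultimately show ?thesis by (simp add: mult.assoc)
  qed (simp add: w_def tpow_nonpos max_def)
  have rp_lim: "(\<lambda>i. rpow (\<delta> i) s r) \<longlonglongrightarrow> tpow s r" for r
  proof (cases "r > 0")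
    case True
    have np: "complex_of_real ((max r 0)\<^sup>2) \<notin> \<real>\<^sub>\<le>\<^sub>0"
      using True by (simp add: complex_nonpos_Reals_iff del: of_real_power)
    have "(\<lambda>i. rpow (\<delta> i) s r) \<longlonglongrightarrow> of_real ((max r 0)\<^sup>2) powr (s / 2)"
      unfolding rpow_def
      by (rule tendsto_powr_complex[OF np tendsto_of_real[OF lim_base] tendsto_const])
    moreover have "complex_of_real (r\<^sup>2) powr (s / 2) = tpow s r"
      using True by (simp add: powr_def tpow_pos Ln_of_real ln_realpow del: of_real_power)
    ultimately show ?thesis using True by simp
  next
    case False
    then have "max r 0 = 0" by simp
    then show ?thesis
      using tendsto_powr_complex_0[OF tendsto_of_real[OF \<delta>0, unfolded of_real_0] tendsto_const, of "s / 2"] assms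
      by (simp add: rpow_def tpow_def)
  qed
  have wrm [measurable]: "wr i \<in> borel_measurable borel" for i unfolding wr_def by measurable
  define g where "g x = \<sigma> * max (u x) 0 powr (\<sigma> - 1) * h x" for x
  have [measurable]: "g \<in> borel_measurable borel" unfolding g_def by measurable
  have g_nonneg: "g x \<ge> 0" for x using \<sigma> h_nonneg by (simp add: g_def)
  have int_wr: "integrable lborel (\<lambda>x. wr i (u x) * h x)" for i
    using integrable_Re[OF int_w[of "of_real \<sigma>" i]] by (simp add: w_real)
  have wr_lim: "(\<lambda>i. wr i (u x) * h x) \<longlonglongrightarrow> g x" for x
  proof -
    have "(\<lambda>i. complex_of_real (wr i (u x))) \<longlonglongrightarrow> of_real (\<sigma> * max (u x) 0 powr (\<sigma> - 1))"
      using w_lim[of "of_real \<sigma>" "u x"] tpow_of_real[of "\<sigma> - 1" "u x"] by (simp add: w_real)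
    from tendsto_mult[OF this[unfolded tendsto_of_real_iff] tendsto_const, of "h x"]
    show ?thesis by (simp add: g_def)
  qed
  \<comment> \<open>The sign of \<open>h\<close> enters here: the regularised integrands are
    nonnegative, and after integration by parts their integrals are bounded by that of
    \<open>B\<close>, uniformly in i.\<close>
  have "(\<integral>\<^sup>+x. ennreal (g x) \<partial>lborel) = (\<integral>\<^sup>+x. liminf (\<lambda>i. ennreal (wr i (u x) * h x)) \<partial>lborel)"
    using lim_imp_Liminf[OF _ tendsto_ennrealI[OF wr_lim]] by (intro nn_integral_cong) simp
  also have "\<dots> \<le> liminf (\<lambda>i. \<integral>\<^sup>+x. ennreal (wr i (u x) * h x) \<partial>lborel)"
    by (intro nn_integral_liminf) measurable
  also have "\<dots> \<le> liminf (\<lambda>i::nat. ennreal (integral\<^sup>L lborel B))"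
  proof (intro Liminf_mono always_eventually allI)
    fix i
    have "(\<integral>\<^sup>+x. ennreal (wr i (u x) * h x) \<partial>lborel) = ennreal (integral\<^sup>L lborel (\<lambda>x. wr i (u x) * h x))"
      using wr_nonneg h_nonneg by (intro nn_integral_eq_integral int_wr) auto
    also have "integral\<^sup>L lborel (\<lambda>x. wr i (u x) * h x) = Re (integral\<^sup>L lborel (\<lambda>x. w (of_real \<sigma>) i (u x) * of_real (h x)))"
      using integral_Re[OF int_w[of "of_real \<sigma>" i]] by (simp add: w_real)
    also have "\<dots> = Re (integral\<^sup>L lborel (\<lambda>x. rpow (\<delta> i) (of_real \<sigma>) (u x) * of_real (hs 1 x)))"
      by (simp add: ibp)
    also have "\<dots> \<le> norm (integral\<^sup>L lborel (\<lambda>x. rpow (\<delta> i) (of_real \<sigma>) (u x) * of_real (hs 1 x)))"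
      by (rule complex_Re_le_cmod)
    also have "\<dots> \<le> integral\<^sup>L lborel B"
      by (rule Bochner_Integration.integral_norm_bound_integral[OF integrable_continuous_compact[OF _ C_compact] intB])
        (auto intro!: continuous_intros continuous_on_compose2[OF crp cu] hs_continuous B[of "of_real \<sigma>", simplified] simp: hs_supp)
    finally show "(\<integral>\<^sup>+x. ennreal (wr i (u x) * h x) \<partial>lborel) \<le> ennreal (integral\<^sup>L lborel B)"
      by (simp add: ennreal_leI)
  qed
  also have "\<dots> < \<infinity>" by (simp add: Liminf_const)
  finally have int_g: "integrable lborel g"
    using g_nonneg by (intro integrableI_nonneg) auto
  have tm [measurable]: "(\<lambda>x. tpow (s - 1) (u x)) \<in> borel_measurable borel"
    unfolding tpow_def powr_def by measurable
  have norm_t: "norm (tpow (s - 1) (u x) * of_real (h x)) = g x / \<sigma>" for x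
    using \<sigma> h_nonneg[of x] by (simp add: norm_mult norm_tpow g_def \<sigma>_def)
  have "integrable lborel (\<lambda>x. tpow (s - 1) (u x) * of_real (h x))"
    by (rule Bochner_Integration.integrable_bound[OF integrable_divide_zero[OF int_g, of \<sigma>]])
      (use g_nonneg \<sigma> in \<open>auto simp: norm_t\<close>)
  then show ?int by (simp add: u_def)
  \<comment> \<open>With \<open>g\<close> integrable, dominated convergence passes to the limit on
    both sides of the regularised integration by parts.\<close>
  have L1: "(\<lambda>i. integral\<^sup>L lborel (\<lambda>x. w s i (u x) * of_real (h x)))
      \<longlonglongrightarrow> integral\<^sup>L lborel (\<lambda>x. s * tpow (s - 1) (u x) * of_real (h x))"
  proof (rule integral_dominated_convergence[where w = "\<lambda>x. norm s / \<sigma> * g x"])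
    show "AE x in lborel. (\<lambda>i. w s i (u x) * of_real (h x)) \<longlonglongrightarrow> s * tpow (s - 1) (u x) * of_real (h x)"
      by (intro AE_I2 tendsto_mult w_lim tendsto_const)
    show "AE x in lborel. norm (w s i (u x) * of_real (h x)) \<le> norm s / \<sigma> * g x" for i
    proof (intro AE_I2)
      fix x
      have "norm (w s i (u x) * of_real (h x)) = norm s / \<sigma> * (wr i (u x) * h x)"
        using h_nonneg[of x] norm_w[of s i "u x"] by (simp add: norm_mult \<sigma>_def)
      also have "\<dots> \<le> norm s / \<sigma> * g x"
        unfolding g_def using wr_le[of i "u x"] h_nonneg[of x] \<sigma>
        by (intro mult_left_mono mult_right_mono) auto
      finally show "norm (w s i (u x) * of_real (h x)) \<le> norm s / \<sigma> * g x" .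
    qed
  qed (use int_w[of s] int_g in \<open>auto intro: borel_measurable_integrable\<close>)
  have L2: "(\<lambda>i. integral\<^sup>L lborel (\<lambda>x. rpow (\<delta> i) s (u x) * of_real (hs 1 x)))
      \<longlonglongrightarrow> integral\<^sup>L lborel (\<lambda>x. tpow s (u x) * of_real (hs 1 x))"
  proof (rule integral_dominated_convergence[where w = B])
    show "AE x in lborel. (\<lambda>i. rpow (\<delta> i) s (u x) * of_real (hs 1 x)) \<longlonglongrightarrow> tpow s (u x) * of_real (hs 1 x)"
      by (intro AE_I2 tendsto_mult rp_lim tendsto_const)
    show "(\<lambda>x. tpow s (u x) * complex_of_real (hs 1 x)) \<in> borel_measurable lborel"
      unfolding tpow_def powr_def by measurable
    show "(\<lambda>x. rpow (\<delta> i) s (u x) * complex_of_real (hs 1 x)) \<in> borel_measurable lborel" for i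
      unfolding rpow_def powr_def by measurable
  qed (use B intB in \<open>auto simp: \<sigma>_def\<close>)
  have "integral\<^sup>L lborel (\<lambda>x. s * tpow (s - 1) (u x) * of_real (h x))
      = integral\<^sup>L lborel (\<lambda>x. tpow s (u x) * of_real (hs 1 x))"
    by (rule LIMSEQ_unique[OF L1]) (use L2 in \<open>simp add: ibp\<close>)
  then show "s * J (s - 1) 0 v = J s 1 v" by (simp add: J_def u_def mult.assoc)
qed

text \<open>Each integration by parts produces a factor that is absorbed by s / Gamma(s + 1) = 1 /
  Gamma(s). The right-hand side has no poles, as the reciprocal Gamma function is entire, and it
  makes sense for Re s > -k, where it is the continuation.\<close>

lemma J_continuation:
  assumes "Re s > 0"
  shows "rGamma s * J (s - 1) 0 v = rGamma (s + of_nat (Suc k)) * J (s + of_nat k) (Suc k) v"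
proof (induction k)
  case 0
  have "s * J (s - 1) 0 v = J s 1 v"
    using J_base(2)[of s v] J_step[of s 0 v] assms by (cases "Re s \<le> 1") auto
  then have "rGamma (s + 1) * (s * J (s - 1) 0 v) = rGamma (s + 1) * J s 1 v" by simp
  moreover have "rGamma (s + 1) * (s * J (s - 1) 0 v) = rGamma s * J (s - 1) 0 v"
    by (simp flip: rGamma_plus1[of s])
  ultimately show ?case by simp
next
  case (Suc k)
  define z where "z = s + of_nat (Suc k)"
  have a: "z * J (s + of_nat k) (Suc k) v = J z (Suc (Suc k)) v"
    using J_step[of z "Suc k" v] assms by (simp add: z_def)
  have "rGamma s * J (s - 1) 0 v = rGamma z * J (s + of_nat k) (Suc k) v"
    using Suc by (simp add: z_def)
  also have "\<dots> = rGamma (z + 1) * (z * J (s + of_nat k) (Suc k) v)"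
    by (simp flip: rGamma_plus1[of z])
  also have "\<dots> = rGamma (z + 1) * J z (Suc (Suc k)) v" by (simp only: a)
  also have "z + 1 = s + of_nat (Suc (Suc k))" by (simp add: z_def)
  finally show ?case by (simp only: z_def)
qed

lemma J_holomorphic: "(\<lambda>s. J (s + of_nat k) j v) holomorphic_on {s. Re s > - real k}"
proof -
  obtain a b where ab: "C \<subseteq> cbox a b" by (rule compact_subset_cbox[OF C_compact])
  let ?U = "{s. Re s > - real k}"
  have "(\<lambda>s. integral (cbox a b) (\<lambda>x. tpow (s + of_nat k) (v - y x) * of_real (hs j x))) holomorphic_on ?U"
  proof (rule leibniz_rule_holomorphic)
    fix s x assume "s \<in> ?U"
    show "((\<lambda>s. tpow (s + of_nat k) (v - y x) * of_real (hs j x)) has_field_derivative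
        tpow (s + of_nat k) (v - y x) * of_real (ln (max (v - y x) 0)) * of_real (hs j x)) (at s within ?U)"
      by (rule DERIV_cmult_right[OF DERIV_shift[THEN iffD1, OF tpow_has_field_derivative, THEN DERIV_subset]])
        auto
  next
    fix s assume "s \<in> ?U"
    then show "(\<lambda>x. tpow (s + of_nat k) (v - y x) * of_real (hs j x)) integrable_on cbox a b"
      by (intro integrable_continuous continuous_on_subset[OF integrand_continuous]) auto
  next
    have "continuous_on (?U \<times> cbox a b) (\<lambda>p. (\<lambda>(s, r). tpow s r * of_real (ln (max r 0)))
        (fst p + of_nat k, v - y (snd p)))"
      by (rule continuous_on_compose2[OF continuous_on_tpow_ln])
        (auto intro!: continuous_intros continuous_on_compose2[OF y_continuous[of UNIV]])
    moreover have "continuous_on (?U \<times> cbox a b) (\<lambda>p. complex_of_real (hs j (snd p)))"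
      by (intro continuous_intros continuous_on_compose2[OF hs_continuous[of UNIV]]) auto
    ultimately show "continuous_on (?U \<times> cbox a b)
        (\<lambda>(s, x). tpow (s + of_nat k) (v - y x) * of_real (ln (max (v - y x) 0)) * of_real (hs j x))"
      unfolding case_prod_unfold fst_conv snd_conv by (rule continuous_on_mult)
  qed (simp add: convex_halfspace_Re_gt)
  moreover have "hs j x = 0" if "x \<notin> cbox a b" for x using that ab hs_supp by blast
  then have "integral (cbox a b) (\<lambda>x. tpow (s + of_nat k) (v - y x) * of_real (hs j x)) = J (s + of_nat k) j v"
    if "s \<in> ?U" for s
    unfolding J_def using that
    by (intro integral_lborel_continuous_compact(2)[symmetric] integrand_continuous) auto
  ultimately show ?thesis by (rule holomorphic_transform)
qed

end

subsection \<open>The chart of the hyperboloid\<close>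

definition dens :: "real ^ 'n \<Rightarrow> real" where "dens x = 1 / sqrt (1 + (norm x)\<^sup>2)"

text \<open>This is [z, w] for the points with coordinates \<open>a\<close> and \<open>x\<close>,
  hence the hyperbolic cosine of their distance.\<close>

definition hy :: "real ^ 'n \<Rightarrow> real ^ 'n \<Rightarrow> real" where
  "hy a x = sqrt (1 + (norm a)\<^sup>2) * sqrt (1 + (norm x)\<^sup>2) - a \<bullet> x"

lemma one_plus_norm2_pos: "0 < 1 + (norm x)\<^sup>2"
  by (simp add: add_pos_nonneg)

lemma dens_pos: "dens x > 0" by (simp add: dens_def one_plus_norm2_pos)

lemma dens_smooth: "smooth_on UNIV (dens :: real ^ 'n \<Rightarrow> real)"
  unfolding dens_def[abs_def]
  by (intro smooth_on_divide smooth_on_const smooth_on_sqrt smooth_on_add smooth_on_norm2 open_UNIV)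
    (auto simp: one_plus_norm2_pos)

lemma hy_smooth: "smooth_on UNIV (hy a)"
  unfolding hy_def[abs_def] inner_commute[of a]
  by (intro smooth_on_diff smooth_on_mult smooth_on_inner smooth_on_const smooth_on_sqrt smooth_on_add smooth_on_norm2 open_UNIV)
    (auto simp: one_plus_norm2_pos)

lemma mink_alt: "mink z w = fst z * fst w - snd z \<bullet> snd w"
  by (simp add: mink_def inner_vec_def)

lemma mink_hchart: "mink (hchart a) (hchart x) = hy a x"
  by (simp add: mink_alt hchart_def hy_def)

lemma hyp_iff_hchart: "z \<in> hyp \<longleftrightarrow> z = hchart (snd z)"
proof
  assume "z \<in> hyp"
  then have "(fst z)\<^sup>2 = 1 + (norm (snd z))\<^sup>2" "fst z > 0"
    by (auto simp: hyp_def mink_alt power2_eq_square power2_norm_eq_inner[unfolded power2_eq_square])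
  then have "fst z = sqrt (1 + (norm (snd z))\<^sup>2)"
    by (metis abs_of_pos real_sqrt_abs)
  then show "z = hchart (snd z)" by (simp add: hchart_def prod_eq_iff)
next
  assume "z = hchart (snd z)"
  then have "fst z = sqrt (1 + (norm (snd z))\<^sup>2)" by (simp add: hchart_def prod_eq_iff)
  moreover have "0 < sqrt (1 + (norm (snd z))\<^sup>2)" by (simp add: one_plus_norm2_pos)
  ultimately show "z \<in> hyp"
    by (simp add: hyp_def mink_alt power2_norm_eq_inner one_plus_norm2_pos less_imp_le)
qed

lemma hchart_in_hyp [simp]: "hchart a \<in> hyp"
  by (simp add: hyp_iff_hchart) (simp add: hchart_def)

text \<open>A reverse Cauchy-Schwarz inequality: (1 + |a| |x|)^2 \<le> (1 + |a|^2) (1 + |x|^2),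
  because 2 |a| |x| \<le> |a|^2 + |x|^2.\<close>

lemma hy_ge_1: "hy a x \<ge> 1"
proof -
  have "(1 + norm a * norm x)\<^sup>2 \<le> (1 + (norm a)\<^sup>2) * (1 + (norm x)\<^sup>2)"
    using sum_squares_bound[of "norm a" "norm x"]
    by (simp add: power2_sum power_mult_distrib algebra_simps)
  then have "1 + norm a * norm x \<le> sqrt ((1 + (norm a)\<^sup>2) * (1 + (norm x)\<^sup>2))"
    by (rule real_le_rsqrt)
  moreover have "a \<bullet> x \<le> norm a * norm x" by (rule norm_cauchy_schwarz)
  ultimately show ?thesis by (simp add: hy_def real_sqrt_mult)
qed

lemma hchart_has_derivative:
  "(hchart has_derivative (\<lambda>v. ((x \<bullet> v) / sqrt (1 + (norm x)\<^sup>2), v))) (at x)"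
proof -
  have "((\<lambda>x. sqrt (1 + x \<bullet> x)) has_derivative (\<lambda>v. (x \<bullet> v) / sqrt (1 + x \<bullet> x))) (at x)"
    using one_plus_norm2_pos[of x]
    by (auto intro!: derivative_eq_intros simp: power2_norm_eq_inner inner_commute field_simps fun_eq_iff)
  then show ?thesis
    unfolding hchart_def[abs_def] power2_norm_eq_inner
    by (intro has_derivative_Pair has_derivative_ident)
qed

text \<open>The matrix I - c x x^T; the Gram matrix of the chart has this form with c = 1 / (1 +
  |x|^2).\<close>

definition rank1 :: "real \<Rightarrow> real ^ 'n \<Rightarrow> real ^ 'n ^ 'n" where
  "rank1 c x = (\<chi> i j. (if i = j then 1 else 0) - c * (x $ i * x $ j))"

lemma rank1_mult_vec: "rank1 c x *v w = w - (c * (x \<bullet> w)) *\<^sub>R x"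
proof -
  have "(\<Sum>j\<in>UNIV. ((if i = j then 1 else 0) - c * (x $ i * x $ j)) * w $ j)
      = w $ i - c * (x \<bullet> w) * x $ i" for i
  proof -
    have "(\<Sum>j\<in>UNIV. ((if i = j then 1 else 0) - c * (x $ i * x $ j)) * w $ j)
      = (\<Sum>j\<in>UNIV. (if i = j then w $ j else 0)) - (\<Sum>j\<in>UNIV. c * x $ i * (x $ j * w $ j))"
      unfolding sum_subtractf[symmetric] by (intro sum.cong) (auto simp: algebra_simps)
    then show ?thesis by (simp add: inner_vec_def flip: sum_distrib_left)
  qed
  then show ?thesis by (simp add: vec_eq_iff rank1_def matrix_vector_mult_def)
qed

text \<open>Conjugation with an orthogonal matrix that turns x into a multiple of a basis vector
  makes the matrix diagonal.\<close>

lemma det_rank1: "det (rank1 c x) = 1 - c * (norm x)\<^sup>2" for x :: "real ^ 'n"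
proof -
  obtain k :: 'n where True by blast
  define b :: "real ^ 'n" where "b = norm x *\<^sub>R axis k 1"
  have "norm x = norm b" by (simp add: b_def norm_axis_1)
  then obtain f where f: "orthogonal_transformation f" "f x = b"
    by (rule orthogonal_transformation_exists)
  define M where "M = matrix f"
  have M: "orthogonal_matrix M" "f = (*v) M"
    using f(1) by (auto simp: M_def orthogonal_transformation_matrix matrix_works fun_eq_iff)
  have "M ** rank1 c x ** transpose M = rank1 c b"
  proof (subst matrix_eq, rule allI)
    fix w
    have MT: "M *v (transpose M *v w) = w"
      using M(1) by (simp only: orthogonal_matrix_def matrix_vector_mul_assoc matrix_vector_mul_lid)
    have "(M ** rank1 c x ** transpose M) *v w = M *v (rank1 c x *v (transpose M *v w))"
      by (simp flip: matrix_vector_mul_assoc)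
    also have "\<dots> = w - (c * (x \<bullet> (transpose M *v w))) *\<^sub>R (M *v x)"
      by (simp add: rank1_mult_vec matrix_vector_mult_diff_distrib MT matrix_vector_mult_scaleR
          del: transpose_matrix_vector)
    also have "x \<bullet> (transpose M *v w) = (M *v x) \<bullet> w"
      by (metis dot_lmul_matrix transpose_matrix_vector transpose_transpose)
    finally show "(M ** rank1 c x ** transpose M) *v w = rank1 c b *v w"
      using f(2) M(2) by (simp add: rank1_mult_vec)
  qed
  then have "det M * det (rank1 c x) * det M = det (rank1 c b)"
    by (metis det_mul det_transpose)
  moreover have "det M = 1 \<or> det M = -1" by (rule det_orthogonal_matrix[OF M(1)])
  ultimately have "det (rank1 c x) = det (rank1 c b)" by auto
  also have "\<dots> = (\<Prod>i\<in>UNIV. rank1 c b $ i $ i)"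
    by (rule det_diagonal) (auto simp: rank1_def b_def axis_def)
  also have "\<dots> = (\<Prod>i\<in>UNIV. if i = k then 1 - c * (norm x)\<^sup>2 else 1)"
    by (intro prod.cong) (auto simp: rank1_def b_def axis_def power2_eq_square)
  finally show ?thesis by simp
qed

lemma sqrt_det_hgram: "sqrt (det (hgram x)) = dens x"
proof -
  have "hgram x $ i $ j = rank1 (1 / (1 + (norm x)\<^sup>2)) x $ i $ j" for i j
  proof -
    have "hgram x $ i $ j = axis i 1 $ j - (x $ i / sqrt (1 + (norm x)\<^sup>2)) * (x $ j / sqrt (1 + (norm x)\<^sup>2))"
      by (simp add: hgram_def mink_alt inner_axis frechet_derivative_at[OF hchart_has_derivative, symmetric])
    also have "\<dots> = axis i 1 $ j - (x $ i * x $ j) / (1 + (norm x)\<^sup>2)"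
      using one_plus_norm2_pos[of x] by simp
    finally show ?thesis by (simp add: rank1_def axis_def)
  qed
  then have "hgram x = rank1 (1 / (1 + (norm x)\<^sup>2)) x" by (simp add: vec_eq_iff)
  then have "det (hgram x) = 1 / (1 + (norm x)\<^sup>2)"
    using one_plus_norm2_pos[of x] by (simp add: det_rank1 field_simps)
  then show ?thesis by (simp add: dens_def real_sqrt_divide)
qed

lemma hchart_measurable [measurable]: "hchart \<in> borel_measurable borel"
  using hchart_has_derivative
  by (intro borel_measurable_continuous_onI continuous_at_imp_continuous_on ballI has_derivative_continuous) blast

lemma dens_measurable [measurable]: "dens \<in> borel_measurable borel"
  by (intro borel_measurable_continuous_onI smooth_on_continuous_on dens_smooth)

lemma hmeasure_alt: "hmeasure = distr (density lborel (\<lambda>x. ennreal (dens x))) borel hchart"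
  by (simp add: hmeasure_def sqrt_det_hgram)

lemma sets_hmeasure [simp, measurable_cong]: "sets hmeasure = sets borel"
  and space_hmeasure [simp]: "space hmeasure = UNIV"
  by (simp_all add: hmeasure_def)

lemma nn_integral_hmeasure:
  assumes [measurable]: "\<phi> \<in> borel_measurable borel"
  shows "(\<integral>\<^sup>+z. \<phi> z \<partial>hmeasure) = (\<integral>\<^sup>+x. ennreal (dens x) * \<phi> (hchart x) \<partial>lborel)"
  unfolding hmeasure_alt by (subst nn_integral_distr, simp, simp, subst nn_integral_density) auto

lemma integral_hmeasure:
  fixes \<phi> :: "'n::finite mspace \<Rightarrow> complex"
  assumes [measurable]: "\<phi> \<in> borel_measurable borel"
  shows "integral\<^sup>L hmeasure \<phi> = integral\<^sup>L lborel (\<lambda>x. dens x *\<^sub>R \<phi> (hchart x))"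
  unfolding hmeasure_alt
  by (subst integral_distr, simp, simp, subst integral_density) (auto simp: less_imp_le[OF dens_pos])

lemma hball_alt: "t > 0 \<Longrightarrow> hball t (hchart a) = {w \<in> hyp. mink (hchart a) w < cosh t}"
proof -
  assume t: "t > 0"
  have "arcosh (mink (hchart a) w) < t \<longleftrightarrow> mink (hchart a) w < cosh t" if "w \<in> hyp" for w
  proof -
    have "mink (hchart a) w \<ge> 1"
      using that hy_ge_1 mink_hchart by (metis hyp_iff_hchart)
    then show ?thesis
      using arcosh_less_iff_real[of "mink (hchart a) w" "cosh t"] t
      by (simp add: arcosh_cosh_real cosh_real_ge_1)
  qed
  then show ?thesis by (auto simp: hball_def hdist_def)
qed

lemma mink_measurable [measurable]: "mink z \<in> borel_measurable borel"
  "(\<lambda>w. mink w w) \<in> borel_measurable borel"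
  unfolding mink_alt[abs_def]
  by (auto intro!: borel_measurable_continuous_onI continuous_intros)

lemma mink_minus_self:
  assumes "z \<in> hyp" "w \<in> hyp"
  shows "mink (exp t *\<^sub>R z - w) (exp t *\<^sub>R z - w) = 2 * exp t * (cosh t - mink z w)"
proof -
  have "mink (exp t *\<^sub>R z - w) (exp t *\<^sub>R z - w) = (exp t)\<^sup>2 * mink z z - 2 * exp t * mink z w + mink w w"
    by (simp add: mink_alt inner_diff_left inner_diff_right algebra_simps power2_eq_square inner_commute)
  also have "\<dots> = (exp t)\<^sup>2 - 2 * exp t * mink z w + 1" using assms by (simp add: hyp_def)
  also have "(exp t)\<^sup>2 + 1 = 2 * exp t * cosh t"
    by (simp add: cosh_def exp_minus field_simps power2_eq_square)
  then have "(exp t)\<^sup>2 - 2 * exp t * mink z w + 1 = 2 * exp t * cosh t - 2 * exp t * mink z w" by simp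
  finally show ?thesis by (simp add: algebra_simps)
qed

definition lift_fun :: "(real ^ 'n \<Rightarrow> real) \<Rightarrow> 'n mspace \<Rightarrow> complex" where
  "lift_fun g w = complex_of_real (g (snd w))"

text \<open>The indicator of the ball disappears into \<open>tpow\<close>, which vanishes where
  \<open>hy a x \<ge> cosh t\<close>; the factor \<open>2 * exp t\<close> splits off the power
  because it is a positive real.\<close>

lemma M_int_lift_fun:
  assumes g: "continuous_on UNIV g" and t: "t > 0"
  shows "M_int (lift_fun g) t (hchart a) s =
     of_real (2 * exp t * ((exp t - 1) / sinh t) ^ (CARD('n) - 2))
     * (1 / (of_real (exp t - 1) powr (2 * s + of_nat CARD('n) - 2))) * of_real (2 * exp t) powr (s - 1)
     * (rGamma s * integral\<^sup>L lborel (\<lambda>x::real^'n. tpow (s - 1) (cosh t - hy a x) * of_real (g x * dens x)))"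
proof -
  define \<phi> where "\<phi> w = indicator (hball t (hchart a)) w *\<^sub>R
      (of_real (mink (exp t *\<^sub>R hchart a - w) (exp t *\<^sub>R hchart a - w)) powr (s - 1) * lift_fun g w)"
    for w :: "'n mspace"
  have [measurable]: "g \<in> borel_measurable borel" using g by (rule borel_measurable_continuous_onI)
  have [measurable]: "snd \<in> borel \<rightarrow>\<^sub>M (borel :: (real^'n) measure)" "fst \<in> borel \<rightarrow>\<^sub>M (borel :: real measure)"
    by (auto intro!: borel_measurable_continuous_onI continuous_intros)
  have [measurable]: "{w \<in> hyp. mink (hchart a) w < cosh t} \<in> sets borel"
    unfolding hyp_def by measurable
  have [measurable]: "(\<lambda>w. mink (exp t *\<^sub>R hchart a - w) (exp t *\<^sub>R hchart a - w)) \<in> borel_measurable borel"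
    unfolding mink_alt by (auto intro!: borel_measurable_continuous_onI continuous_intros)
  have "\<phi> \<in> borel_measurable borel"
    unfolding \<phi>_def lift_fun_def hball_alt[OF t] powr_def by measurable
  from integral_hmeasure[OF this]
  have "(LINT w:hball t (hchart a)|hmeasure.
        of_real (mink (exp t *\<^sub>R hchart a - w) (exp t *\<^sub>R hchart a - w)) powr (s - 1) * lift_fun g w)
      = integral\<^sup>L lborel (\<lambda>x. dens x *\<^sub>R \<phi> (hchart x))"
    unfolding set_lebesgue_integral_def \<phi>_def .
  also have "(\<lambda>x. dens x *\<^sub>R \<phi> (hchart x))
      = (\<lambda>x. of_real (2 * exp t) powr (s - 1) * (tpow (s - 1) (cosh t - hy a x) * of_real (g x * dens x)))"
  proof
    fix x :: "real ^ 'n"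
    show "dens x *\<^sub>R \<phi> (hchart x)
      = of_real (2 * exp t) powr (s - 1) * (tpow (s - 1) (cosh t - hy a x) * of_real (g x * dens x))"
    proof (cases "hy a x < cosh t")
      case True
      have "\<phi> (hchart x) = complex_of_real (2 * exp t * (cosh t - hy a x)) powr (s - 1) * of_real (g x)"
        using True by (simp add: \<phi>_def hball_alt[OF t] mink_hchart mink_minus_self lift_fun_def) (simp add: hchart_def)
      also have "complex_of_real (2 * exp t * (cosh t - hy a x)) powr (s - 1)
          = of_real (2 * exp t) powr (s - 1) * of_real (cosh t - hy a x) powr (s - 1)"
        unfolding of_real_mult[of "2 * exp t"] using True by (intro powr_times_real) auto
      finally show ?thesis using True by (simp add: tpow_pos scaleR_conv_of_real)
    qed (simp add: \<phi>_def hball_alt[OF t] mink_hchart tpow_nonpos)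
  qed
  finally have eq: "(LINT w:hball t (hchart a)|hmeasure.
        of_real (mink (exp t *\<^sub>R hchart a - w) (exp t *\<^sub>R hchart a - w)) powr (s - 1) * lift_fun g w)
      = of_real (2 * exp t) powr (s - 1)
        * integral\<^sup>L lborel (\<lambda>x::real^'n. tpow (s - 1) (cosh t - hy a x) * of_real (g x * dens x))"
    by simp
  have "1 / Gamma s = rGamma s" by (simp add: rGamma_inverse_Gamma divide_inverse)
  then show ?thesis unfolding M_int_def eq by (simp only: mult.assoc) (simp only: ac_simps)
qed

lemma test_fun_lift_fun:
  fixes g :: "real ^ 'n \<Rightarrow> real"
  assumes "smooth_on UNIV g" "compact C" "\<And>x. x \<notin> C \<Longrightarrow> g x = 0"
  shows "test_fun (lift_fun g)"
proof -
  have "lift_fun g \<circ> hchart = (\<lambda>x. complex_of_real (g x))"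
    by (auto simp: lift_fun_def hchart_def)
  then have "Ck k (lift_fun g \<circ> hchart)" for k
    using assms(1) Ck_complex_of_real[of k g] by (simp add: smooth_on_def)
  moreover have "compact (closure {z \<in> hyp. lift_fun g z \<noteq> 0})"
  proof -
    have "continuous_on C hchart"
      using hchart_has_derivative
      by (intro continuous_at_imp_continuous_on ballI has_derivative_continuous) blast
    then have "compact (hchart ` C)" using assms(2) by (rule compact_continuous_image)
    moreover have "{z \<in> hyp. lift_fun g z \<noteq> 0} \<subseteq> hchart ` C"
    proof
      fix z assume z: "z \<in> {z \<in> hyp. lift_fun g z \<noteq> 0}"
      then have "snd z \<in> C" using assms(3) by (auto simp: lift_fun_def)
      then show "z \<in> hchart ` C" using z hyp_iff_hchart[of z] by blast
    qed
    ultimately show ?thesis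
      unfolding compact_closure by (rule bounded_subset[OF compact_imp_bounded])
  qed
  ultimately show ?thesis by (simp add: test_fun_def)
qed

subsection \<open>The means and their analytic continuation\<close>

text \<open>The positive factor by which the means differ from the plain fractional integrals \<open>Sr\<close> below.\<close>

definition coef :: "nat \<Rightarrow> real \<Rightarrow> real \<Rightarrow> real" where
  "coef n t \<alpha> = 2 * exp t * ((exp t - 1) / sinh t) ^ (n - 2)
     * (exp t - 1) powr (- (2 * \<alpha> + real n - 2)) * (2 * exp t) powr (\<alpha> - 1)"

text \<open>All radii used later keep cosh t in a fixed compact interval to the right of 1, so the
  normalising factor never affects the powers of the scale.\<close>

lemma coef_lower_bound:
  assumes "1 < V0"
  shows "\<exists>c>0. \<forall>v\<in>{V0..V1}. coef n (arcosh v) \<alpha> \<ge> c"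
proof (cases "V0 \<le> V1")
  case True
  have pos: "arcosh v > 0" if "v \<in> {V0..V1}" for v using assms that by simp
  have coef_pos: "coef n t \<alpha> > 0" if "t > 0" for t using that by (simp add: coef_def)
  have "continuous_on {V0..V1} (\<lambda>v. coef n (arcosh v) \<alpha>)"
    unfolding coef_def
    by (intro continuous_intros continuous_on_powr) (use assms pos in \<open>auto simp: order.strict_iff_order\<close>)
  then obtain v0 where v0: "v0 \<in> {V0..V1}" "\<And>v. v \<in> {V0..V1} \<Longrightarrow> coef n (arcosh v0) \<alpha> \<le> coef n (arcosh v) \<alpha>"
    using continuous_attains_inf[of "{V0..V1}" "\<lambda>v. coef n (arcosh v) \<alpha>"] True by auto
  then show ?thesis using coef_pos[OF pos[OF v0(1)]] by blast
qed (auto intro: exI[of _ 1])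

locale chart_transport = transport "hy a" "\<lambda>x. g x * dens x" Y C S
  for a :: "real ^ 'n::finite" and g Y C S +
  assumes g_smooth: "smooth_on UNIV g"
begin

text \<open>The continued integral of order \<alpha> after k + 1 integrations by parts: the exponent
  is \<alpha> - 1 + (k + 1), and the kernel is continuous once \<alpha> + k > 0.\<close>

definition Sr :: "real \<Rightarrow> nat \<Rightarrow> real \<Rightarrow> real" where
  "Sr \<alpha> k v = rGamma (\<alpha> + real (Suc k))
     * integral\<^sup>L lborel (\<lambda>x. max (v - hy a x) 0 powr (\<alpha> + real k) * hs (Suc k) x)"

lemma J_of_real:
  "J (of_real r) j v = of_real (integral\<^sup>L lborel (\<lambda>x. max (v - hy a x) 0 powr r * hs j x))"
proof -
  have "(\<lambda>x. tpow (of_real r) (v - hy a x) * complex_of_real (hs j x))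
      = (\<lambda>x. of_real (max (v - hy a x) 0 powr r * hs j x))"
    by (simp add: tpow_of_real)
  then show ?thesis by (simp only: J_def integral_complex_of_real)
qed

text \<open>After k + 1 integrations by parts the integral is holomorphic for Re s > -k, and k \<ge>
  (n - 1)/2 puts the half plane of \<open>M_op\<close> inside this region. By the identity theorem
  every admissible continuation has the same value at \<alpha>, so the definite description denotes
  it.\<close>

lemma M_op_eq:
  assumes \<alpha>: "\<alpha> > (1 - real CARD('n)) / 2" and k: "real k \<ge> (real CARD('n) - 1) / 2" and t: "t > 0"
  shows "M_op (of_real \<alpha>) t (lift_fun g) (hchart a) = of_real (coef CARD('n) t \<alpha> * Sr \<alpha> k (cosh t))"
proof -
  let ?H = "{s. Re s > (1 - real CARD('n)) / 2}"
  define P where "P s = complex_of_real (2 * exp t * ((exp t - 1) / sinh t) ^ (CARD('n) - 2))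
     * (1 / (of_real (exp t - 1) powr (2 * s + of_nat CARD('n) - 2))) * of_real (2 * exp t) powr (s - 1)" for s
  define F where "F s = P s * (rGamma (s + of_nat (Suc k)) * J (s + of_nat k) (Suc k) (cosh t))" for s
  have t0: "exp t - 1 > 0" using t by simp
  have sub: "?H \<subseteq> {s. Re s > - real k}" using k by auto
  have "complex_of_real (exp t - 1) powr z \<noteq> 0" for z using t0 by (simp add: powr_def)
  then have "P holomorphic_on ?H"
    unfolding P_def using t0
    by (intro holomorphic_intros) auto
  then have F: "F holomorphic_on ?H"
    unfolding F_def
    by (intro holomorphic_on_mult holomorphic_rGamma' holomorphic_on_subset[OF J_holomorphic sub])
      (auto intro!: holomorphic_intros)
  have FM: "F s = M_int (lift_fun g) t (hchart a) s" if "Re s > 0" for s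
    unfolding M_int_lift_fun[OF smooth_on_continuous_on[OF g_smooth] t] F_def P_def
    using J_continuation[OF that, of "cosh t" k] by (simp add: J_def)
  have uniq: "G (of_real \<alpha>) = F (of_real \<alpha>)" if G: "G holomorphic_on ?H"
    "\<And>s. Re s > 0 \<Longrightarrow> G s = M_int (lift_fun g) t (hchart a) s" for G
  proof (rule analytic_continuation_open[of "{s. Re s > 0}" ?H G F "of_real \<alpha>"])
    have "1 \<in> {s. Re s > 0}" by simp
    then show "{s. Re s > 0} \<noteq> {}" by blast
    show "open {s. Re s > 0}" "open ?H" by (rule open_halfspace_Re_gt)+
    show "connected ?H" by (intro convex_connected convex_halfspace_Re_gt)
    show "{s. Re s > 0} \<subseteq> ?H"
    proof
      fix s :: complex assume "s \<in> {s. Re s > 0}"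
      moreover have "(1 - real CARD('n)) / 2 \<le> 0" by (simp add: Suc_leI)
      ultimately show "s \<in> ?H" unfolding mem_Collect_eq by linarith
    qed
  qed (use G F FM \<alpha> in auto)
  have "M_op (of_real \<alpha>) t (lift_fun g) (hchart a) = F (of_real \<alpha>)"
    unfolding M_op_def
  proof (rule the_equality)
    show "\<exists>F'. F' holomorphic_on ?H \<and> (\<forall>s. 0 < Re s \<longrightarrow> F' s = M_int (lift_fun g) t (hchart a) s)
        \<and> F (of_real \<alpha>) = F' (of_real \<alpha>)"
      using F FM by blast
  qed (use uniq in blast)
  also have "F (of_real \<alpha>) = of_real (coef CARD('n) t \<alpha> * Sr \<alpha> k (cosh t))"
  proof -
    have e1: "2 * complex_of_real \<alpha> + of_nat CARD('n) - 2 = of_real (2 * \<alpha> + real CARD('n) - 2)"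
      "complex_of_real \<alpha> - 1 = of_real (\<alpha> - 1)"
      "complex_of_real \<alpha> + of_nat k = of_real (\<alpha> + real k)"
      "complex_of_real \<alpha> + of_nat (Suc k) = of_real (\<alpha> + real (Suc k))" by simp_all
    have p: "complex_of_real (exp t - 1) powr of_real r = of_real ((exp t - 1) powr r)"
      "complex_of_real (2 * exp t) powr of_real r = of_real ((2 * exp t) powr r)" for r
      using t0 by (intro powr_of_real; simp)+
    have P: "P (of_real \<alpha>) = of_real (coef CARD('n) t \<alpha>)"
      unfolding P_def coef_def e1 p powr_minus by (simp add: divide_inverse)
    show ?thesis
      unfolding F_def P unfolding e1 J_of_real rGamma_complex_of_real Sr_def by simp
  qed
  finally show ?thesis .
qed

lemma max_op_ge:
  assumes "\<alpha> > (1 - real CARD('n)) / 2" "real k \<ge> (real CARD('n) - 1) / 2" "v > 1"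
    "0 \<le> c" "c \<le> coef CARD('n) (arcosh v) \<alpha>"
  shows "max_op (of_real \<alpha>) (lift_fun g) (hchart a) \<ge> ennreal (c * \<bar>Sr \<alpha> k v\<bar>)"
proof -
  have t: "arcosh v > 0" using assms(3) by simp
  have "ennreal (c * \<bar>Sr \<alpha> k v\<bar>) \<le> ennreal (norm (M_op (of_real \<alpha>) (arcosh v) (lift_fun g) (hchart a)))"
    using assms unfolding M_op_eq[OF assms(1,2) t]
    by (intro ennreal_leI) (simp add: norm_mult abs_mult mult_right_mono flip: of_real_mult)
  also have "\<dots> \<le> max_op (of_real \<alpha>) (lift_fun g) (hchart a)"
    unfolding max_op_def using t by (intro SUP_upper) auto
  finally show ?thesis .
qed

end

section \<open>Averaging the continued means over the radius\<close>

lemma has_integral_beta_shift: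
  fixes a b y w :: real
  assumes "a > -1" "b > -1" "y < w"
  shows "((\<lambda>v. (w - v) powr b * (v - y) powr a) has_integral (w - y) powr (a + b + 1) * Beta (a + 1) (b + 1)) {y..w}"
proof -
  have "((\<lambda>t. t powr (a + 1 - 1) * (1 - t) powr (b + 1 - 1)) has_integral Beta (a + 1) (b + 1)) (cbox 0 1)"
    using has_integral_Beta_real[of "a + 1" "b + 1"] assms by simp
  moreover define m c where "m = 1 / (w - y)" and "c = - y / (w - y)"
  moreover have m: "m > 0" using assms by (simp add: m_def)
  ultimately have "((\<lambda>v. (m *\<^sub>R v + c) powr (a + 1 - 1) * (1 - (m *\<^sub>R v + c)) powr (b + 1 - 1))
      has_integral (Beta (a + 1) (b + 1) /\<^sub>R m ^ DIM(real))) (cbox ((0 - c) /\<^sub>R m) ((1 - c) /\<^sub>R m))"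
    by (intro has_integral_affinity')
  moreover have "m *\<^sub>R v + c = (v - y) / (w - y)" for v by (simp add: m_def c_def diff_divide_distrib)
  moreover have "(0 - c) /\<^sub>R m = y" using assms by (simp add: m_def c_def)
  moreover have "(1 - c) /\<^sub>R m = w"
  proof -
    have "1 - c = w / (w - y)" using assms by (simp add: c_def field_simps)
    then show ?thesis using assms by (simp add: m_def)
  qed
  moreover have "inverse m = w - y"
    by (simp add: m_def)
  ultimately have "((\<lambda>v. ((v - y) / (w - y)) powr a * (1 - (v - y) / (w - y)) powr b) has_integral (w - y) * Beta (a + 1) (b + 1)) {y..w}"
    by simp
  from has_integral_mult_right[OF this, of "(w - y) powr (a + b)"]
  have "((\<lambda>v. (w - y) powr (a + b) * (((v - y) / (w - y)) powr a * (1 - (v - y) / (w - y)) powr b))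
      has_integral (w - y) powr (a + b) * ((w - y) * Beta (a + 1) (b + 1))) {y..w}" .
  moreover have "(w - y) powr (a + b) * ((w - y) * Beta (a + 1) (b + 1)) = (w - y) powr (a + b + 1) * Beta (a + 1) (b + 1)"
    using assms by (simp add: powr_add)
  moreover have "(w - y) powr (a + b) * (((v - y) / (w - y)) powr a * (1 - (v - y) / (w - y)) powr b)
      = (w - v) powr b * (v - y) powr a" if "v \<in> {y..w}" for v
  proof -
    have "1 - (v - y) / (w - y) = (w - v) / (w - y)" using assms by (simp add: field_simps)
    then show ?thesis using assms that by (simp add: powr_divide powr_add)
  qed
  ultimately show ?thesis
    using has_integral_eq[of "{y..w}" "\<lambda>v. (w - y) powr (a + b) * (((v - y) / (w - y)) powr a * (1 - (v - y) / (w - y)) powr b)"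
        "\<lambda>v. (w - v) powr b * (v - y) powr a"] by simp
qed

context chart_transport
begin

text \<open>Averaging in \<open>v = cosh t\<close> against the Riemann-Liouville kernel of order \<open>1 - \<alpha>\<close> turns the
  means of order \<open>\<alpha>\<close> into means of order 1, which are positive.\<close>

lemma Sr_average:
  assumes \<alpha>: "\<alpha> < 0" and k: "\<alpha> + real k > 0" and v01: "v0 \<le> v1"
    and C01: "\<And>x. x \<in> C \<Longrightarrow> v0 \<le> hy a x \<and> hy a x \<le> v1" and g1: "\<And>x. g x \<noteq> 0 \<Longrightarrow> hy a x < v1"
  shows "integral {v0..v1} (\<lambda>v. (v1 - v) powr (- \<alpha>) * Sr \<alpha> k v)
    = Gamma (1 - \<alpha>) * integral\<^sup>L lborel (\<lambda>x. g x * dens x)"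
proof -
  obtain A B where AB: "C \<subseteq> cbox A B" by (rule compact_subset_cbox[OF C_compact])
  then have hs_AB: "hs j x = 0" if "x \<notin> cbox A B" for j x using that hs_supp by blast
  define f where "f v x = (v1 - v) powr (- \<alpha>) * (max (v - hy a x) 0 powr (\<alpha> + real k) * hs (Suc k) x)" for v x
  have "continuous_on (cbox v0 v1 \<times> cbox A B) (\<lambda>p. f (fst p) (snd p))"
    unfolding f_def using \<alpha> k
    by (intro continuous_intros continuous_on_powr' continuous_on_compose2[OF hs_continuous[of UNIV]]
        continuous_on_compose2[OF y_continuous[of UNIV]]) auto
  then have cont: "continuous_on (cbox (v0, A) (v1, B)) (\<lambda>(v, x). f v x)"
    by (simp add: case_prod_unfold cbox_Pair_eq)
  have cm: "continuous_on UNIV (\<lambda>x. max (v - hy a x) 0 powr r * hs j x)" if "r > 0" for v r j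
    using that by (intro continuous_intros continuous_on_powr' hs_continuous y_continuous) auto
  have Leb: "integral\<^sup>L lborel (\<lambda>x. max (v - hy a x) 0 powr r * hs j x)
      = integral (cbox A B) (\<lambda>x. max (v - hy a x) 0 powr r * hs j x)" if "r > 0" for v r j
    using hs_AB by (intro integral_lborel_continuous_compact(2) cm that) simp
  let ?\<Gamma> = "rGamma (\<alpha> + real (Suc k))"
  have "integral {v0..v1} (\<lambda>v. (v1 - v) powr (- \<alpha>) * Sr \<alpha> k v)
      = integral (cbox v0 v1) (\<lambda>v. ?\<Gamma> * integral (cbox A B) (f v))"
    unfolding Sr_def Leb[OF k] f_def by (simp add: mult.left_commute)
  \<comment> \<open>Fubini moves the average over v inside; for fixed x in the support it is a Beta
    integral in v from \<open>hy a x\<close> to \<open>v1\<close>.\<close>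
  also have "\<dots> = ?\<Gamma> * integral (cbox A B) (\<lambda>x. integral (cbox v0 v1) (\<lambda>v. f v x))"
    by (subst integral_swap_continuous[OF cont, symmetric]) simp
  also have "integral (cbox A B) (\<lambda>x. integral (cbox v0 v1) (\<lambda>v. f v x))
      = integral (cbox A B) (\<lambda>x. Beta (\<alpha> + real k + 1) (1 - \<alpha>) * (max (v1 - hy a x) 0 powr (real k + 1) * hs (Suc k) x))"
  proof (rule integral_cong)
    fix x
    show "integral (cbox v0 v1) (\<lambda>v. f v x)
        = Beta (\<alpha> + real k + 1) (1 - \<alpha>) * (max (v1 - hy a x) 0 powr (real k + 1) * hs (Suc k) x)"
    proof (cases "x \<in> C")
      case True
      define y where "y = hy a x"
      have y: "v0 \<le> y" "y \<le> v1" using C01[OF True] by (auto simp: y_def)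
      define \<phi> where "\<phi> v = (v1 - v) powr (- \<alpha>) * max (v - y) 0 powr (\<alpha> + real k)" for v
      have "continuous_on {v0..v1} \<phi>"
        unfolding \<phi>_def using \<alpha> k by (intro continuous_intros continuous_on_powr') auto
      then have i: "\<phi> integrable_on {v0..v1}" by (rule integrable_continuous_real)
      have "integral {v0..v1} \<phi> = integral {v0..y} \<phi> + integral {y..v1} \<phi>"
        using Henstock_Kurzweil_Integration.integral_combine[OF y i] by simp
      also have "integral {v0..y} \<phi> = integral {v0..y} (\<lambda>_. 0)"
        by (rule integral_cong) (auto simp: \<phi>_def max_def)
      also have "integral {y..v1} \<phi> = (v1 - y) powr (real k + 1) * Beta (\<alpha> + real k + 1) (1 - \<alpha>)"
      proof (cases "y < v1")
        case True
        have "integral {y..v1} \<phi> = integral {y..v1} (\<lambda>v. (v1 - v) powr (- \<alpha>) * (v - y) powr (\<alpha> + real k))"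
          by (rule integral_cong) (auto simp: \<phi>_def)
        also have "\<dots> = (v1 - y) powr (\<alpha> + real k + - \<alpha> + 1) * Beta (\<alpha> + real k + 1) (- \<alpha> + 1)"
          by (rule integral_unique[OF has_integral_beta_shift]) (use \<alpha> k True in auto)
        finally show ?thesis by (simp add: add.commute)
      qed (use y in auto)
      finally have "integral {v0..v1} \<phi> = (v1 - y) powr (real k + 1) * Beta (\<alpha> + real k + 1) (1 - \<alpha>)" by simp
      moreover have "(\<lambda>v. f v x) = (\<lambda>v. \<phi> v * hs (Suc k) x)"
        by (simp add: f_def \<phi>_def y_def mult.assoc)
      ultimately show ?thesis using y by (simp add: y_def ac_simps)
    qed (simp add: f_def hs_supp)
  qed
  also have "\<dots> = Beta (\<alpha> + real k + 1) (1 - \<alpha>)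
      * integral\<^sup>L lborel (\<lambda>x. max (v1 - hy a x) 0 powr (real k + 1) * hs (Suc k) x)"
    by (subst Leb) auto
  \<comment> \<open>The factor 1 / Gamma(\<alpha> + k + 1) cancels the same Gamma value in the Beta
    function, so \<alpha> survives only in Gamma(1 - \<alpha>).\<close>
  also have "?\<Gamma> * (Beta (\<alpha> + real k + 1) (1 - \<alpha>) * integral\<^sup>L lborel (\<lambda>x. max (v1 - hy a x) 0 powr (real k + 1) * hs (Suc k) x))
      = Gamma (1 - \<alpha>) * (rGamma (real k + 2) * integral\<^sup>L lborel (\<lambda>x. max (v1 - hy a x) 0 powr (real k + 1) * hs (Suc k) x))"
  proof -
    have "Gamma (\<alpha> + real (Suc k)) \<noteq> 0" using k by (intro less_imp_neq[symmetric] Gamma_real_pos) simp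
    then have "?\<Gamma> * Gamma (\<alpha> + real k + 1) = 1"
      by (simp add: rGamma_inverse_Gamma ac_simps)
    then have "?\<Gamma> * Beta (\<alpha> + real k + 1) (1 - \<alpha>) = Gamma (1 - \<alpha>) * rGamma (real k + 2)"
    proof -
      have e: "(\<alpha> + real k + 1) + (1 - \<alpha>) = real k + 2" by simp
      have "?\<Gamma> * Beta (\<alpha> + real k + 1) (1 - \<alpha>)
          = (?\<Gamma> * Gamma (\<alpha> + real k + 1)) * (Gamma (1 - \<alpha>) * rGamma (real k + 2))"
        unfolding Beta_altdef e by (simp only: mult.assoc)
      then show ?thesis by (simp only: \<open>?\<Gamma> * Gamma (\<alpha> + real k + 1) = 1\<close> mult_1_left)
    qed
    then show ?thesis unfolding mult.assoc[symmetric] by (rule arg_cong)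
  qed
  \<comment> \<open>The integrations by parts are undone at order 1, where the kernel has exponent
    0.\<close>
  also have "rGamma (real k + 2) * integral\<^sup>L lborel (\<lambda>x. max (v1 - hy a x) 0 powr (real k + 1) * hs (Suc k) x)
      = integral\<^sup>L lborel (\<lambda>x. g x * dens x)"
  proof -
    have "rGamma 1 * J (1 - 1) 0 v1 = rGamma (1 + of_nat (Suc k)) * J (1 + of_nat k) (Suc k) v1"
      by (rule J_continuation) simp
    moreover have "1 + complex_of_nat k = of_real (real k + 1)" "1 + complex_of_nat (Suc k) = of_real (real k + 2)" by simp_all
    ultimately have "J (of_real 0) 0 v1 = of_real (rGamma (real k + 2)) * J (of_real (real k + 1)) (Suc k) v1"
      unfolding rGamma_complex_of_real[symmetric] by (simp del: of_real_add)
    then have "integral\<^sup>L lborel (\<lambda>x. max (v1 - hy a x) 0 powr 0 * hs 0 x)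
        = rGamma (real k + 2) * integral\<^sup>L lborel (\<lambda>x. max (v1 - hy a x) 0 powr (real k + 1) * hs (Suc k) x)"
      unfolding J_of_real of_real_mult[symmetric] of_real_eq_iff .
    \<comment> \<open>Since \<open>0 powr 0 = 0\<close>, the kernel is an indicator function; the
      strict inequality \<open>hy a x < v1\<close> on the support makes it equal to 1 there.\<close>
    moreover have "(\<lambda>x. max (v1 - hy a x) 0 powr 0 * hs 0 x) = (\<lambda>x. g x * dens x)"
    proof
      show "max (v1 - hy a x) 0 powr 0 * hs 0 x = g x * dens x" for x
        using g1[of x] by (cases "g x = 0") auto
    qed
    ultimately show ?thesis by simp
  qed
  finally show ?thesis .
qed

text \<open>If the maximal function at the centre equals B, all continued means with v in the
  interval are at most B/c in modulus, and the Riemann-Liouville weight has total mass at most (v1 -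
  v0)^(1 - \<alpha>).\<close>

lemma max_op_ge_average:
  assumes \<alpha>: "\<alpha> > (1 - real CARD('n)) / 2" "\<alpha> < 0"
    and v01: "1 < v0" "v0 < v1" and c: "0 < c" "\<And>v. v \<in> {v0..v1} \<Longrightarrow> c \<le> coef CARD('n) (arcosh v) \<alpha>"
    and C01: "\<And>x. x \<in> C \<Longrightarrow> v0 \<le> hy a x \<and> hy a x \<le> v1" and g1: "\<And>x. g x \<noteq> 0 \<Longrightarrow> hy a x < v1"
  shows "max_op (of_real \<alpha>) (lift_fun g) (hchart a)
    \<ge> ennreal (c * Gamma (1 - \<alpha>) * (v1 - v0) powr (\<alpha> - 1) * integral\<^sup>L lborel (\<lambda>x. g x * dens x))"
proof (cases "max_op (of_real \<alpha>) (lift_fun g) (hchart a)")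
  case (real B)
  define k where "k = CARD('n)"
  have k: "real k \<ge> (real CARD('n) - 1) / 2" "\<alpha> + real k > 0" using \<alpha> by (auto simp: k_def)
  have S: "\<bar>Sr \<alpha> k v\<bar> \<le> B / c" if "v \<in> {v0..v1}" for v
  proof -
    have "ennreal (c * \<bar>Sr \<alpha> k v\<bar>) \<le> ennreal B"
      using max_op_ge[OF \<alpha>(1) k(1), of v c] v01 c that real by simp
    then show ?thesis using c real by (simp add: field_simps)
  qed
  have "norm (integral {v0..v1} (\<lambda>v. (v1 - v) powr (- \<alpha>) * Sr \<alpha> k v)) \<le> ((v1 - v0) powr (- \<alpha>) * (B / c)) * (v1 - v0)"
  \<comment> \<open>A non-integrable function has integral 0 by convention, which satisfies the
    bound trivially.\<close>
  proof (cases "(\<lambda>v. (v1 - v) powr (- \<alpha>) * Sr \<alpha> k v) integrable_on {v0..v1}")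
    case True
    have "norm ((v1 - v) powr (- \<alpha>) * Sr \<alpha> k v) \<le> (v1 - v0) powr (- \<alpha>) * (B / c)" if "v \<in> {v0..v1}" for v
      unfolding norm_mult using S[OF that] that \<alpha> by (intro mult_mono) (auto intro!: powr_mono2)
    then have "norm (integral (cbox v0 v1) (\<lambda>v. (v1 - v) powr (- \<alpha>) * Sr \<alpha> k v)) \<le> ((v1 - v0) powr (- \<alpha>) * (B / c)) * measure lborel (cbox v0 v1)"
      by (intro has_integral_bound[OF _ integrable_integral]) (use True real c v01 in auto)
    then show ?thesis using v01 by simp
  qed (use real c v01 in \<open>simp add: not_integrable_integral\<close>)
  then have "Gamma (1 - \<alpha>) * integral\<^sup>L lborel (\<lambda>x. g x * dens x) \<le> ((v1 - v0) powr (- \<alpha>) * (B / c)) * (v1 - v0)"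
    using Sr_average[OF \<alpha>(2) k(2), of v0 v1] v01 C01 g1 by simp
  also have "\<dots> = (v1 - v0) powr (1 - \<alpha>) * B / c"
    using v01 powr_add[of "v1 - v0" "- \<alpha>" 1] by simp
  finally have "c * (Gamma (1 - \<alpha>) * integral\<^sup>L lborel (\<lambda>x. g x * dens x)) \<le> (v1 - v0) powr (1 - \<alpha>) * B"
    using c by (simp add: field_simps)
  then have "(v1 - v0) powr (\<alpha> - 1) * (c * (Gamma (1 - \<alpha>) * integral\<^sup>L lborel (\<lambda>x. g x * dens x)))
      \<le> (v1 - v0) powr (\<alpha> - 1) * ((v1 - v0) powr (1 - \<alpha>) * B)" by (intro mult_left_mono) auto
  also have "\<dots> = B" using v01 by (simp add: mult.assoc[symmetric] flip: powr_add)
  finally show ?thesis using real by (simp add: ac_simps ennreal_leI)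
qed simp

end

subsection \<open>Lower bounds for the maximal operator\<close>

lemma hy_has_derivative:
  "(hy a has_derivative (\<lambda>v. ((sqrt (1 + (norm a)\<^sup>2) / sqrt (1 + (norm x)\<^sup>2)) *\<^sub>R x - a) \<bullet> v)) (at x)"
proof -
  have 1: "((\<lambda>x. fst (hchart x)) has_derivative (\<lambda>v. x \<bullet> v / sqrt (1 + (norm x)\<^sup>2))) (at x)"
    using has_derivative_fst[OF hchart_has_derivative[of x]] by simp
  have "((\<lambda>x. sqrt (1 + (norm a)\<^sup>2) * fst (hchart x) - a \<bullet> x) has_derivative
      (\<lambda>v. sqrt (1 + (norm a)\<^sup>2) * (x \<bullet> v / sqrt (1 + (norm x)\<^sup>2)) - a \<bullet> v)) (at x)"
    by (intro has_derivative_diff has_derivative_mult_right 1 has_derivative_inner_right has_derivative_ident)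
  then show ?thesis by (simp add: hy_def[abs_def] hchart_def inner_diff_left)
qed

text \<open>The distance from a has no critical point other than a: if q x = a with q the quotient
  of the two roots, comparing norms gives |x| = |a|, hence q = 1.\<close>

lemma hy_gradient_nonzero:
  assumes "(sqrt (1 + (norm a)\<^sup>2) / sqrt (1 + (norm x)\<^sup>2)) *\<^sub>R x - a = 0"
  shows "x = a"
proof -
  let ?q = "sqrt (1 + (norm a)\<^sup>2) / sqrt (1 + (norm x)\<^sup>2)"
  have q: "?q > 0" using one_plus_norm2_pos[of a] one_plus_norm2_pos[of x] by simp
  have a: "?q *\<^sub>R x = a" using assms by simp
  then have "?q * norm x = norm a" using q by (metis abs_of_pos norm_scaleR)
  then have "?q\<^sup>2 * (norm x)\<^sup>2 = (norm a)\<^sup>2" by (metis power_mult_distrib)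
  then have "(1 + (norm a)\<^sup>2) * (norm x)\<^sup>2 = (norm a)\<^sup>2 * (1 + (norm x)\<^sup>2)"
    using one_plus_norm2_pos[of a] one_plus_norm2_pos[of x]
    by (simp add: power_divide less_imp_le divide_eq_eq split: if_splits)
  then have "(norm x)\<^sup>2 = (norm a)\<^sup>2" by (simp add: algebra_simps)
  then have "?q = 1" using one_plus_norm2_pos[of x] by (simp only:) simp
  then show ?thesis using a by (simp only: scaleR_one)
qed

text \<open>A predicate in the constant, so that \<open>c\<close> is fixed before the centre, the
  test function and the interval, all of which vary with the scale.\<close>

definition averaged_lower_bound :: "'n::finite itself \<Rightarrow> real \<Rightarrow> real \<Rightarrow> real \<Rightarrow> real \<Rightarrow> bool" where
  "averaged_lower_bound _ \<alpha> V0 V1 c \<longleftrightarrow> (\<forall>(a :: real^'n) (g :: real^'n \<Rightarrow> real) C v0 v1.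
     smooth_on UNIV g \<longrightarrow> (\<forall>x. g x \<ge> 0) \<longrightarrow> compact C \<longrightarrow> (\<forall>x. x \<notin> C \<longrightarrow> g x = 0) \<longrightarrow>
     (\<forall>x. g x \<noteq> 0 \<longrightarrow> v0 \<le> hy a x \<and> hy a x < v1) \<longrightarrow> V0 \<le> v0 \<longrightarrow> v0 < v1 \<longrightarrow> v1 \<le> V1 \<longrightarrow>
     max_op (of_real \<alpha>) (lift_fun g) (hchart a)
       \<ge> ennreal (c * (v1 - v0) powr (\<alpha> - 1) * integral\<^sup>L lborel (\<lambda>x. g x * dens x)))"

lemma averaged_lower_boundD:
  fixes a :: "real ^ 'n::finite"
  assumes "averaged_lower_bound TYPE('n) \<alpha> V0 V1 c" "smooth_on UNIV g" "\<And>x. g x \<ge> 0"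
    "compact C" "\<And>x. x \<notin> C \<Longrightarrow> g x = 0" "\<And>x. g x \<noteq> 0 \<Longrightarrow> v0 \<le> hy a x \<and> hy a x < v1"
    "V0 \<le> v0" "v0 < v1" "v1 \<le> V1"
  shows "max_op (of_real \<alpha>) (lift_fun g) (hchart a)
       \<ge> ennreal (c * (v1 - v0) powr (\<alpha> - 1) * integral\<^sup>L lborel (\<lambda>x. g x * dens x))"
  by (rule assms(1)[unfolded averaged_lower_bound_def, rule_format]) (use assms(2-) in auto)

text \<open>The field is minus the gradient of \<open>hy a\<close> divided by its squared length. It
  is singular only at a, and \<open>hy a x \<ge> V0 > 1\<close> keeps the support away from
  there.\<close>

lemma max_op_lower_bound:
  assumes \<alpha>: "\<alpha> > (1 - real CARD('n::finite)) / 2" "\<alpha> < 0" and V0: "1 < V0"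
  obtains c where "c > 0" "averaged_lower_bound TYPE('n) \<alpha> V0 V1 c"
proof -
  obtain c0 where c0: "c0 > 0" "\<And>v. v \<in> {V0..V1} \<Longrightarrow> coef CARD('n) (arcosh v) \<alpha> \<ge> c0"
    using coef_lower_bound[OF V0, of V1 "CARD('n)" \<alpha>] by blast
  have G: "Gamma (1 - \<alpha>) > 0" using \<alpha> by (intro Gamma_real_pos) simp
  show ?thesis
  proof (rule that[of "c0 * Gamma (1 - \<alpha>)"])
    show "0 < c0 * Gamma (1 - \<alpha>)" using c0 G by simp
    show "averaged_lower_bound TYPE('n) \<alpha> V0 V1 (c0 * Gamma (1 - \<alpha>))"
      unfolding averaged_lower_bound_def
    proof (intro allI impI)
      fix a :: "real ^ 'n" and g :: "real ^ 'n \<Rightarrow> real" and C0 v0 v1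
      assume gs: "smooth_on UNIV g" and gnn: "\<forall>x. g x \<ge> 0" and C0c: "compact C0" and C0s: "\<forall>x. x \<notin> C0 \<longrightarrow> g x = 0"
        and gvs: "\<forall>x. g x \<noteq> 0 \<longrightarrow> v0 \<le> hy a x \<and> hy a x < v1" and v: "V0 \<le> v0" "v0 < v1" "v1 \<le> V1"
      note g = gs gnn[rule_format] and C0 = C0c C0s[rule_format] and gv = gvs[rule_format]
      define C where "C = C0 \<inter> {x. v0 \<le> hy a x \<and> hy a x \<le> v1}"
      define G where "G x = (sqrt (1 + (norm a)\<^sup>2) / sqrt (1 + (norm x)\<^sup>2)) *\<^sub>R x - a" for x
      define Y where "Y x = - (G x /\<^sub>R (norm (G x))\<^sup>2)" for x
      have hyc: "continuous_on UNIV (hy a)" by (rule smooth_on_continuous_on[OF hy_smooth])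
      have "closed {x. v0 \<le> hy a x \<and> hy a x \<le> v1}"
        by (intro closed_Collect_conj closed_Collect_le hyc continuous_on_const)
      then have C: "compact C" unfolding C_def using C0(1) by (auto intro: compact_Int_closed)
      have aC: "C \<subseteq> - {a}"
      proof -
        have "hy a a = 1" using one_plus_norm2_pos[of a] by (simp add: hy_def power2_norm_eq_inner less_imp_le)
        then show ?thesis using V0 v by (auto simp: C_def)
      qed
      have Gnz: "G x \<noteq> 0" if "x \<noteq> a" for x using hy_gradient_nonzero that by (auto simp: G_def)
      have Gs: "smooth_on UNIV (\<lambda>x. G x \<bullet> e)" for e
      proof -
        have "smooth_on UNIV (\<lambda>x. sqrt (1 + (norm a)\<^sup>2) / sqrt (1 + (norm x)\<^sup>2) * (x \<bullet> e) - a \<bullet> e)"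
          by (intro smooth_on_diff smooth_on_mult smooth_on_inner smooth_on_const smooth_on_divide
              smooth_on_sqrt smooth_on_add smooth_on_norm2 open_UNIV) (auto simp: one_plus_norm2_pos)
        then show ?thesis by (simp add: G_def inner_diff_left)
      qed
      have op: "open (- {a})" by (simp add: open_Compl)
      interpret chart_transport a g Y C "- {a}"
      proof unfold_locales
        show "smooth_on UNIV (\<lambda>x. g x * dens x)" by (intro smooth_on_mult g dens_smooth open_UNIV)
        show "g x * dens x = 0" if "x \<notin> C" for x
        proof (rule ccontr)
          assume "g x * dens x \<noteq> 0"
          then have "g x \<noteq> 0" by auto
          then show False using that gv[of x] C0(2)[of x] by (auto simp: C_def)
        qed
        show "0 \<le> g x * dens x" for x using g(2) dens_pos[of x] by (simp add: less_imp_le)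
        fix e :: "real ^ 'n" assume "e \<in> Basis"
        have "smooth_on (- {a}) (\<lambda>x. - ((G x \<bullet> e) / (\<Sum>b\<in>Basis. (G x \<bullet> b)\<^sup>2)))"
        proof (intro smooth_on_minus smooth_on_divide smooth_on_sum smooth_on_power smooth_on_subset[OF Gs] op)
          fix x assume "x \<in> - {a}"
          then have "0 < G x \<bullet> G x" using Gnz by simp
          then show "0 < (\<Sum>b\<in>Basis. (G x \<bullet> b)\<^sup>2)"
            by (subst (asm) euclidean_inner) (simp add: power2_eq_square)
        qed auto
        moreover have "(norm z)\<^sup>2 = (\<Sum>b\<in>Basis. (z \<bullet> b)\<^sup>2)" for z :: "real ^ 'n"
          unfolding power2_norm_eq_inner by (subst euclidean_inner) (simp add: power2_eq_square)
        ultimately show "smooth_on (- {a}) (\<lambda>x. Y x \<bullet> e)"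
          by (simp add: Y_def divide_inverse mult.commute)
      next
        fix x assume "x \<in> C"
        then have "x \<noteq> a" using aC by auto
        then have "G x \<noteq> 0" by (rule Gnz)
        moreover have "frechet_derivative (hy a) (at x) = (\<lambda>v. G x \<bullet> v)"
          unfolding G_def by (rule frechet_derivative_at[OF hy_has_derivative, symmetric])
        ultimately show "frechet_derivative (hy a) (at x) (Y x) = - 1"
          by (simp add: Y_def power2_norm_eq_inner)
      qed (use hy_smooth g C aC op in auto)
      show "max_op (of_real \<alpha>) (lift_fun g) (hchart a)
         \<ge> ennreal (c0 * Gamma (1 - \<alpha>) * (v1 - v0) powr (\<alpha> - 1) * integral\<^sup>L lborel (\<lambda>x. g x * dens x))"
        by (rule max_op_ge_average[OF \<alpha> _ v(2) c0(1)]) (use v V0 c0 gv in \<open>auto simp: C_def\<close>)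
    qed
  qed
qed

section \<open>Testing the norm inequality on superlevel sets\<close>

lemma epowr_mono: "x \<le> y \<Longrightarrow> p \<ge> 0 \<Longrightarrow> epowr x p \<le> epowr y p"
  by (cases x; cases y)
    (auto simp: epowr_def ennreal_le_iff2 top_unique intro!: ennreal_leI powr_mono2 split: if_splits)

lemma epowr_ennreal: "x \<ge> 0 \<Longrightarrow> epowr (ennreal x) p = ennreal (x powr p)"
  by (simp add: epowr_def)

text \<open>What boundedness yields through Chebyshev's inequality when the maximal function is at
  least \<open>B\<close> on \<open>Z\<close>. As above, the constant comes before the scale.\<close>

definition testing_bound :: "'n::finite itself \<Rightarrow> complex \<Rightarrow> real \<Rightarrow> real \<Rightarrow> bool" where
  "testing_bound _ \<beta> p C \<longleftrightarrow> (\<forall>(g :: real^'n \<Rightarrow> real) K Z B D m.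
     smooth_on UNIV g \<longrightarrow> compact K \<longrightarrow> (\<forall>x. x \<notin> K \<longrightarrow> g x = 0) \<longrightarrow> Z \<in> sets borel \<longrightarrow> B \<ge> 0 \<longrightarrow>
     (\<forall>a. a \<in> Z \<longrightarrow> max_op \<beta> (lift_fun g) (hchart a) \<ge> ennreal B) \<longrightarrow> D \<ge> 0 \<longrightarrow>
     (\<integral>\<^sup>+x. ennreal (dens x * \<bar>g x\<bar> powr p) \<partial>lborel) \<le> ennreal D \<longrightarrow> m \<ge> 0 \<longrightarrow>
     ennreal m \<le> (\<integral>\<^sup>+x. ennreal (dens x) * indicator Z x \<partial>lborel) \<longrightarrow> B powr p * m \<le> C * D)"

lemma testing_boundD:
  fixes g :: "real ^ 'n::finite \<Rightarrow> real"
  assumes "testing_bound TYPE('n) \<beta> p C" "smooth_on UNIV g" "compact K" "\<And>x. x \<notin> K \<Longrightarrow> g x = 0"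
    "Z \<in> sets borel" "B \<ge> 0" "\<And>a. a \<in> Z \<Longrightarrow> max_op \<beta> (lift_fun g) (hchart a) \<ge> ennreal B" "D \<ge> 0"
    "(\<integral>\<^sup>+x. ennreal (dens x * \<bar>g x\<bar> powr p) \<partial>lborel) \<le> ennreal D" "m \<ge> 0"
    "ennreal m \<le> (\<integral>\<^sup>+x. ennreal (dens x) * indicator Z x \<partial>lborel)"
  shows "B powr p * m \<le> C * D"
  by (rule assms(1)[unfolded testing_bound_def, rule_format, of g K Z B D m]) (use assms(2-) in auto)

lemma max_op_bounded_testing:
  assumes bd: "max_op_bounded TYPE('n::finite) \<beta> p" and p: "p > 0"
  obtains C where "C > 0" "testing_bound TYPE('n) \<beta> p C"
proof -
  obtain C0 :: real where C0: "\<And>f::'n mspace \<Rightarrow> complex. test_fun f \<Longrightarrow>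
      Lp_norm p (max_op \<beta> f) \<le> ennreal C0 * Lp_norm p (\<lambda>z. ennreal (norm (f z)))"
    using bd unfolding max_op_bounded_def by blast
  show ?thesis
  \<comment> \<open>\<open>C0\<close> may be negative, in which case \<open>ennreal C0\<close> is 0,
    hence the maximum; adding 1 makes the constant positive.\<close>
  proof (rule that[of "(max C0 0) powr p + 1"])
    show "0 < max C0 0 powr p + 1" by (simp add: add_nonneg_pos)
    show "testing_bound TYPE('n) \<beta> p ((max C0 0) powr p + 1)"
      unfolding testing_bound_def
    proof (intro allI impI)
      fix g :: "real^'n \<Rightarrow> real" and K Z B D m
      assume g: "smooth_on UNIV g" and Kc: "compact K" and Ks: "\<forall>x. x \<notin> K \<longrightarrow> g x = 0" and Z: "Z \<in> sets borel"
        and B0: "B \<ge> 0" and Bs: "\<forall>a. a \<in> Z \<longrightarrow> max_op \<beta> (lift_fun g) (hchart a) \<ge> ennreal B"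
        and D: "D \<ge> 0" "(\<integral>\<^sup>+x. ennreal (dens x * \<bar>g x\<bar> powr p) \<partial>lborel) \<le> ennreal D"
        and m: "m \<ge> 0" "ennreal m \<le> (\<integral>\<^sup>+x. ennreal (dens x) * indicator Z x \<partial>lborel)"
      note K = Kc Ks[rule_format] and B = B0 Bs[rule_format]
      note [measurable] = Z
      have [measurable]: "g \<in> borel_measurable borel"
        using smooth_on_continuous_on[OF g] by (rule borel_measurable_continuous_onI)
      have [measurable]: "snd \<in> borel \<rightarrow>\<^sub>M (borel :: (real^'n) measure)" "fst \<in> borel \<rightarrow>\<^sub>M (borel :: real measure)"
        by (auto intro!: borel_measurable_continuous_onI continuous_intros)
      define W where "W = {w \<in> hyp. snd w \<in> Z}"
      have [measurable]: "W \<in> sets borel" unfolding W_def hyp_def by measurable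
      have "ennreal (B powr p * m) \<le> ennreal (B powr p) * (\<integral>\<^sup>+x. ennreal (dens x) * indicator Z x \<partial>lborel)"
        using m B by (simp add: ennreal_mult mult_left_mono)
      also have "\<dots> = (\<integral>\<^sup>+x. ennreal (dens x) * (ennreal (B powr p) * indicator W (hchart x)) \<partial>lborel)"
        by (subst nn_integral_cmult[symmetric], measurable)
          (auto intro!: nn_integral_cong simp: W_def indicator_def hchart_def[abs_def] mult.commute
            hchart_in_hyp[unfolded hchart_def])
      also have "\<dots> = (\<integral>\<^sup>+w. ennreal (B powr p) * indicator W w \<partial>hmeasure)"
        by (rule nn_integral_hmeasure[symmetric]) measurable
      also have "\<dots> \<le> (\<integral>\<^sup>+w. epowr (max_op \<beta> (lift_fun g) w) p \<partial>hmeasure)"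
      proof (rule nn_integral_mono)
        fix w :: "'n mspace"
        show "ennreal (B powr p) * indicator W w \<le> epowr (max_op \<beta> (lift_fun g) w) p"
        proof (cases "w \<in> W")
          case True
          then have w: "w = hchart (snd w)" "snd w \<in> Z" using hyp_iff_hchart[of w] by (auto simp: W_def)
          have "epowr (ennreal B) p \<le> epowr (max_op \<beta> (lift_fun g) w) p"
            using B(2)[OF w(2)] w(1) p by (intro epowr_mono) auto
          then show ?thesis using True B by (simp add: epowr_ennreal)
        qed simp
      qed
      finally have "epowr (ennreal (B powr p * m)) (1 / p) \<le> Lp_norm p (max_op \<beta> (lift_fun g))"
        unfolding Lp_norm_def using p by (intro epowr_mono) auto
      also have "\<dots> \<le> ennreal C0 * Lp_norm p (\<lambda>z. ennreal (norm (lift_fun g z)))"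
        by (rule C0[OF test_fun_lift_fun[OF g K]])
      also have "\<dots> \<le> ennreal C0 * epowr (ennreal D) (1 / p)"
      proof (intro mult_left_mono)
        have "(\<integral>\<^sup>+z. epowr (ennreal (norm (lift_fun g z))) p \<partial>hmeasure)
            = (\<integral>\<^sup>+z. ennreal (\<bar>g (snd z)\<bar> powr p) \<partial>hmeasure)"
          by (simp add: epowr_ennreal lift_fun_def)
        also have "\<dots> = (\<integral>\<^sup>+x. ennreal (dens x * \<bar>g x\<bar> powr p) \<partial>lborel)"
          by (subst nn_integral_hmeasure, measurable)
            (simp add: hchart_def ennreal_mult less_imp_le[OF dens_pos])
        finally show "Lp_norm p (\<lambda>z. ennreal (norm (lift_fun g z))) \<le> epowr (ennreal D) (1 / p)"
          unfolding Lp_norm_def using D(2) p by (intro epowr_mono) auto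
      qed simp
      also have "\<dots> = ennreal (max C0 0 * D powr (1 / p))"
      proof -
        have "ennreal C0 = ennreal (max C0 0)" by (simp add: max_def ennreal_neg)
        then show ?thesis using D(1) by (simp add: epowr_ennreal ennreal_mult)
      qed
      finally have "(B powr p * m) powr (1 / p) \<le> max C0 0 * D powr (1 / p)"
        using B m D by (simp add: epowr_ennreal ennreal_le_iff)
      then have "((B powr p * m) powr (1 / p)) powr p \<le> (max C0 0 * D powr (1 / p)) powr p"
        using p by (intro powr_mono2) auto
      then have "B powr p * m \<le> max C0 0 powr p * D"
        using B m D p by (simp add: powr_powr powr_mult)
      also have "\<dots> \<le> (max C0 0 powr p + 1) * D" using D(1) by (intro mult_right_mono) auto
      finally show "B powr p * m \<le> (max C0 0 powr p + 1) * D" .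
    qed
  qed
qed

lemma powr_exponent_le:
  fixes A B L r s :: real
  assumes "A > 0" "\<And>l. l \<ge> L \<Longrightarrow> A * l powr r \<le> B * l powr s"
  shows "r \<le> s"
proof (rule ccontr)
  assume "\<not> r \<le> s"
  then have rs: "r - s > 0" by simp
  have "filterlim (\<lambda>l::real. l powr (r - s)) at_top at_top" using rs by real_asymp
  then have "\<forall>\<^sub>F l in at_top. l powr (r - s) > B / A" by (simp add: filterlim_at_top_dense)
  moreover have "\<forall>\<^sub>F l in at_top. l \<ge> L" "\<forall>\<^sub>F l::real in at_top. l > 0" by (auto intro: eventually_ge_at_top eventually_gt_at_top)
  ultimately have "\<forall>\<^sub>F l::real in at_top. False"
  proof eventually_elim
    case (elim l)
    have "A * l powr (r - s) * l powr s \<le> B * l powr s"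
      using assms(2)[OF elim(2)] elim(3) by (simp add: powr_diff)
    then have "A * l powr (r - s) \<le> B" using elim(3) by simp
    then show ?case using elim(1) assms(1) by (simp add: field_simps)
  qed
  then show False by simp
qed

lemma measure_mult_le_integral:
  fixes f :: "'a::euclidean_space \<Rightarrow> real"
  assumes "integrable lborel f" "\<And>x. f x \<ge> 0" "compact S" "\<And>x. x \<in> S \<Longrightarrow> c \<le> f x"
  shows "c * measure lborel S \<le> integral\<^sup>L lborel f"
proof -
  have S: "emeasure lborel S < \<infinity>" "S \<in> sets lborel"
    using emeasure_lborel_cbox_finite compact_imp_closed[OF assms(3)]
      emeasure_bounded_finite[OF compact_imp_bounded[OF assms(3)]] by auto
  have "c * measure lborel S = integral\<^sup>L lborel (\<lambda>x. c * indicator S x)" using S by simp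
  also have "\<dots> \<le> integral\<^sup>L lborel f"
    using assms by (intro integral_mono integrable_mult_right integrable_real_indicator S)
      (auto simp: indicator_def)
  finally show ?thesis .
qed

lemma measure_mult_le_nn_integral:
  fixes f :: "'a::euclidean_space \<Rightarrow> real"
  assumes "compact S" "\<And>x. x \<in> S \<Longrightarrow> c \<le> f x" "c \<ge> 0"
  shows "ennreal (c * measure lborel S) \<le> (\<integral>\<^sup>+x. ennreal (f x) * indicator S x \<partial>lborel)"
proof -
  have S: "emeasure lborel S < \<infinity>" "S \<in> sets lborel"
    using compact_imp_closed[OF assms(1)]
      emeasure_bounded_finite[OF compact_imp_bounded[OF assms(1)]] by auto
  have "ennreal (c * measure lborel S) = (\<integral>\<^sup>+x. ennreal c * indicator S x \<partial>lborel)"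
    using S(1) assms(3) nn_integral_cmult_indicator[OF S(2), of "ennreal c"]
    by (simp add: ennreal_mult emeasure_eq_ennreal_measure)
  also have "\<dots> \<le> (\<integral>\<^sup>+x. ennreal (f x) * indicator S x \<partial>lborel)"
    using assms(2) by (intro nn_integral_mono) (auto simp: indicator_def intro: ennreal_leI)
  finally show ?thesis .
qed

lemma dens_le_1: "dens x \<le> 1"
proof -
  have "1 \<le> sqrt (1 + (norm x)\<^sup>2)" by simp
  then show ?thesis using one_plus_norm2_pos[of x] by (simp add: dens_def divide_le_eq_1)
qed

lemma nn_integral_dens_powr_le:
  fixes g :: "real ^ 'n \<Rightarrow> real"
  assumes "compact S" "\<And>x. g x \<noteq> 0 \<Longrightarrow> x \<in> S" "\<And>x. \<bar>g x\<bar> \<le> 1" "p \<ge> 0"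
  shows "(\<integral>\<^sup>+x. ennreal (dens x * \<bar>g x\<bar> powr p) \<partial>lborel) \<le> ennreal (measure lborel S)"
proof -
  have S: "emeasure lborel S < \<infinity>" "S \<in> sets lborel"
    using compact_imp_closed[OF assms(1)]
      emeasure_bounded_finite[OF compact_imp_bounded[OF assms(1)]] by auto
  have "(\<integral>\<^sup>+x. ennreal (dens x * \<bar>g x\<bar> powr p) \<partial>lborel) \<le> (\<integral>\<^sup>+x. indicator S x \<partial>lborel)"
  proof (rule nn_integral_mono)
    fix x
    have "\<bar>g x\<bar> powr p \<le> 1" using assms(3)[of x] assms(4) by (intro powr_le1) auto
    then have "dens x * \<bar>g x\<bar> powr p \<le> 1"
      using dens_le_1[of x] dens_pos[of x] by (intro mult_le_one) auto
    then show "ennreal (dens x * \<bar>g x\<bar> powr p) \<le> indicator S x"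
      using assms(2)[of x] by (cases "g x = 0") (auto simp: ennreal_le_1)
  qed
  also have "\<dots> = ennreal (measure lborel S)" using S by (simp add: emeasure_eq_ennreal_measure)
  finally show ?thesis .
qed

subsection \<open>The range \<open>p > 2\<close>\<close>

lemma sqrt_one_plus_le: "s \<ge> 0 \<Longrightarrow> sqrt (1 + s) \<le> 1 + s"
  by (rule real_le_lsqrt) (auto simp: power2_eq_square algebra_simps)

lemma sqrt_le_bound:
  fixes s b :: real
  assumes "s \<le> b" "1 \<le> b"
  shows "sqrt s \<le> b"
proof -
  have "b * 1 \<le> b * b" using assms by (intro mult_left_mono) auto
  then have "s \<le> b\<^sup>2" using assms unfolding power2_eq_square by linarith
  moreover have "0 \<le> b" using assms by simp
  ultimately show ?thesis by (metis real_sqrt_abs real_sqrt_le_mono abs_of_nonneg)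
qed

lemma sqrt_one_plus_le_2: "s \<le> 3 \<Longrightarrow> sqrt (1 + s) \<le> 2"
  by (rule real_le_lsqrt) auto

lemma abs_sqrt_diff_le:
  assumes "x \<ge> 1" "y \<ge> 1" shows "\<bar>sqrt x - sqrt y\<bar> \<le> \<bar>x - y\<bar>"
proof -
  have "x - y = (sqrt x - sqrt y) * (sqrt x + sqrt y)" using assms by (simp add: algebra_simps)
  then have "\<bar>x - y\<bar> = \<bar>sqrt x - sqrt y\<bar> * (sqrt x + sqrt y)" using assms by (simp add: abs_mult)
  moreover have "sqrt x \<ge> 1" "sqrt y \<ge> 1" using assms by auto
  then have "\<bar>sqrt x - sqrt y\<bar> * 1 \<le> \<bar>sqrt x - sqrt y\<bar> * (sqrt x + sqrt y)"
    by (intro mult_left_mono) linarith+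
  ultimately show ?thesis by simp
qed

lemma measure_shell:
  assumes "0 \<le> r" "r \<le> R"
  shows "measure lborel (cball (0 :: 'a::euclidean_space) R - ball 0 r)
    = unit_ball_vol (real DIM('a)) * (R ^ DIM('a) - r ^ DIM('a))"
proof -
  have "measure lborel (cball (0::'a) R - ball 0 r) = measure lborel (cball (0::'a) R) - measure lborel (ball (0::'a) r)"
  proof (rule measure_Diff)
    show "emeasure lborel (cball (0::'a) R) \<noteq> \<infinity>"
      using emeasure_bounded_finite[OF bounded_cball[of "0::'a" R]] by simp
    show "ball 0 r \<subseteq> cball (0::'a) R" using assms by auto
  qed auto
  then show ?thesis using assms by (simp add: content_cball content_ball algebra_simps)
qed

text \<open>Test functions concentrated near a geodesic sphere, whose centres are the points where the
  maximal function is large.\<close>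

lemma necessary_sphere:
  assumes \<alpha>: "\<alpha> > (1 - real CARD('n::finite)) / 2" "\<alpha> < 0" and p: "p > 0"
    and bd: "max_op_bounded TYPE('n) (of_real \<alpha>) p"
  shows "\<alpha> \<ge> - (real CARD('n) - 1) / p"
proof -
  let ?n = "CARD('n)"
  \<comment> \<open>From the origin, |x| = 1 means \<open>hy 0 x = sqrt 2\<close>. For l \<ge> 50
    the window from sqrt 2 - 5/l to sqrt 2 + 5/l stays within [6/5, 2].\<close>
  obtain c where c: "c > 0" "averaged_lower_bound TYPE('n) \<alpha> (6/5) 2 c"
    by (rule max_op_lower_bound[OF \<alpha>, of "6/5" 2]) auto
  obtain C where C: "C > 0" "testing_bound TYPE('n) (of_real \<alpha>) p C"
    by (rule max_op_bounded_testing[OF bd p]) auto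
  define V where "V = unit_ball_vol (real ?n)"
  have V: "V > 0" by (simp add: V_def)
  define b where "b = bump (3/4) / 2"
  have b: "b > 0" by (simp add: b_def bump_pos)
  define c1 where "c1 = c * 10 powr (\<alpha> - 1) * (b * (V * (1/6)))"
  have c1: "c1 > 0" using c V b by (simp add: c1_def)
  \<comment> \<open>Balance of powers: a maximal function of size l^(-\<alpha>) on a ball of volume
    about l^(-n), against a support of volume about 1/l.\<close>
  have main: "(c1 powr p * (V / 2)) * l powr (- \<alpha> * p - real ?n) \<le> (C * (V * (2 ^ ?n * real ?n * 2))) * l powr (- 1)"
    if l: "l \<ge> 50" for l :: real
  proof -
    define g where "g x = bump (1 - (l * ((norm x)\<^sup>2 - 1))\<^sup>2)" for x :: "real ^ 'n"
    have gs: "smooth_on UNIV g" unfolding g_def[abs_def]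
      by (intro smooth_on_bump smooth_on_diff smooth_on_const smooth_on_power smooth_on_mult smooth_on_norm2 open_UNIV)
    have gnn: "g x \<ge> 0" for x by (simp add: g_def bump_nonneg)
    have gsupp: "\<bar>(norm x)\<^sup>2 - 1\<bar> < 1 / l" if "g x \<noteq> 0" for x
    proof -
      have "(l * ((norm x)\<^sup>2 - 1))\<^sup>2 < 1" using that by (rule contrapos_np) (simp add: g_def bumpd_eq_0)
      then have "\<bar>l * ((norm x)\<^sup>2 - 1)\<bar> < 1" by (simp add: abs_square_less_1)
      then have "l * \<bar>(norm x)\<^sup>2 - 1\<bar> < 1" using l unfolding abs_mult by simp
      then show ?thesis using l by (simp add: pos_less_divide_eq mult.commute)
    qed
    define r1 where "r1 = sqrt (1 - 1 / l)"
    define R1 where "R1 = sqrt (1 + 1 / l)"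
    define R2 where "R2 = sqrt (1 + 1 / (2 * l))"
    have l1: "1 / l \<le> 1 / 50" "1 / l > 0" using l by (auto simp: field_simps)
    have l2: "1 / (2 * l) \<le> 1 / 100" "1 / (2 * l) > 0" using l by (auto simp: field_simps)
    have r1: "0 \<le> r1" "r1 \<le> 1" "r1\<^sup>2 = 1 - 1 / l" using l1 by (auto simp: r1_def)
    have R1: "1 \<le> R1" "R1\<^sup>2 = 1 + 1 / l" using l1 by (auto simp: R1_def)
    have R1b: "R1 \<le> 2" unfolding R1_def using l1 by (intro sqrt_one_plus_le_2) linarith
    have R2: "1 \<le> R2" "R2\<^sup>2 = 1 + 1 / (2 * l)" using l1 by (auto simp: R2_def)
    have R2b: "R2 \<le> 2" unfolding R2_def using l1 l2 by (intro sqrt_one_plus_le_2) linarith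
    define S where "S = cball (0 :: real^'n) R1 - ball 0 r1"
    have S: "compact S" unfolding S_def by (intro compact_diff compact_cball open_ball)
    have gS: "x \<in> S" if "g x \<noteq> 0" for x
    proof -
      have "(norm x)\<^sup>2 \<le> R1\<^sup>2" "r1\<^sup>2 \<le> (norm x)\<^sup>2" using gsupp[OF that] r1 R1 by auto
      then have "norm x \<le> R1" "r1 \<le> norm x" using R1 r1 by (auto intro: power2_le_imp_le)
      then show ?thesis by (simp add: S_def)
    qed
    \<comment> \<open>A thinner shell on which \<open>g\<close> is bounded below: the outer radius
      \<open>R2\<close> keeps the argument of \<open>bump\<close> above 3/4, and the density is at
      least 1/2 there.\<close>
    define T where "T = cball (0 :: real^'n) R2 - ball 0 1"
    have T: "compact T" unfolding T_def by (intro compact_diff compact_cball open_ball)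
    have gT: "b \<le> g x * dens x" if "x \<in> T" for x
    proof -
      have n: "1 \<le> norm x" "norm x \<le> R2" using that by (auto simp: T_def)
      have n2: "1 \<le> (norm x)\<^sup>2" "(norm x)\<^sup>2 \<le> R2\<^sup>2" using n by (auto intro: power_mono)
      then have "0 \<le> l * ((norm x)\<^sup>2 - 1)" "l * ((norm x)\<^sup>2 - 1) \<le> 1 / 2"
        using R2 l by (auto simp: field_simps)
      then have "(l * ((norm x)\<^sup>2 - 1))\<^sup>2 \<le> (1/2)\<^sup>2" by (intro power_mono)
      then have "bump (3/4) \<le> g x" unfolding g_def by (intro bump_mono) (simp add: power2_eq_square)
      moreover have "1 / 2 \<le> dens x"
      proof -
        have "sqrt (1 + (norm x)\<^sup>2) \<le> 2" using n2 R2 l1 l2 by (intro sqrt_one_plus_le_2) linarith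
        then show ?thesis using one_plus_norm2_pos[of x] by (simp add: dens_def field_simps)
      qed
      ultimately have "bump (3/4) * (1 / 2) \<le> g x * dens x"
        using gnn[of x] by (intro mult_mono) auto
      then show ?thesis by (simp add: b_def)
    qed
    have mT: "V * (1 / (6 * l)) \<le> measure lborel T"
    proof -
      have "1 / (2 * l) = (R2 - 1) * (R2 + 1)" using R2 by (simp add: algebra_simps power2_eq_square)
      also have "\<dots> \<le> (R2 - 1) * 3" using R2 R2b by (intro mult_left_mono) auto
      finally have "1 / (6 * l) \<le> R2 - 1" by simp
      also have "\<dots> \<le> R2 ^ ?n - 1 ^ ?n"
        using R2 power_increasing[of 1 ?n R2] by (simp add: Suc_leI)
      finally have "V * (1 / (6 * l)) \<le> V * (R2 ^ ?n - 1 ^ ?n)" using V by (intro mult_left_mono) auto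
      then show ?thesis unfolding T_def using R2 by (subst measure_shell) (auto simp: V_def)
    qed
    have mS: "measure lborel S \<le> V * (2 ^ ?n * real ?n * 2) * (1 / l)"
    proof -
      have "R1 - r1 \<le> (R1 - r1) * (R1 + r1)" using R1 r1 mult_left_mono[of 1 "R1 + r1" "R1 - r1"] by simp
      also have "\<dots> = 2 / l" using R1 r1 by (simp add: algebra_simps power2_eq_square)
      finally have d: "R1 - r1 \<le> 2 / l" .
      \<comment> \<open>The radii are halved because the estimate for differences of powers is for
        numbers of modulus at most 1.\<close>
      have "R1 ^ ?n - r1 ^ ?n = 2 ^ ?n * ((R1 / 2) ^ ?n - (r1 / 2) ^ ?n)" by (simp add: power_divide field_simps)
      also have "\<dots> \<le> 2 ^ ?n * (real ?n * (R1 / 2 - r1 / 2))"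
        using norm_power_diff[of "R1 / 2" "r1 / 2" ?n] R1 R1b r1 by (intro mult_left_mono) auto
      also have "\<dots> \<le> 2 ^ ?n * (real ?n * (2 / l))"
        using d R1 r1 by (intro mult_left_mono) auto
      finally have "R1 ^ ?n - r1 ^ ?n \<le> 2 ^ ?n * real ?n * 2 * (1 / l)" by simp
      then have "V * (R1 ^ ?n - r1 ^ ?n) \<le> V * (2 ^ ?n * real ?n * 2 * (1 / l))"
        using V by (intro mult_left_mono) auto
      then show ?thesis unfolding S_def using R1 r1 by (subst measure_shell) (auto simp: V_def mult.assoc)
    qed
    have int: "integrable lborel (\<lambda>x. g x * dens x)"
      using gS by (intro integrable_continuous_compact[OF _ S] continuous_on_mult smooth_on_continuous_on gs dens_smooth) auto
    have "b * measure lborel T \<le> integral\<^sup>L lborel (\<lambda>x. g x * dens x)"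
      by (rule measure_mult_le_integral[OF int mult_nonneg_nonneg[OF gnn less_imp_le[OF dens_pos]] T gT])
    moreover have "b * (V * (1 / (6 * l))) \<le> b * measure lborel T" using mT b by (intro mult_left_mono) auto
    ultimately have I: "b * (V * (1 / (6 * l))) \<le> integral\<^sup>L lborel (\<lambda>x. g x * dens x)" by linarith
    define v0 where "v0 = sqrt 2 - 5 / l"
    define v1 where "v1 = sqrt 2 + 5 / l"
    have s2: "13/10 \<le> sqrt (2::real)" "sqrt (2::real) \<le> 3/2"
      by (rule real_le_rsqrt, simp add: power2_eq_square) (rule real_le_lsqrt, simp_all add: power2_eq_square)
    have l5: "5 / l \<le> 1/10" "5 / l > 0" using l by (auto simp: field_simps)
    have v: "6/5 \<le> v0" "v0 < v1" "v1 \<le> 2" using s2 l5 unfolding v0_def v1_def by linarith+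
    \<comment> \<open>Errors of 1/l from the norm of x, 8/(5l) from the root containing a, and
      3/(2l) from the inner product add up to less than 5/l.\<close>
    have hyb: "v0 \<le> hy a x \<and> hy a x < v1" if a: "norm a \<le> 1 / l" and gx: "g x \<noteq> 0" for a x :: "real ^ 'n"
    proof -
      have n: "\<bar>(norm x)\<^sup>2 - 1\<bar> < 1 / l" by (rule gsupp[OF gx])
      have sx: "\<bar>sqrt (1 + (norm x)\<^sup>2) - sqrt 2\<bar> \<le> 1 / l"
        using abs_sqrt_diff_le[of "1 + (norm x)\<^sup>2" 2] n by simp
      have "(norm a)\<^sup>2 \<le> (1 / l)\<^sup>2" using a by (intro power_mono) auto
      also have "\<dots> \<le> 1 / l"
        unfolding power2_eq_square using l1 mult_left_mono[of "1 / l" 1 "1 / l"] by linarith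
      finally have "(norm a)\<^sup>2 \<le> 1 / l" .
      then have sa: "1 \<le> sqrt (1 + (norm a)\<^sup>2)" "sqrt (1 + (norm a)\<^sup>2) \<le> 1 + 1 / l"
        using sqrt_one_plus_le[of "(norm a)\<^sup>2"] by auto
      have "(norm x)\<^sup>2 \<le> 1 + 1/50" using n l1 by linarith
      also have "\<dots> \<le> (3/2)\<^sup>2" by (simp add: power2_eq_square)
      finally have "(norm x)\<^sup>2 \<le> (3/2)\<^sup>2" .
      then have "norm x \<le> 3/2" by (rule power2_le_imp_le) simp
      then have "norm a * norm x \<le> 1 / l * (3/2)" using a l1 by (intro mult_mono) auto
      then have ax: "\<bar>a \<bullet> x\<bar> \<le> 3/2 * (1 / l)"
        using order_trans[OF Cauchy_Schwarz_ineq2[of a x]] by (simp only: mult.commute)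
      let ?A = "sqrt (1 + (norm a)\<^sup>2)" and ?X = "sqrt (1 + (norm x)\<^sup>2)"
      have "1 * ?X \<le> ?A * ?X" using sa by (intro mult_right_mono) auto
      moreover have "?A * ?X \<le> (1 + 1 / l) * ?X" using sa by (intro mult_right_mono) auto
      moreover have "1 / l * ?X \<le> 1 / l * (8/5)"
        using sx s2 l1 by (intro mult_left_mono) linarith+
      ultimately have "?X \<le> ?A * ?X" "?A * ?X \<le> ?X + 8/5 * (1 / l)" by (auto simp: algebra_simps)
      moreover have "5 / l = 5 * (1 / l)" by simp
      moreover have "s - f \<le> P - d \<and> P - d < s + f"
        if "X \<le> P" "P \<le> X + 8/5 * q" "f = 5 * q" "\<bar>d\<bar> \<le> 3/2 * q" "\<bar>X - s\<bar> \<le> q" "0 < q"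
        for s f P d X q :: real
        using that by linarith
      ultimately show ?thesis using ax sx l1(2) unfolding hy_def v0_def v1_def by blast
    qed
    define B where "B = c1 * l powr (- \<alpha>)"
    have Bval: "B \<le> c * (v1 - v0) powr (\<alpha> - 1) * integral\<^sup>L lborel (\<lambda>x. g x * dens x)"
    proof -
      have "v1 - v0 = 10 * (1 / l)" by (simp add: v0_def v1_def)
      then have e: "(v1 - v0) powr (\<alpha> - 1) = 10 powr (\<alpha> - 1) * (l powr (- \<alpha>) * l)"
      proof -
        have "(1 / l) powr (\<alpha> - 1) = l powr (- (\<alpha> - 1))"
          using l by (simp only: powr_divide powr_minus_divide powr_one_eq_one)
        also have "\<dots> = l powr (- \<alpha>) * l" using l powr_add[of l "- \<alpha>" 1] by simp
        finally show ?thesis using l \<open>v1 - v0 = 10 * (1 / l)\<close> by (simp only: powr_mult)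
      qed
      have "B = c * (v1 - v0) powr (\<alpha> - 1) * (b * (V * (1 / (6 * l))))"
        unfolding B_def c1_def e using l by (simp add: field_simps)
      also have "\<dots> \<le> c * (v1 - v0) powr (\<alpha> - 1) * integral\<^sup>L lborel (\<lambda>x. g x * dens x)"
        using I c(1) by (intro mult_left_mono) auto
      finally show ?thesis .
    qed
    define Z where "Z = cball (0 :: real^'n) (1 / l)"
    have Zb: "max_op (of_real \<alpha>) (lift_fun g) (hchart a) \<ge> ennreal B" if "a \<in> Z" for a
    proof -
      have a: "norm a \<le> 1 / l" using that by (simp add: Z_def)
      have "ennreal B \<le> ennreal (c * (v1 - v0) powr (\<alpha> - 1) * integral\<^sup>L lborel (\<lambda>x. g x * dens x))"
        by (rule ennreal_leI[OF Bval])
      also have "\<dots> \<le> max_op (of_real \<alpha>) (lift_fun g) (hchart a)"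
        by (rule averaged_lower_boundD[OF c(2) gs gnn S _ hyb[OF a] v]) (use gS in blast)
      finally show ?thesis .
    qed
    have Zd: "1 / 2 \<le> dens a" if "a \<in> Z" for a
    proof -
      have "norm a \<le> 1" using that l1 unfolding Z_def mem_cball_0 by linarith
      then have "(norm a)\<^sup>2 \<le> 1" by (simp add: power_le_one)
      then have "sqrt (1 + (norm a)\<^sup>2) \<le> 2" by (intro sqrt_one_plus_le_2) linarith
      then show ?thesis using one_plus_norm2_pos[of a] by (simp add: dens_def field_simps)
    qed
    have mZ: "measure lborel Z = V * (1 / l) ^ ?n"
      unfolding Z_def using l1 by (subst content_cball) (auto simp: V_def)
    have "B powr p * (1 / 2 * measure lborel Z) \<le> C * measure lborel S"
    proof (rule testing_boundD[OF C(2) gs S])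
      show "(\<integral>\<^sup>+x. ennreal (dens x * \<bar>g x\<bar> powr p) \<partial>lborel) \<le> ennreal (measure lborel S)"
        by (rule nn_integral_dens_powr_le[OF S gS]) (use gnn bump_le_1 p in \<open>auto simp: g_def\<close>)
      show "ennreal (1 / 2 * measure lborel Z) \<le> (\<integral>\<^sup>+x. ennreal (dens x) * indicator Z x \<partial>lborel)"
        by (rule measure_mult_le_nn_integral) (use Zd in \<open>auto simp: Z_def\<close>)
      show "0 \<le> B" using c1 by (simp add: B_def)
    qed (use gS Zb in \<open>auto simp: Z_def\<close>)
    also have "\<dots> \<le> C * (V * (2 ^ ?n * real ?n * 2) * (1 / l))" using mS C(1) by (intro mult_left_mono) auto
    also have "\<dots> = (C * (V * (2 ^ ?n * real ?n * 2))) * l powr (- 1)"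
      using l by (simp add: powr_minus_divide)
    finally have "B powr p * (1 / 2 * measure lborel Z) \<le> (C * (V * (2 ^ ?n * real ?n * 2))) * l powr (- 1)" .
    moreover have "B powr p * (1 / 2 * measure lborel Z) = (c1 powr p * (V / 2)) * l powr (- \<alpha> * p - real ?n)"
    proof -
      have "(1 / l) ^ ?n = l powr (- real ?n)" 
        using l by (simp add: power_one_over powr_minus_divide powr_realpow)
      moreover have "B powr p = c1 powr p * l powr (- \<alpha> * p)" using c1 l by (simp add: B_def powr_mult powr_powr)
      moreover have "l powr (- \<alpha> * p) * l powr (- real ?n) = l powr (- \<alpha> * p - real ?n)"
        by (simp flip: powr_add)
      ultimately show ?thesis unfolding mZ by simp
    qed
    ultimately show ?thesis by simp
  qed
  have "- \<alpha> * p - real ?n \<le> - 1"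
    by (rule powr_exponent_le[OF _ main]) (use c1 V in auto)
  then show ?thesis using p by (simp add: field_simps)
qed

definition slab :: "'n \<Rightarrow> real \<Rightarrow> real \<Rightarrow> real \<Rightarrow> (real ^ 'n) set" where
  "slab k u v w = cbox (\<chi> j. if j = k then u else - w) (\<chi> j. if j = k then v else w)"

lemma mem_slab: "x \<in> slab k u v w \<longleftrightarrow> u \<le> x $ k \<and> x $ k \<le> v \<and> (\<forall>j. j \<noteq> k \<longrightarrow> \<bar>x $ j\<bar> \<le> w)"
proof -
  have "x \<in> slab k u v w \<longleftrightarrow> (\<forall>j. (if j = k then u else - w) \<le> x $ j \<and> x $ j \<le> (if j = k then v else w))"
    by (simp add: slab_def mem_box_cart)
  also have "\<dots> \<longleftrightarrow> (\<forall>j. if j = k then u \<le> x $ k \<and> x $ k \<le> v else \<bar>x $ j\<bar> \<le> w)"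
    by (intro iff_allI) (auto simp: abs_le_iff)
  finally show ?thesis by auto
qed

lemma compact_slab: "compact (slab k u v w)"
  by (simp add: slab_def)

lemma measure_slab:
  fixes k :: "'n::finite"
  assumes "u \<le> v" "0 \<le> w"
  shows "measure lborel (slab k u v w) = (v - u) * (2 * w) ^ (CARD('n) - 1)"
proof -
  have "(\<chi> j. if j = k then u else 0) \<in> slab k u v w" using assms by (simp add: mem_slab)
  then have "measure lborel (slab k u v w) = (\<Prod>j\<in>UNIV. if j = k then v - u else 2 * w)"
    unfolding slab_def by (subst content_cbox_cart) (auto intro!: prod.cong)
  also have "\<dots> = (v - u) * (\<Prod>j\<in>UNIV - {k}. 2 * w)"
    by (subst prod.remove[of _ k]) auto
  finally show ?thesis by (simp add: card_Diff_singleton)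
qed

lemma norm2_eq_sum: "(norm x)\<^sup>2 = (\<Sum>j\<in>UNIV. (x $ j)\<^sup>2)" for x :: "real ^ 'n"
  unfolding power2_norm_eq_inner inner_vec_def by (simp add: power2_eq_square)

lemma norm2_le_card:
  fixes x :: "real ^ 'n::finite"
  assumes "\<And>j. \<bar>x $ j\<bar> \<le> w"
  shows "(norm x)\<^sup>2 \<le> real CARD('n) * w\<^sup>2"
proof -
  have "(\<Sum>j\<in>UNIV. (x $ j)\<^sup>2) \<le> (\<Sum>j\<in>(UNIV :: 'n set). w\<^sup>2)"
    using assms by (intro sum_mono) (metis abs_ge_zero power2_abs power_mono)
  then show ?thesis by (simp add: norm2_eq_sum)
qed

text \<open>Test functions on a cap of thickness \<open>m\<^sup>-\<^sup>2\<close> and width \<open>m\<^sup>-\<^sup>1\<close>, which is nearly tangent to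
  the geodesic spheres centred on a tube orthogonal to it.\<close>

lemma necessary_cap:
  assumes \<alpha>: "\<alpha> > (1 - real CARD('n::finite)) / 2" "\<alpha> < 0" and p: "p > 0"
    and bd: "max_op_bounded TYPE('n) (of_real \<alpha>) p"
  shows "\<alpha> \<ge> 1 / p - (real CARD('n) - 1) / 2"
proof -
  define n where "n = CARD('n)"
  have n: "n \<ge> 1" by (simp add: n_def Suc_leI)
  define N where "N = real n"
  have N: "N \<ge> 1" using n by (simp add: N_def)
  \<comment> \<open>K is (5 + N) + 2 N + 1: the first two terms bound, in units of q, the deviation
    of \<open>hy a x\<close> from its value at x = 0, and the last makes the inequalities
    strict.\<close>
  define K where "K = 6 + 3 * N"
  have K: "K > 0" using N by (simp add: K_def)
  obtain k :: 'n where True by blast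
  obtain c where c: "c > 0" "averaged_lower_bound TYPE('n) \<alpha> (6/5) (6 + N) c"
    by (rule max_op_lower_bound[OF \<alpha>, of "6/5" "6 + N"]) auto
  obtain C where C: "C > 0" "testing_bound TYPE('n) (of_real \<alpha>) p C"
    by (rule max_op_bounded_testing[OF bd p]) auto
  define b where "b = bump (1/2) / 2"
  have b: "b > 0" by (simp add: b_def bump_pos)
  define c1 where "c1 = c * (2 * K) powr (\<alpha> - 1) * (b * (1 / N) ^ (n - 1))"
  have c1: "c1 > 0" using c K b N by (simp add: c1_def)
  define d where "d = 1 / sqrt (5 + N)"
  have d: "d > 0" using N by (simp add: d_def)
  \<comment> \<open>A lower bound of order m^(-2\<alpha> - (N - 1)) on a tube of volume about m^(-(N
    - 1)), against a support of volume about m^(-2 - (N - 1)).\<close>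
  have main: "(c1 powr p * (d * 2 ^ (n - 1))) * m powr ((- 2 * \<alpha> - (N - 1)) * p - (N - 1))
      \<le> (C * (2 * 2 ^ (n - 1))) * m powr (- 2 - (N - 1))"
    if m: "m \<ge> 10 * K" for m :: real
  proof -
    have mN: "m \<ge> N" "m \<ge> 1" using m N by (auto simp: K_def)
    have m0: "m > 0" using mN by simp
    have mm: "m * 1 \<le> m * m" using mN by (intro mult_left_mono) auto
    define q where "q = 1 / m\<^sup>2"
    have "1 \<le> m * m" using mm mN by linarith
    then have q: "q > 0" "q \<le> 1" "m\<^sup>2 * q = 1" using m0 by (auto simp: q_def power2_eq_square)
    have Kq: "K * q \<le> 1 / 10"
    proof -
      have "10 * K \<le> m\<^sup>2" using m mm by (simp add: power2_eq_square)
      then have "10 * K * q \<le> m\<^sup>2 * q" using q by (intro mult_right_mono) auto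
      then show ?thesis using q by simp
    qed
    have q4: "m ^ 4 * q\<^sup>2 = 1"
    proof -
      have "m ^ 4 * q\<^sup>2 = (m\<^sup>2 * q)\<^sup>2" by (simp add: power_mult_distrib)
      then show ?thesis using q by simp
    qed
    have qm: "(1 / m)\<^sup>2 = q" by (simp add: q_def power_divide)
    \<comment> \<open>The two quadratic terms confine \<open>x $ k\<close> to size q = m^(-2) and
      the norm of x to size 1/m.\<close>
    define g where "g x = bump (1 - m ^ 4 * (x $ k)\<^sup>2 - m\<^sup>2 * (norm x)\<^sup>2)" for x :: "real ^ 'n"
    have gs: "smooth_on UNIV g" unfolding g_def[abs_def]
      by (intro smooth_on_bump smooth_on_diff smooth_on_const smooth_on_power smooth_on_mult smooth_on_nth smooth_on_norm2 open_UNIV)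
    have gnn: "g x \<ge> 0" for x by (simp add: g_def bump_nonneg)
    have gsupp: "\<bar>x $ k\<bar> \<le> q" "(norm x)\<^sup>2 \<le> q" "norm x \<le> 1 / m" if "g x \<noteq> 0" for x
    proof -
      have "m ^ 4 * (x $ k)\<^sup>2 + m\<^sup>2 * (norm x)\<^sup>2 < 1"
        using that by (rule contrapos_np) (simp add: g_def bumpd_eq_0)
      moreover have "0 \<le> m ^ 4 * (x $ k)\<^sup>2" "0 \<le> m\<^sup>2 * (norm x)\<^sup>2" by simp_all
      ultimately have 1: "m ^ 4 * (x $ k)\<^sup>2 \<le> m ^ 4 * q\<^sup>2" "m\<^sup>2 * (norm x)\<^sup>2 \<le> m\<^sup>2 * q"
        unfolding q4 q(3) by linarith+
      then have "(x $ k)\<^sup>2 \<le> q\<^sup>2" using m0 by simp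
      then show "\<bar>x $ k\<bar> \<le> q" using q(1) by (simp add: abs_le_square_iff[symmetric])
      show *: "(norm x)\<^sup>2 \<le> q" using 1(2) m0 by simp
      then have "(norm x)\<^sup>2 \<le> (1 / m)\<^sup>2" by (simp only: qm)
      then show "norm x \<le> 1 / m" by (rule power2_le_imp_le) (use m0 in simp)
    qed
    define S where "S = slab k (- q) q (1 / m)"
    have S: "compact S" unfolding S_def by (rule compact_slab)
    have gS: "x \<in> S" if "g x \<noteq> 0" for x
    proof -
      have "\<bar>x $ j\<bar> \<le> 1 / m" for j using component_le_norm_cart[of x j] gsupp(3)[OF that] by linarith
      then show ?thesis using gsupp(1)[OF that] by (simp add: S_def mem_slab abs_le_iff)
    qed
    \<comment> \<open>The factor 1/(2N) in the width keeps |x|^2 below q/4, so both quadratic terms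
      are at most 1/4 and \<open>g\<close> is at least \<open>bump (1/2)\<close>.\<close>
    define T where "T = slab k (- (q / 2)) (q / 2) (1 / (2 * N * m))"
    have T: "compact T" unfolding T_def by (rule compact_slab)
    have gT: "b \<le> g x * dens x" if "x \<in> T" for x
    proof -
      have xk: "\<bar>x $ k\<bar> \<le> q / 2" using that by (auto simp: T_def mem_slab)
      have "q / 2 \<le> 1 / (2 * N * m)"
        using mN N m0 by (simp add: q_def power2_eq_square field_simps)
      then have "\<bar>x $ j\<bar> \<le> 1 / (2 * N * m)" for j
        using that xk by (cases "j = k") (auto simp: T_def mem_slab)
      then have "(norm x)\<^sup>2 \<le> real CARD('n) * (1 / (2 * N * m))\<^sup>2" by (rule norm2_le_card)
      also have "\<dots> = 1 / N * (q / 4)" using N by (simp add: N_def n_def q_def power2_eq_square)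
      also have "\<dots> \<le> 1 * (q / 4)" using N q by (intro mult_right_mono) auto
      finally have nx: "(norm x)\<^sup>2 \<le> q / 4" by simp
      have "m\<^sup>2 * (norm x)\<^sup>2 \<le> m\<^sup>2 * (q / 4)" using nx by (intro mult_left_mono) auto
      then have 1: "m\<^sup>2 * (norm x)\<^sup>2 \<le> 1 / 4" using q(3) by simp
      have "(x $ k)\<^sup>2 \<le> (q / 2)\<^sup>2" using xk by (metis abs_ge_zero power2_abs power_mono)
      then have "m ^ 4 * (x $ k)\<^sup>2 \<le> m ^ 4 * (q / 2)\<^sup>2" by (intro mult_left_mono) auto
      then have 2: "m ^ 4 * (x $ k)\<^sup>2 \<le> 1 / 4" using q4 by (simp add: power_divide)
      have "bump (1/2) \<le> g x" unfolding g_def using 1 2 by (intro bump_mono) linarith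
      moreover have "1 / 2 \<le> dens x"
      proof -
        have "sqrt (1 + (norm x)\<^sup>2) \<le> 2" using nx q by (intro sqrt_one_plus_le_2) linarith
        then show ?thesis using one_plus_norm2_pos[of x] by (simp add: dens_def field_simps)
      qed
      ultimately have "bump (1/2) * (1 / 2) \<le> g x * dens x"
        using gnn[of x] by (intro mult_mono) auto
      then show ?thesis by (simp add: b_def)
    qed
    have mT: "measure lborel T = q * ((1 / N) ^ (n - 1) * (1 / m) ^ (n - 1))"
    proof -
      have "measure lborel T = q * (2 * (1 / (2 * N * m))) ^ (n - 1)"
        unfolding T_def n_def using q N m0 by (subst measure_slab) auto
      also have "2 * (1 / (2 * N * m)) = (1 / N) * (1 / m)" using N m0 by simp
      finally show ?thesis by (simp only: power_mult_distrib)
    qed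
    have mS: "measure lborel S = 2 * q * (2 ^ (n - 1) * (1 / m) ^ (n - 1))"
    proof -
      have "measure lborel S = 2 * q * (2 * (1 / m)) ^ (n - 1)"
        unfolding S_def n_def using q m0 by (subst measure_slab) auto
      then show ?thesis by (simp only: power_mult_distrib)
    qed
    have int: "integrable lborel (\<lambda>x. g x * dens x)"
      using gS by (intro integrable_continuous_compact[OF _ S] continuous_on_mult smooth_on_continuous_on gs dens_smooth) auto
    have I: "b * measure lborel T \<le> integral\<^sup>L lborel (\<lambda>x. g x * dens x)"
      by (rule measure_mult_le_integral[OF int mult_nonneg_nonneg[OF gnn less_imp_le[OF dens_pos]] T gT])
    define Z where "Z = slab k 1 2 (1 / m)"
    have Za: "1 \<le> (norm a)\<^sup>2" "(norm a)\<^sup>2 \<le> 4 + N" "\<And>j. j \<noteq> k \<Longrightarrow> \<bar>a $ j\<bar> \<le> 1 / m" "1 \<le> a $ k" "a $ k \<le> 2" if "a \<in> Z" for a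
    proof -
      show a: "\<And>j. j \<noteq> k \<Longrightarrow> \<bar>a $ j\<bar> \<le> 1 / m" "1 \<le> a $ k" "a $ k \<le> 2"
        using that by (auto simp: Z_def mem_slab)
      have s: "(norm a)\<^sup>2 = (a $ k)\<^sup>2 + (\<Sum>j\<in>UNIV - {k}. (a $ j)\<^sup>2)"
        unfolding norm2_eq_sum by (rule sum.remove) auto
      have "1 \<le> (a $ k)\<^sup>2" using a by (simp add: one_le_power)
      moreover have "0 \<le> (\<Sum>j\<in>UNIV - {k}. (a $ j)\<^sup>2)" by (simp add: sum_nonneg)
      ultimately show "1 \<le> (norm a)\<^sup>2" unfolding s by linarith
      have "(a $ k)\<^sup>2 \<le> 2\<^sup>2" using a by (intro power_mono) auto
      moreover have "(\<Sum>j\<in>UNIV - {k}. (a $ j)\<^sup>2) \<le> (\<Sum>j\<in>UNIV - {k}. 1)"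
      proof (rule sum_mono)
        fix j assume "j \<in> UNIV - {k}"
        then have "\<bar>a $ j\<bar> \<le> 1 / m" using a(1) by simp
        also have "\<dots> \<le> 1" using mN by simp
        finally show "(a $ j)\<^sup>2 \<le> 1" by (simp add: abs_square_le_1)
      qed
      moreover have "(\<Sum>j\<in>UNIV - {k}. 1) \<le> N" by (simp add: N_def n_def card_Diff_singleton)
      ultimately show "(norm a)\<^sup>2 \<le> 4 + N" unfolding s by simp
    qed
    have hyb: "sqrt (1 + (norm a)\<^sup>2) - K * q \<le> hy a x \<and> hy a x < sqrt (1 + (norm a)\<^sup>2) + K * q"
      if a: "a \<in> Z" and gx: "g x \<noteq> 0" for a x
    proof -
      let ?A = "sqrt (1 + (norm a)\<^sup>2)" and ?X = "sqrt (1 + (norm x)\<^sup>2)"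
      have "?A \<le> 5 + N"
        using Za(2)[OF a] N by (intro sqrt_le_bound) (auto simp: N_def)
      moreover have X: "0 \<le> ?X - 1" "?X - 1 \<le> q"
        using sqrt_one_plus_le[of "(norm x)\<^sup>2"] gsupp(2)[OF gx] by auto
      ultimately have 1: "0 \<le> ?A * (?X - 1)" "?A * (?X - 1) \<le> (5 + N) * q"
        using N by (auto intro!: mult_mono)
      have "\<bar>a \<bullet> x\<bar> \<le> (\<Sum>j\<in>UNIV. \<bar>a $ j * x $ j\<bar>)" by (simp add: inner_vec_def sum_abs)
      also have "\<dots> \<le> (\<Sum>j\<in>(UNIV :: 'n set). 2 * q)"
      proof (rule sum_mono)
        fix j :: 'n
        show "\<bar>a $ j * x $ j\<bar> \<le> 2 * q"
        proof (cases "j = k")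
          case True
          then show ?thesis using Za(4,5)[OF a] gsupp(1)[OF gx] unfolding abs_mult
            by (intro mult_mono) auto
        next
          case False
          \<comment> \<open>Off the axis both factors are at most 1/m and the product is at most q;
            this is what fixes the width of the tube of centres.\<close>
          have "\<bar>x $ j\<bar> \<le> 1 / m" using component_le_norm_cart[of x j] gsupp(3)[OF gx] by linarith
          then have "\<bar>a $ j * x $ j\<bar> \<le> (1 / m) * (1 / m)"
            unfolding abs_mult using Za(3)[OF a False] m0 by (intro mult_mono) auto
          also have "\<dots> = q" by (simp add: q_def power2_eq_square)
          finally show ?thesis using q by simp
        qed
      qed
      also have "\<dots> = 2 * N * q" by (simp add: N_def n_def)
      finally have 2: "\<bar>a \<bullet> x\<bar> \<le> 2 * N * q" .
      have "hy a x = ?A + ?A * (?X - 1) - a \<bullet> x" by (simp add: hy_def algebra_simps)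
      moreover have "K * q = (5 + N) * q + 2 * N * q + q" by (simp add: K_def algebra_simps)
      moreover have "0 \<le> (5 + N) * q" using N q by simp
      ultimately show ?thesis using 1 2 q(1) by linarith
    qed
    define B where "B = c1 * m powr (- 2 * \<alpha> - (N - 1))"
    have mpow: "(1 / m) ^ (n - 1) = m powr (- (N - 1))"
    proof -
      have "(1 / m) ^ (n - 1) = 1 / m powr real (n - 1)" using m0 by (simp add: power_one_over powr_realpow)
      also have "real (n - 1) = N - 1" using n by (simp add: N_def of_nat_diff)
      also have "1 / m powr (N - 1) = m powr (- (N - 1))" by (simp only: powr_minus_divide)
      finally show ?thesis .
    qed
    have qpow: "q powr r = m powr (- 2 * r)" for r
    proof -
      have "q = m powr (- 2)" using m0 by (simp add: q_def powr_minus_divide powr_numeral)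
      then show ?thesis by (simp add: powr_powr)
    qed
    have Zb: "max_op (of_real \<alpha>) (lift_fun g) (hchart a) \<ge> ennreal B" if "a \<in> Z" for a
    proof -
      define A where "A = sqrt (1 + (norm a)\<^sup>2)"
      have "13/10 \<le> A" unfolding A_def using Za(1)[OF that] by (intro real_le_rsqrt) (simp add: power2_eq_square)
      moreover have "A \<le> 5 + N"
        unfolding A_def
        using Za(2)[OF that] N by (intro sqrt_le_bound) (auto simp: N_def)
      moreover have Kq0: "K * q > 0" using K q by simp
      ultimately have v: "6/5 \<le> A - K * q" "A - K * q < A + K * q" "A + K * q \<le> 6 + N" using Kq by linarith+
      have "(A + K * q) - (A - K * q) = (2 * K) * q" by simp
      then have e: "((A + K * q) - (A - K * q)) powr (\<alpha> - 1) = (2 * K) powr (\<alpha> - 1) * m powr (- 2 * (\<alpha> - 1))"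
        using K q by (simp only: powr_mult qpow)
      have "q = m powr (- 2)" using qpow[of 1] q by simp
      moreover have "m powr (- 2 * (\<alpha> - 1)) * (m powr (- 2) * m powr (- (N - 1))) = m powr (- 2 * \<alpha> - (N - 1))"
        by (simp add: algebra_simps flip: powr_add)
      ultimately have "m powr (- 2 * \<alpha> - (N - 1)) = m powr (- 2 * (\<alpha> - 1)) * (q * (1 / m) ^ (n - 1))"
        using mpow by simp
      then have "B = c * ((2 * K) powr (\<alpha> - 1) * m powr (- 2 * (\<alpha> - 1))) * (b * measure lborel T)"
        unfolding B_def c1_def mT by simp
      also have "\<dots> = c * ((A + K * q) - (A - K * q)) powr (\<alpha> - 1) * (b * measure lborel T)" by (simp only: e)
      also have "\<dots> \<le> c * ((A + K * q) - (A - K * q)) powr (\<alpha> - 1) * integral\<^sup>L lborel (\<lambda>x. g x * dens x)"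
        using I c(1) by (intro mult_left_mono) auto
      finally have "ennreal B \<le> ennreal (c * ((A + K * q) - (A - K * q)) powr (\<alpha> - 1) * integral\<^sup>L lborel (\<lambda>x. g x * dens x))"
        by (rule ennreal_leI)
      also have "\<dots> \<le> max_op (of_real \<alpha>) (lift_fun g) (hchart a)"
        by (rule averaged_lower_boundD[OF c(2) gs gnn S _ hyb[OF that, folded A_def] v]) (use gS in blast)
      finally show ?thesis .
    qed
    have Zd: "d \<le> dens a" if "a \<in> Z" for a
      unfolding d_def dens_def using Za(2)[OF that] one_plus_norm2_pos[of a] N
      by (intro divide_left_mono) auto
    have mZ: "measure lborel Z = 2 ^ (n - 1) * (1 / m) ^ (n - 1)"
    proof -
      have "measure lborel Z = (2 * (1 / m)) ^ (n - 1)"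
        unfolding Z_def n_def using m0 by (subst measure_slab) auto
      then show ?thesis by (simp only: power_mult_distrib)
    qed
    have "B powr p * (d * measure lborel Z) \<le> C * measure lborel S"
    proof (rule testing_boundD[OF C(2) gs S])
      show "(\<integral>\<^sup>+x. ennreal (dens x * \<bar>g x\<bar> powr p) \<partial>lborel) \<le> ennreal (measure lborel S)"
        by (rule nn_integral_dens_powr_le[OF S gS]) (use gnn bump_le_1 p in \<open>auto simp: g_def\<close>)
      show "ennreal (d * measure lborel Z) \<le> (\<integral>\<^sup>+x. ennreal (dens x) * indicator Z x \<partial>lborel)"
        by (rule measure_mult_le_nn_integral) (use Zd d in \<open>auto simp: Z_def compact_slab\<close>)
      show "0 \<le> B" using c1 by (simp add: B_def)
      show "Z \<in> sets borel" by (simp add: Z_def slab_def)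
    qed (use gS Zb d in auto)
    also have "C * measure lborel S = (C * (2 * 2 ^ (n - 1))) * (q * (1 / m) ^ (n - 1))"
      unfolding mS by simp
    also have "q * (1 / m) ^ (n - 1) = m powr (- 2 - (N - 1))"
      using qpow[of 1] q mpow by (simp flip: powr_add)
    also have "B powr p * (d * measure lborel Z)
        = (c1 powr p * (d * 2 ^ (n - 1))) * (m powr ((- 2 * \<alpha> - (N - 1)) * p) * m powr (- (N - 1)))"
      unfolding mZ mpow B_def using c1 by (simp add: powr_mult powr_powr)
    also have "m powr ((- 2 * \<alpha> - (N - 1)) * p) * m powr (- (N - 1)) = m powr ((- 2 * \<alpha> - (N - 1)) * p - (N - 1))"
      unfolding powr_add[symmetric] by (simp add: algebra_simps)
    finally show ?thesis .
  qed
  have "(- 2 * \<alpha> - (N - 1)) * p - (N - 1) \<le> - 2 - (N - 1)"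
    by (rule powr_exponent_le[OF _ main]) (use c1 d in auto)
  then show ?thesis using p by (simp add: field_simps N_def n_def)
qed

subsection \<open>Complete monotonicity along a flow\<close>

text \<open>Full differentiability at x is demanded although only the value along \<open>V\<close>
  is recorded, because \<open>vf_adjoint\<close> differentiates in every basis direction. The
  existential form lets the rules compose without naming derivatives.\<close>

definition has_vf_derivative :: "('a::euclidean_space \<Rightarrow> 'a) \<Rightarrow> ('a \<Rightarrow> real) \<Rightarrow> 'a \<Rightarrow> real \<Rightarrow> bool" where
  "has_vf_derivative V g x d \<longleftrightarrow> (\<exists>D. (g has_derivative D) (at x) \<and> D (V x) = d)"

lemma has_vf_derivative_const: "has_vf_derivative V (\<lambda>_. c) x 0"
  unfolding has_vf_derivative_def by (intro exI[of _ "\<lambda>_. 0"]) auto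

lemma has_vf_derivative_linear: "bounded_linear L \<Longrightarrow> has_vf_derivative V L x (L (V x))"
  unfolding has_vf_derivative_def using bounded_linear_imp_has_derivative by blast

lemma has_vf_derivative_add:
  assumes "has_vf_derivative V f x d" "has_vf_derivative V g x e"
  shows "has_vf_derivative V (\<lambda>x. f x + g x) x (d + e)"
proof -
  obtain D E where "(f has_derivative D) (at x)" "D (V x) = d" "(g has_derivative E) (at x)" "E (V x) = e"
    using assms unfolding has_vf_derivative_def by blast
  then show ?thesis
    unfolding has_vf_derivative_def using has_derivative_add[of f D "at x" g E]
    by (intro exI[of _ "\<lambda>h. D h + E h"]) auto
qed

lemma has_vf_derivative_mult:
  assumes "has_vf_derivative V f x d" "has_vf_derivative V g x e"
  shows "has_vf_derivative V (\<lambda>x. f x * g x) x (d * g x + f x * e)"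
proof -
  obtain D E where "(f has_derivative D) (at x)" "D (V x) = d" "(g has_derivative E) (at x)" "E (V x) = e"
    using assms unfolding has_vf_derivative_def by blast
  then show ?thesis
    unfolding has_vf_derivative_def using has_derivative_mult[of f D x UNIV g E]
    by (intro exI[of _ "\<lambda>h. f x * E h + D h * g x"]) auto
qed

lemma has_vf_derivative_compose:
  assumes "(\<phi> has_real_derivative \<phi>') (at (g x))" "has_vf_derivative V g x d"
  shows "has_vf_derivative V (\<lambda>x. \<phi> (g x)) x (\<phi>' * d)"
proof -
  obtain D where D: "(g has_derivative D) (at x)" "D (V x) = d"
    using assms(2) unfolding has_vf_derivative_def by blast
  show ?thesis
    unfolding has_vf_derivative_def
    using DERIV_compose_FDERIV[OF assms(1) D(1)] D(2)
    by (intro exI[of _ "\<lambda>v. D v * \<phi>'"]) auto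
qed

lemma has_vf_derivative_cmult:
  "has_vf_derivative V f x d \<Longrightarrow> has_vf_derivative V (\<lambda>x. c * f x) x (c * d)"
  using has_vf_derivative_mult[OF has_vf_derivative_const[of V c x], of f d] by simp

lemma has_vf_derivative_minus:
  "has_vf_derivative V f x d \<Longrightarrow> has_vf_derivative V (\<lambda>x. - f x) x (- d)"
  using has_vf_derivative_cmult[of V f x d "-1"] by simp

lemma has_vf_derivative_diff:
  "has_vf_derivative V f x d \<Longrightarrow> has_vf_derivative V g x e \<Longrightarrow> has_vf_derivative V (\<lambda>x. f x - g x) x (d - e)"
  using has_vf_derivative_add[OF _ has_vf_derivative_minus, of V f x d g e] by simp

lemma has_vf_derivative_sum:
  "(\<And>i. i \<in> I \<Longrightarrow> has_vf_derivative V (f i) x (d i)) \<Longrightarrow>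
    has_vf_derivative V (\<lambda>x. \<Sum>i\<in>I. f i x) x (\<Sum>i\<in>I. d i)"
  by (induction I rule: infinite_finite_induct)
    (auto intro: has_vf_derivative_const has_vf_derivative_add)

lemma has_vf_derivative_divide:
  assumes "has_vf_derivative V f x d" "has_vf_derivative V g x e" "g x \<noteq> 0"
  shows "has_vf_derivative V (\<lambda>x. f x / g x) x ((d * g x - f x * e) / (g x)\<^sup>2)"
proof -
  have "(inverse has_real_derivative - (inverse (g x) ^ Suc (Suc 0))) (at (g x))"
    by (rule DERIV_inverse[OF assms(3)])
  from has_vf_derivative_mult[OF assms(1) has_vf_derivative_compose[OF this assms(2)]]
  have "has_vf_derivative V (\<lambda>x. f x * inverse (g x)) x
     (d * inverse (g x) + f x * (- (inverse (g x) ^ Suc (Suc 0)) * e))" .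
  moreover have "d * inverse (g x) + f x * (- (inverse (g x) ^ Suc (Suc 0)) * e) = (d * g x - f x * e) / (g x)\<^sup>2"
    using assms(3) by (simp add: field_simps power2_eq_square)
  ultimately show ?thesis by (simp add: divide_inverse)
qed

lemma has_vf_derivative_cong:
  assumes "open S" "x \<in> S" "\<And>x. x \<in> S \<Longrightarrow> f x = g x" "has_vf_derivative V f x d"
  shows "has_vf_derivative V g x d"
  using assms has_derivative_transform_within_open[of f _ x UNIV S g]
  unfolding has_vf_derivative_def by blast

text \<open>Complete monotonicity up to order \<open>k\<close> along the flow of \<open>V\<close>.\<close>

primrec cm_along :: "nat \<Rightarrow> 'a::euclidean_space set \<Rightarrow> ('a \<Rightarrow> 'a) \<Rightarrow> ('a \<Rightarrow> real) \<Rightarrow> bool" where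
  "cm_along 0 S V g = (\<forall>x\<in>S. g x \<ge> 0)"
| "cm_along (Suc k) S V g = ((\<forall>x\<in>S. g x \<ge> 0) \<and>
     (\<exists>g'. (\<forall>x\<in>S. has_vf_derivative V g x (- g' x)) \<and> cm_along k S V g'))"

lemma cm_along_nonneg: "cm_along k S V g \<Longrightarrow> x \<in> S \<Longrightarrow> g x \<ge> 0"
  by (cases k) auto

lemma cm_along_SucI:
  "(\<And>x. x \<in> S \<Longrightarrow> g x \<ge> 0) \<Longrightarrow> (\<And>x. x \<in> S \<Longrightarrow> has_vf_derivative V g x (- g' x)) \<Longrightarrow>
    cm_along k S V g' \<Longrightarrow> cm_along (Suc k) S V g"
  by auto

lemma cm_along_SucE:
  assumes "cm_along (Suc k) S V g"
  obtains g' where "\<And>x. x \<in> S \<Longrightarrow> has_vf_derivative V g x (- g' x)" "cm_along k S V g'"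
  using assms by auto

lemma cm_along_SucD: "cm_along (Suc k) S V g \<Longrightarrow> cm_along k S V g"
proof (induction k arbitrary: g)
  case 0
  then show ?case by simp
next
  case (Suc k)
  from Suc.prems obtain g' where "\<And>x. x \<in> S \<Longrightarrow> has_vf_derivative V g x (- g' x)" "cm_along (Suc k) S V g'"
    by (rule cm_along_SucE) blast
  then show ?case using Suc.IH cm_along_nonneg[OF Suc.prems] by (intro cm_along_SucI) auto
qed

lemma cm_along_const: "c \<ge> 0 \<Longrightarrow> cm_along k S V (\<lambda>_. c)"
proof (induction k arbitrary: c)
  case (Suc k)
  show ?case
    by (rule cm_along_SucI[where g' = "\<lambda>_. 0"]) (use Suc has_vf_derivative_const[of V c] in auto)
qed simp

lemma cm_along_invariant:
  assumes "\<And>x. x \<in> S \<Longrightarrow> g x \<ge> 0" "\<And>x. x \<in> S \<Longrightarrow> has_vf_derivative V g x 0"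
  shows "cm_along k S V g"
  by (cases k) (use assms in \<open>auto intro!: exI[of _ "\<lambda>_. 0"] cm_along_const\<close>)

lemma cm_along_add: "cm_along k S V f \<Longrightarrow> cm_along k S V g \<Longrightarrow> cm_along k S V (\<lambda>x. f x + g x)"
proof (induction k arbitrary: f g)
  case (Suc k)
  obtain f' where f': "\<And>x. x \<in> S \<Longrightarrow> has_vf_derivative V f x (- f' x)" "cm_along k S V f'"
    using Suc.prems(1) by (rule cm_along_SucE) blast
  obtain g' where g': "\<And>x. x \<in> S \<Longrightarrow> has_vf_derivative V g x (- g' x)" "cm_along k S V g'"
    using Suc.prems(2) by (rule cm_along_SucE) blast
  show ?case
  proof (rule cm_along_SucI[where g' = "\<lambda>x. f' x + g' x"])
    show "has_vf_derivative V (\<lambda>x. f x + g x) x (- (f' x + g' x))" if "x \<in> S" for x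
      using has_vf_derivative_add[OF f'(1)[OF that] g'(1)[OF that]] by simp
    show "0 \<le> f x + g x" if "x \<in> S" for x
      using cm_along_nonneg[OF Suc.prems(1) that] cm_along_nonneg[OF Suc.prems(2) that] by simp
    show "cm_along k S V (\<lambda>x. f' x + g' x)" by (rule Suc.IH[OF f'(2) g'(2)])
  qed
qed simp

text \<open>By the Leibniz rule, minus the derivative of the product is a sum of products of
  functions that are completely monotone one order lower.\<close>

lemma cm_along_mult: "cm_along k S V f \<Longrightarrow> cm_along k S V g \<Longrightarrow> cm_along k S V (\<lambda>x. f x * g x)"
proof (induction k arbitrary: f g)
  case (Suc k)
  obtain f' where f': "\<And>x. x \<in> S \<Longrightarrow> has_vf_derivative V f x (- f' x)" "cm_along k S V f'"
    using Suc.prems(1) by (rule cm_along_SucE) blast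
  obtain g' where g': "\<And>x. x \<in> S \<Longrightarrow> has_vf_derivative V g x (- g' x)" "cm_along k S V g'"
    using Suc.prems(2) by (rule cm_along_SucE) blast
  show ?case
  proof (rule cm_along_SucI[where g' = "\<lambda>x. f' x * g x + f x * g' x"])
    show "has_vf_derivative V (\<lambda>x. f x * g x) x (- (f' x * g x + f x * g' x))" if "x \<in> S" for x
      using has_vf_derivative_mult[OF f'(1)[OF that] g'(1)[OF that]] by simp
    show "0 \<le> f x * g x" if "x \<in> S" for x
      using cm_along_nonneg[OF Suc.prems(1) that] cm_along_nonneg[OF Suc.prems(2) that] by simp
    show "cm_along k S V (\<lambda>x. f' x * g x + f x * g' x)"
      by (intro cm_along_add Suc.IH f'(2) g'(2) cm_along_SucD[OF Suc.prems(1)] cm_along_SucD[OF Suc.prems(2)])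
  qed
qed simp

lemma cm_along_sum: "(\<And>i. i \<in> I \<Longrightarrow> cm_along k S V (f i)) \<Longrightarrow> cm_along k S V (\<lambda>x. \<Sum>i\<in>I. f i x)"
  by (induction I rule: infinite_finite_induct) (auto intro: cm_along_const cm_along_add)

lemma cm_along_power: "cm_along k S V f \<Longrightarrow> cm_along k S V (\<lambda>x. f x ^ m)"
  by (induction m) (auto intro: cm_along_const cm_along_mult)

lemma cm_along_cong:
  assumes "open S" "\<And>x. x \<in> S \<Longrightarrow> f x = g x" "cm_along k S V f"
  shows "cm_along k S V g"
proof (cases k)
  case 0
  then show ?thesis using assms by auto
next
  case (Suc j)
  then obtain f' where f': "\<And>x. x \<in> S \<Longrightarrow> has_vf_derivative V f x (- f' x)" "cm_along j S V f'"
    using assms(3) by (auto elim: cm_along_SucE)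
  show ?thesis unfolding Suc
    by (rule cm_along_SucI[OF _ _ f'(2)])
      (use assms(2) cm_along_nonneg[OF assms(3)] has_vf_derivative_cong[OF assms(1) _ assms(2) f'(1)] in auto)
qed

text \<open>Along a rotation a linear function is \<open>A * sin \<theta>\<close>, and cosecant and cotangent are completely
  monotone on the first quadrant.\<close>

lemma cm_along_csc_cot:
  assumes "\<And>x. x \<in> S \<Longrightarrow> w x > 0" "\<And>x. x \<in> S \<Longrightarrow> w' x \<ge> 0"
    "\<And>x. x \<in> S \<Longrightarrow> has_vf_derivative V w x (w' x)" "\<And>x. x \<in> S \<Longrightarrow> has_vf_derivative V w' x (- w x)"
  shows "cm_along k S V (\<lambda>x. 1 / w x) \<and> cm_along k S V (\<lambda>x. w' x / w x)"
proof (induction k)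
  case 0
  then show ?case using assms by (auto intro!: divide_nonneg_nonneg intro: less_imp_le)
next
  case (Suc k)
  have "cm_along (Suc k) S V (\<lambda>x. 1 / w x)"
  \<comment> \<open>The derivatives csc' = -csc cot and cot' = -(1 + cot^2) are polynomials in csc
    and cot, which is why both functions go through one induction.\<close>
  proof (rule cm_along_SucI[where g' = "\<lambda>x. (1 / w x) * (w' x / w x)"])
    show "has_vf_derivative V (\<lambda>x. 1 / w x) x (- (1 / w x * (w' x / w x)))" if "x \<in> S" for x
      using has_vf_derivative_divide[OF has_vf_derivative_const[of V 1] assms(3)[OF that]] assms(1)[OF that]
      by (simp add: power2_eq_square)
    show "cm_along k S V (\<lambda>x. 1 / w x * (w' x / w x))" using Suc by (intro cm_along_mult) auto
  qed (use assms in \<open>auto intro: less_imp_le\<close>)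
  moreover have "cm_along (Suc k) S V (\<lambda>x. w' x / w x)"
  proof (rule cm_along_SucI[where g' = "\<lambda>x. 1 + (w' x / w x)\<^sup>2"])
    show "has_vf_derivative V (\<lambda>x. w' x / w x) x (- (1 + (w' x / w x)\<^sup>2))" if "x \<in> S" for x
    proof -
      have "(- w x * w x - w' x * w' x) / (w x)\<^sup>2 = - (1 + (w' x / w x)\<^sup>2)"
        using assms(1)[OF that] by (simp add: field_simps power2_eq_square)
      then show ?thesis
        using has_vf_derivative_divide[OF assms(4)[OF that] assms(3)[OF that]] assms(1)[OF that] by simp
    qed
    show "cm_along k S V (\<lambda>x. 1 + (w' x / w x)\<^sup>2)"
      using Suc by (intro cm_along_add cm_along_const cm_along_power) auto
  qed (use assms in \<open>auto intro!: divide_nonneg_nonneg intro: less_imp_le\<close>)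
  ultimately show ?case by blast
qed

text \<open>A trace-free linear field has zero divergence, so -div (h b V) reduces to minus the
  derivative of h b along V.\<close>

lemma vf_adjoint_divergence_free:
  assumes V: "bounded_linear V" "(\<Sum>e\<in>Basis. V e \<bullet> e) = 0"
    and d: "has_vf_derivative V (\<lambda>x. h x * b x) x d"
  shows "vf_adjoint (\<lambda>x. b x *\<^sub>R V x) h x = - d"
proof -
  obtain D where D: "((\<lambda>x. h x * b x) has_derivative D) (at x)" "D (V x) = d"
    using d unfolding has_vf_derivative_def by blast
  have "frechet_derivative (\<lambda>x. h x * ((b x *\<^sub>R V x) \<bullet> e)) (at x) e = (h x * b x) * (V e \<bullet> e) + D e * (V x \<bullet> e)" for e
  proof -
    have Ve: "((\<lambda>x. V x \<bullet> e) has_derivative (\<lambda>v. V v \<bullet> e)) (at x)"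
      by (intro has_derivative_inner_left bounded_linear_imp_has_derivative V)
    have hb: "((\<lambda>x. h x * ((b x *\<^sub>R V x) \<bullet> e)) has_derivative (\<lambda>v. (h x * b x) * (V v \<bullet> e) + D v * (V x \<bullet> e))) (at x)"
      using has_derivative_mult[OF D(1) Ve] by (simp add: mult.assoc)
    show ?thesis unfolding frechet_derivative_at[OF hb, symmetric] by (rule refl)
  qed
  then have "vf_adjoint (\<lambda>x. b x *\<^sub>R V x) h x = - ((h x * b x) * (\<Sum>e\<in>Basis. V e \<bullet> e) + (\<Sum>e\<in>Basis. D e * (V x \<bullet> e)))"
    by (simp add: vf_adjoint_def sum.distrib sum_distrib_left)
  also have "(\<Sum>e\<in>Basis. D e * (V x \<bullet> e)) = D (\<Sum>e\<in>Basis. (V x \<bullet> e) *\<^sub>R e)"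
    using has_derivative_linear[OF D(1)] by (simp add: linear_sum linear_cmul mult.commute)
  also have "\<dots> = d" using D(2) by (simp add: euclidean_representation)
  finally show ?thesis using V(2) by simp
qed

text \<open>When all the factors are completely monotone, every term of the Leibniz expansion of the iterated
  adjoint is nonnegative, so the term in which only \<open>\<Psi>\<close> is differentiated is a lower bound.\<close>

lemma cm_along_iterated_adjoint:
  fixes V :: "'a::euclidean_space \<Rightarrow> 'a" and \<Psi> :: "nat \<Rightarrow> 'i \<Rightarrow> 'a \<Rightarrow> real"
  assumes S: "open S" and V: "bounded_linear V" "(\<Sum>e\<in>Basis. V e \<bullet> e) = 0"
    and b: "\<And>k. cm_along k S V b" and \<rho>: "\<And>k. cm_along k S V \<rho>"
    and \<tau>: "\<And>k i. i \<in> I \<Longrightarrow> cm_along k S V (\<tau> i)"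
    and \<Psi>_nonneg: "\<And>j i x. j \<le> M \<Longrightarrow> i \<in> I \<Longrightarrow> x \<in> S \<Longrightarrow> \<Psi> j i x \<ge> 0"
    and \<Psi>_deriv: "\<And>j i x. i \<in> I \<Longrightarrow> x \<in> S \<Longrightarrow> has_vf_derivative V (\<Psi> j i) x (- (\<Psi> (Suc j) i x * \<tau> i x))"
    and h: "\<And>x. x \<in> S \<Longrightarrow> h x = (\<Sum>i\<in>I. \<Psi> 0 i x * \<rho> x)"
    and m: "m \<le> M"
  shows "cm_along (M - m) S V (\<lambda>x. (vf_adjoint (\<lambda>x. b x *\<^sub>R V x) ^^ m) h x - (\<Sum>i\<in>I. \<Psi> m i x * ((\<tau> i x * b x) ^ m * \<rho> x)))"
  using m
proof (induction m)
  case 0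
  show ?case by (rule cm_along_cong[OF S _ cm_along_const[of 0]]) (use h in auto)
next
  case (Suc m)
  \<comment> \<open>\<open>\<Psi> j i\<close> is completely monotone only up to order M - j, because
    the sign of the profile is known only through M derivatives.\<close>
  have \<Psi>: "cm_along r S V (\<Psi> j i)" if "i \<in> I" "j + r \<le> M" for r j i
    using that
  proof (induction r arbitrary: j)
    case 0
    then show ?case using \<Psi>_nonneg by simp
  next
    case (Suc r)
    show ?case
    proof (rule cm_along_SucI)
      show "has_vf_derivative V (\<Psi> j i) x (- (\<Psi> (Suc j) i x * \<tau> i x))" if "x \<in> S" for x
        by (rule \<Psi>_deriv[OF Suc.prems(1) that])
      show "cm_along r S V (\<lambda>x. \<Psi> (Suc j) i x * \<tau> i x)"
        by (rule cm_along_mult[OF Suc.IH \<tau>]) (use Suc.prems in auto)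
    qed (use \<Psi>_nonneg Suc.prems in auto)
  qed
  define h_m where "h_m = (vf_adjoint (\<lambda>x. b x *\<^sub>R V x) ^^ m) h"
  define E where "E i x = (\<tau> i x * b x) ^ m * \<rho> x" for i x
  define d where "d x = h_m x - (\<Sum>i\<in>I. \<Psi> m i x * E i x)" for x
  obtain q where q: "M - m = Suc q" "q = M - Suc m" using Suc.prems by (cases "M - m") auto
  have "cm_along (Suc q) S V d"
    using Suc.IH Suc.prems unfolding q(1)[symmetric] d_def h_m_def E_def by simp
  then obtain d' where d': "\<And>x. x \<in> S \<Longrightarrow> has_vf_derivative V d x (- d' x)" "cm_along q S V d'"
    by (rule cm_along_SucE) blast
  obtain b' where b': "\<And>x. x \<in> S \<Longrightarrow> has_vf_derivative V b x (- b' x)" "cm_along q S V b'"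
    using b[of "Suc q"] by (rule cm_along_SucE) blast
  have "cm_along (Suc q) S V (\<lambda>x. E i x * b x)" if "i \<in> I" for i
    unfolding E_def by (intro cm_along_mult cm_along_power b \<rho> \<tau> that)
  then have "\<forall>i\<in>I. \<exists>e'. (\<forall>x\<in>S. has_vf_derivative V (\<lambda>x. E i x * b x) x (- e' x)) \<and> cm_along q S V e'"
    unfolding cm_along.simps by blast
  then obtain E' where E': "\<And>i x. i \<in> I \<Longrightarrow> x \<in> S \<Longrightarrow> has_vf_derivative V (\<lambda>x. E i x * b x) x (- E' i x)"
    "\<And>i. i \<in> I \<Longrightarrow> cm_along q S V (E' i)" unfolding bchoice_iff by blast
  \<comment> \<open>What is left of the next adjoint once the terms differentiating
    \<open>\<Psi> m\<close> are split off: contributions from the old remainder, from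
    \<open>b\<close> and from the weights \<open>E\<close>.\<close>
  define R where "R x = (d' x * b x + d x * b' x) + (\<Sum>i\<in>I. \<Psi> m i x * E' i x)" for x
  have cm_R: "cm_along q S V R"
    unfolding R_def
  proof (intro cm_along_add cm_along_mult cm_along_sum d'(2) b'(2) b E'(2))
    show "cm_along q S V d" by (rule cm_along_SucD) fact
    show "cm_along q S V (\<Psi> m i)" if "i \<in> I" for i by (rule \<Psi>[OF that]) (use q in auto)
  qed
  have R_eq: "R x = (vf_adjoint (\<lambda>x. b x *\<^sub>R V x) ^^ Suc m) h x - (\<Sum>i\<in>I. \<Psi> (Suc m) i x * ((\<tau> i x * b x) ^ Suc m * \<rho> x))"
    if x: "x \<in> S" for x
  proof -
    have "has_vf_derivative V (\<lambda>x. d x * b x + (\<Sum>i\<in>I. \<Psi> m i x * (E i x * b x))) x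
       ((- d' x * b x + d x * (- b' x)) + (\<Sum>i\<in>I. - (\<Psi> (Suc m) i x * \<tau> i x) * (E i x * b x) + \<Psi> m i x * (- E' i x)))"
      by (intro has_vf_derivative_add has_vf_derivative_sum has_vf_derivative_mult[OF d'(1)[OF x] b'(1)[OF x]]
          has_vf_derivative_mult[OF \<Psi>_deriv[OF _ x] E'(1)[OF _ x]])
    moreover have "(\<lambda>x. d x * b x + (\<Sum>i\<in>I. \<Psi> m i x * (E i x * b x))) = (\<lambda>x. h_m x * b x)"
      by (simp add: d_def algebra_simps sum_distrib_right sum_distrib_left)
    ultimately have "vf_adjoint (\<lambda>x. b x *\<^sub>R V x) h_m x
      = - ((- d' x * b x + d x * (- b' x)) + (\<Sum>i\<in>I. - (\<Psi> (Suc m) i x * \<tau> i x) * (E i x * b x) + \<Psi> m i x * (- E' i x)))"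
      by (intro vf_adjoint_divergence_free[OF V]) simp
    also have "\<dots> = R x + (\<Sum>i\<in>I. \<Psi> (Suc m) i x * ((\<tau> i x * b x) ^ Suc m * \<rho> x))"
      unfolding R_def E_def by (simp add: sum.distrib sum_negf sum_subtractf algebra_simps)
    finally show ?thesis by (simp add: h_m_def)
  qed
  show ?case unfolding q(2)[symmetric] by (rule cm_along_cong[OF S R_eq cm_R])
qed

subsection \<open>The range \<open>p \<le> 2\<close>\<close>

text \<open>A smooth cutoff, equal to 0 for s \<le> -1 and to 1 for s \<ge> -1/2; at every s at
  least one of the two bumps in the denominator is positive.\<close>

definition bump_step :: "real \<Rightarrow> real" where
  "bump_step s = bump (s + 1) / (bump (s + 1) + bump (- 1 / 2 - s))"

lemma bump_step_denom_pos: "bump (s + 1) + bump (- 1 / 2 - s) > 0"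
proof (cases "s > -1")
  case True
  then show ?thesis using bump_pos[of "s + 1"] bump_nonneg[of "- 1 / 2 - s"] by simp
next
  case False
  then show ?thesis using bump_nonneg[of "s + 1"] bump_pos[of "- 1 / 2 - s"] by simp
qed

lemma bump_step_bounds: "0 \<le> bump_step s" "bump_step s \<le> 1"
  using bump_step_denom_pos[of s] bump_nonneg[of "s + 1"] bump_nonneg[of "- 1 / 2 - s"]
  by (auto simp: bump_step_def)

lemma bump_step_eq_0: "s \<le> -1 \<Longrightarrow> bump_step s = 0"
  by (simp add: bump_step_def bumpd_eq_0)

lemma bump_step_eq_1: "s \<ge> - 1 / 2 \<Longrightarrow> bump_step s = 1"
  using bump_pos[of "s + 1"] by (simp add: bump_step_def bumpd_eq_0)

lemma smooth_on_bump_step: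
  fixes g :: "'a::euclidean_space \<Rightarrow> real"
  assumes "open S" "smooth_on S g"
  shows "smooth_on S (\<lambda>x. bump_step (g x))"
  unfolding bump_step_def
  by (intro smooth_on_divide smooth_on_add smooth_on_bump smooth_on_diff smooth_on_const assms)
    (use bump_step_denom_pos in auto)

lemma abs_add3_le: "\<bar>u\<bar> \<le> A \<Longrightarrow> \<bar>v\<bar> \<le> B \<Longrightarrow> \<bar>w\<bar> \<le> C \<Longrightarrow> \<bar>u + v + w\<bar> \<le> A + B + C"
  for u v w A B C :: real
  by linarith

section \<open>Geometry of the rotation field in a coordinate plane\<close>

locale plane =
  fixes k1 k2 :: "'n::finite"
  assumes k12: "k1 \<noteq> k2"
begin

text \<open>Near the point \<open>pole\<close>, \<open>ang\<close> replaces the polar angle in the plane of \<open>k1\<close> and \<open>k2\<close>: it is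
  rational, and its derivative \<open>ang'\<close> along the rotation field is completely monotone. The function
  \<open>trv\<close> is the squared distance transversal to the orbits, on which it is constant, and \<open>wgt a\<close> is minus
  the derivative of \<open>hy a\<close> along \<open>rot\<close>. The signs in \<open>centres\<close> make \<open>hy a\<close> decrease convexly along
  the orbits.\<close>

definition rot :: "real ^ 'n \<Rightarrow> real ^ 'n" where
  "rot x = (\<chi> l. if l = k1 then - x $ k2 else if l = k2 then x $ k1 else 0)"

definition ang :: "real ^ 'n \<Rightarrow> real" where "ang x = x $ k2 / (x $ k1 + x $ k2)"

definition ang' :: "real ^ 'n \<Rightarrow> real" where
  "ang' x = (1 + ((x $ k1 - x $ k2) / (x $ k1 + x $ k2))\<^sup>2) / 2"

definition rest :: "real ^ 'n \<Rightarrow> real" where "rest x = (\<Sum>l\<in>UNIV - {k1, k2}. (x $ l)\<^sup>2)"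

definition trv :: "real ^ 'n \<Rightarrow> real" where "trv x = ((x $ k1)\<^sup>2 + (x $ k2)\<^sup>2 - 1)\<^sup>2 + rest x"

definition reg :: "(real ^ 'n) set" where
  "reg = {x. 1 / 2 < x $ k1 \<and> \<bar>x $ k2\<bar> < 1 / 8 \<and> norm x < 3}"

definition wgt :: "real ^ 'n \<Rightarrow> real ^ 'n \<Rightarrow> real" where "wgt a x = a $ k2 * x $ k1 - a $ k1 * x $ k2"

definition centres :: "(real ^ 'n) set" where
  "centres = cbox (\<chi> l. if l = k1 then -2 else if l = k2 then 1 else -1) (\<chi> l. if l = k1 then -1 else if l = k2 then 2 else 1)"

definition pole :: "real ^ 'n" where "pole = axis k1 1"

lemma sum_split_plane: "(\<Sum>l\<in>UNIV. f l) = f k1 + f k2 + (\<Sum>l\<in>UNIV - {k1, k2}. f l)" for f :: "'n \<Rightarrow> real"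
proof -
  have "(\<Sum>l\<in>UNIV. f l) = (\<Sum>l\<in>{k1, k2}. f l) + (\<Sum>l\<in>UNIV - {k1, k2}. f l)"
    by (subst sum.union_disjoint[symmetric]) (auto intro: sum.cong)
  then show ?thesis using k12 by simp
qed

lemma norm2_split: "(norm x)\<^sup>2 = (x $ k1)\<^sup>2 + (x $ k2)\<^sup>2 + rest x"
  unfolding norm2_eq_sum rest_def by (rule sum_split_plane)

lemma rest_nonneg: "rest x \<ge> 0" by (simp add: rest_def sum_nonneg)

lemma trv_bounds: "0 \<le> trv x" "\<bar>(x $ k1)\<^sup>2 + (x $ k2)\<^sup>2 - 1\<bar> \<le> sqrt (trv x)" "rest x \<le> (sqrt (trv x))\<^sup>2"
  "\<And>l. l \<noteq> k1 \<Longrightarrow> l \<noteq> k2 \<Longrightarrow> \<bar>x $ l\<bar> \<le> sqrt (trv x)"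
proof -
  show 1: "0 \<le> trv x" using rest_nonneg by (simp add: trv_def)
  show "\<bar>(x $ k1)\<^sup>2 + (x $ k2)\<^sup>2 - 1\<bar> \<le> sqrt (trv x)"
    by (rule real_le_rsqrt) (use rest_nonneg in \<open>simp add: trv_def\<close>)
  show "rest x \<le> (sqrt (trv x))\<^sup>2" using 1 by (simp add: trv_def)
  fix l assume "l \<noteq> k1" "l \<noteq> k2"
  then have "(x $ l)\<^sup>2 \<le> rest x" unfolding rest_def by (intro member_le_sum) auto
  then have "(x $ l)\<^sup>2 \<le> trv x" by (simp add: trv_def add_increasing)
  then show "\<bar>x $ l\<bar> \<le> sqrt (trv x)" by (intro real_le_rsqrt) simp
qed

lemma rot_nth: "rot x $ k1 = - x $ k2" "rot x $ k2 = x $ k1" "l \<noteq> k1 \<Longrightarrow> l \<noteq> k2 \<Longrightarrow> rot x $ l = 0"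
  using k12 by (auto simp: rot_def)

lemma inner_rot: "v \<bullet> rot x = v $ k2 * x $ k1 - v $ k1 * x $ k2"
  unfolding inner_vec_def inner_real_def by (subst sum_split_plane) (simp add: rot_nth)

lemma bounded_linear_rot: "bounded_linear rot"
  by (intro linear_conv_bounded_linear[THEN iffD1] linearI) (auto simp: rot_def vec_eq_iff algebra_simps)

lemma rot_divergence: "(\<Sum>e\<in>Basis. rot e \<bullet> e) = 0"
  unfolding inner_commute[of "rot _"] inner_rot by simp

lemma vfd_nth: "has_vf_derivative rot (\<lambda>x. x $ l) x (rot x $ l)"
  by (rule has_vf_derivative_linear[OF bounded_linear_vec_nth])

lemma vfd_12: "has_vf_derivative rot (\<lambda>x. x $ k1) x (- x $ k2)" "has_vf_derivative rot (\<lambda>x. x $ k2) x (x $ k1)"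
  using vfd_nth[of k1 x] vfd_nth[of k2 x] by (simp_all add: rot_nth)

lemma vfd_sum_12:
  "has_vf_derivative rot (\<lambda>x. x $ k1 + x $ k2) x (x $ k1 - x $ k2)"
  "has_vf_derivative rot (\<lambda>x. x $ k1 - x $ k2) x (- (x $ k1 + x $ k2))"
proof -
  show "has_vf_derivative rot (\<lambda>x. x $ k1 + x $ k2) x (x $ k1 - x $ k2)"
    using has_vf_derivative_add[OF vfd_12, of x] by simp
  have e: "- x $ k2 - x $ k1 = - (x $ k1 + x $ k2)" by simp
  show "has_vf_derivative rot (\<lambda>x. x $ k1 - x $ k2) x (- (x $ k1 + x $ k2))"
    using has_vf_derivative_diff[OF vfd_12, of x] unfolding e .
qed

lemma vfd_square: "has_vf_derivative rot f x d \<Longrightarrow> has_vf_derivative rot (\<lambda>x. (f x)\<^sup>2) x (2 * f x * d)"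
  using has_vf_derivative_mult[of rot f x d f d] by (simp add: power2_eq_square algebra_simps)

lemma vfd_trv: "has_vf_derivative rot trv x 0"
proof -
  have "has_vf_derivative rot (\<lambda>x. (x $ k1)\<^sup>2 + (x $ k2)\<^sup>2) x 0"
    using has_vf_derivative_add[OF vfd_square[OF vfd_12(1)[of x]] vfd_square[OF vfd_12(2)[of x]]] by simp
  from vfd_square[OF has_vf_derivative_diff[OF this has_vf_derivative_const[of _ 1]]]
  have 1: "has_vf_derivative rot (\<lambda>x. ((x $ k1)\<^sup>2 + (x $ k2)\<^sup>2 - 1)\<^sup>2) x 0" by simp
  have "has_vf_derivative rot (\<lambda>x. (x $ l)\<^sup>2) x 0" if "l \<in> UNIV - {k1, k2}" for l
    using vfd_square[OF vfd_nth[of l x]] rot_nth(3)[of l x] that by simp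
  then have "has_vf_derivative rot rest x (\<Sum>l\<in>UNIV - {k1, k2}. 0)"
    unfolding rest_def[abs_def] by (rule has_vf_derivative_sum)
  from has_vf_derivative_add[OF 1 this] show ?thesis by (simp add: trv_def[abs_def])
qed

text \<open>In the polar angle \<theta> of the plane, \<open>ang\<close> is (1 - cot(\<theta> +
  pi/4))/2, so its derivative is (1 + cot^2(\<theta> + pi/4))/2.\<close>

lemma vfd_ang:
  assumes "x $ k1 + x $ k2 \<noteq> 0" shows "has_vf_derivative rot ang x (ang' x)"
proof -
  have "has_vf_derivative rot ang x
      ((x $ k1 * (x $ k1 + x $ k2) - x $ k2 * (x $ k1 - x $ k2)) / (x $ k1 + x $ k2)\<^sup>2)"
    unfolding ang_def[abs_def] by (rule has_vf_derivative_divide[OF vfd_12(2) vfd_sum_12(1) assms])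
  also have "(x $ k1 * (x $ k1 + x $ k2) - x $ k2 * (x $ k1 - x $ k2)) / (x $ k1 + x $ k2)\<^sup>2 = ang' x"
  proof -
    define D where "D = x $ k1 * (x $ k1 + x $ k2) - x $ k2 * (x $ k1 - x $ k2)"
    have "(x $ k1 + x $ k2)\<^sup>2 \<noteq> 0" using assms by simp
    then have "1 + ((x $ k1 - x $ k2) / (x $ k1 + x $ k2))\<^sup>2
        = ((x $ k1 + x $ k2)\<^sup>2 + (x $ k1 - x $ k2)\<^sup>2) / (x $ k1 + x $ k2)\<^sup>2"
      by (simp add: power_divide add_divide_distrib)
    also have "(x $ k1 + x $ k2)\<^sup>2 + (x $ k1 - x $ k2)\<^sup>2 = 2 * D"
      by (simp add: D_def power2_eq_square algebra_simps)
    finally show ?thesis unfolding ang'_def D_def[symmetric] by simp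
  qed
  finally show ?thesis .
qed

text \<open>Differentiating twice along the flow gives back minus the function: on each orbit
  \<open>wgt a\<close> is a multiple of the sine of a shifted angle, as
  \<open>cm_along_csc_cot\<close> requires.\<close>

lemma vfd_wgt:
  "has_vf_derivative rot (wgt a) x (- (a $ k2 * x $ k2) - a $ k1 * x $ k1)"
  "has_vf_derivative rot (\<lambda>x. - (a $ k2 * x $ k2) - a $ k1 * x $ k1) x (- wgt a x)"
  using has_vf_derivative_diff[OF has_vf_derivative_cmult[OF vfd_12(1)[of x], of "a $ k2"] has_vf_derivative_cmult[OF vfd_12(2)[of x], of "a $ k1"]]
   has_vf_derivative_diff[OF has_vf_derivative_minus[OF has_vf_derivative_cmult[OF vfd_12(2)[of x], of "a $ k2"]] has_vf_derivative_cmult[OF vfd_12(1)[of x], of "a $ k1"]]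
  by (simp_all add: wgt_def[abs_def])

lemma vfd_dens: "has_vf_derivative rot dens x 0"
proof -
  have "has_vf_derivative rot (\<lambda>x. x \<bullet> x) x 0"
    unfolding has_vf_derivative_def
  proof (intro exI conjI)
    show "((\<lambda>x. x \<bullet> x) has_derivative (\<lambda>v. x \<bullet> v + v \<bullet> x)) (at x)"
      by (rule has_derivative_inner[OF has_derivative_ident has_derivative_ident])
    show "x \<bullet> rot x + rot x \<bullet> x = 0"
      unfolding inner_commute[of "rot x" x] by (simp add: inner_rot)
  qed
  moreover have "((\<lambda>r. 1 / sqrt (1 + r)) has_real_derivative (- (1 / (2 * (1 + x \<bullet> x) * sqrt (1 + x \<bullet> x))))) (at (x \<bullet> x))"
  proof -
    have "1 + x \<bullet> x > 0" by (simp add: add_pos_nonneg)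
    then show ?thesis by (auto intro!: derivative_eq_intros simp: field_simps)
  qed
  ultimately have "has_vf_derivative rot (\<lambda>x. 1 / sqrt (1 + x \<bullet> x)) x (- (1 / (2 * (1 + x \<bullet> x) * sqrt (1 + x \<bullet> x))) * 0)"
    by (intro has_vf_derivative_compose)
  then show ?thesis by (simp add: dens_def[abs_def] power2_norm_eq_inner)
qed

lemma open_reg: "open reg"
  unfolding reg_def
  by (intro open_Collect_conj open_Collect_less continuous_intros)

lemma mem_centres: "a \<in> centres \<longleftrightarrow> -2 \<le> a $ k1 \<and> a $ k1 \<le> -1 \<and> 1 \<le> a $ k2 \<and> a $ k2 \<le> 2 \<and>
    (\<forall>l. l \<noteq> k1 \<longrightarrow> l \<noteq> k2 \<longrightarrow> \<bar>a $ l\<bar> \<le> 1)"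
proof -
  have "a \<in> centres \<longleftrightarrow> (\<forall>l. (if l = k1 then -2 else if l = k2 then 1 else -1) \<le> a $ l
      \<and> a $ l \<le> (if l = k1 then -1 else if l = k2 then 2 else 1))"
    by (simp add: centres_def mem_box_cart)
  also have "\<dots> \<longleftrightarrow> (\<forall>l. if l = k1 then -2 \<le> a $ k1 \<and> a $ k1 \<le> -1 else if l = k2 then 1 \<le> a $ k2 \<and> a $ k2 \<le> 2 else \<bar>a $ l\<bar> \<le> 1)"
    by (intro iff_allI) (auto simp: abs_le_iff)
  finally have eq: "a \<in> centres \<longleftrightarrow> \<dots>" .
  show ?thesis
  proof
    assume "a \<in> centres"
    then have P: "if l = k1 then -2 \<le> a $ k1 \<and> a $ k1 \<le> -1 else if l = k2 then 1 \<le> a $ k2 \<and> a $ k2 \<le> 2 else \<bar>a $ l\<bar> \<le> 1" for l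
      unfolding eq by (rule spec)
    show "-2 \<le> a $ k1 \<and> a $ k1 \<le> -1 \<and> 1 \<le> a $ k2 \<and> a $ k2 \<le> 2 \<and> (\<forall>l. l \<noteq> k1 \<longrightarrow> l \<noteq> k2 \<longrightarrow> \<bar>a $ l\<bar> \<le> 1)"
    proof (intro conjI allI impI)
      show "\<bar>a $ l\<bar> \<le> 1" if "l \<noteq> k1" "l \<noteq> k2" for l using P[of l] that by simp
    qed (use P[of k1] P[of k2] k12 in simp_all)
  next
    assume "-2 \<le> a $ k1 \<and> a $ k1 \<le> -1 \<and> 1 \<le> a $ k2 \<and> a $ k2 \<le> 2 \<and> (\<forall>l. l \<noteq> k1 \<longrightarrow> l \<noteq> k2 \<longrightarrow> \<bar>a $ l\<bar> \<le> 1)"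
    then show "a \<in> centres" unfolding eq by simp
  qed
qed

lemma norm_centres: "a \<in> centres \<Longrightarrow> (norm a)\<^sup>2 \<le> 8 + real CARD('n)"
proof -
  assume a: "a \<in> centres"
  have "\<bar>a $ k1\<bar> \<le> 2" "\<bar>a $ k2\<bar> \<le> 2" using a by (auto simp: mem_centres)
  then have "(a $ k1)\<^sup>2 \<le> 2\<^sup>2" "(a $ k2)\<^sup>2 \<le> 2\<^sup>2"
    using power_mono[of "\<bar>a $ k1\<bar>" 2 2] power_mono[of "\<bar>a $ k2\<bar>" 2 2] by simp_all
  moreover have "rest a \<le> (\<Sum>l\<in>UNIV - {k1, k2}. 1)"
    unfolding rest_def using a unfolding mem_centres by (intro sum_mono) (auto simp: abs_square_le_1)
  moreover have "(\<Sum>l\<in>UNIV - {k1, k2}. 1 :: real) \<le> real CARD('n)" by (simp add: card_mono)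
  ultimately show ?thesis unfolding norm2_split by simp
qed

lemma measure_centres_pos: "measure lborel centres > 0"
  unfolding centres_def by (subst content_cbox_cart) (auto simp: interval_ne_empty_cart intro!: prod_pos)

text \<open>The signs say that the shifted angles attached to \<open>wgt a\<close> and to
  \<open>x $ k1 + x $ k2\<close> lie in the first quadrant, where cosecant and cotangent are
  completely monotone. The bound 8 limits the loss from dividing by \<open>wgt a\<close>, and 3/8
  bounds the denominator of \<open>ang\<close>.\<close>

lemma wgt_bounds:
  assumes "a \<in> centres" "x \<in> reg"
  shows "wgt a x > 0" "wgt a x \<le> 8" "- (a $ k2 * x $ k2) - a $ k1 * x $ k1 \<ge> 0"
    "x $ k1 + x $ k2 > 3 / 8" "x $ k1 - x $ k2 \<ge> 0"
proof -
  have a: "-2 \<le> a $ k1" "a $ k1 \<le> -1" "1 \<le> a $ k2" "a $ k2 \<le> 2" using assms(1) by (auto simp: mem_centres)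
  have x: "1 / 2 < x $ k1" "\<bar>x $ k2\<bar> < 1 / 8" "norm x < 3" using assms(2) by (auto simp: reg_def)
  have x1: "x $ k1 < 3" using component_le_norm_cart[of x k1] x by linarith
  have p: "\<bar>a $ k1 * x $ k2\<bar> \<le> 2 * (1 / 8)" "\<bar>a $ k2 * x $ k2\<bar> \<le> 2 * (1 / 8)"
    unfolding abs_mult using a x by (intro mult_mono; simp)+
  have q: "1 * x $ k1 \<le> a $ k2 * x $ k1" "a $ k2 * x $ k1 \<le> 2 * 3" "1 * x $ k1 \<le> - a $ k1 * x $ k1"
    using a x x1 by (intro mult_right_mono mult_mono; simp)+
  show "wgt a x > 0" "wgt a x \<le> 8" using p q x unfolding wgt_def by linarith+
  show "- (a $ k2 * x $ k2) - a $ k1 * x $ k1 \<ge> 0" using p q x by simp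
  show "x $ k1 + x $ k2 > 3 / 8" "x $ k1 - x $ k2 \<ge> 0" using x by linarith+
qed

text \<open>Equal to (9 + N) * 4 + 2 + N, the total of the three error terms in
  \<open>hy_estimate\<close>, with N the dimension.\<close>

definition Cc :: real where "Cc = 38 + 5 * real CARD('n)"

text \<open>First-order expansion at \<open>pole\<close>: up to an error of the order of the
  transversal distance, the depth of x below the sphere through \<open>pole\<close> is
  \<open>x $ k2\<close> times a factor bounded below.\<close>

lemma hy_estimate:
  assumes a: "a \<in> centres" and x: "x \<in> reg"
  obtains F where "3 / 4 \<le> F" "\<bar>(hy a pole - hy a x) - x $ k2 * F\<bar> \<le> Cc * sqrt (trv x)"
proof -
  define N where "N = real CARD('n)"
  have N: "N \<ge> 0" by (simp add: N_def)
  have a': "-2 \<le> a $ k1" "a $ k1 \<le> -1" "1 \<le> a $ k2" "a $ k2 \<le> 2" "\<And>l. l \<noteq> k1 \<Longrightarrow> l \<noteq> k2 \<Longrightarrow> \<bar>a $ l\<bar> \<le> 1"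
    using a by (auto simp: mem_centres)
  have x': "1 / 2 < x $ k1" "\<bar>x $ k2\<bar> < 1 / 8" "norm x < 3" using x by (auto simp: reg_def)
  define z where "z = sqrt (trv x)"
  have z: "z \<ge> 0" using trv_bounds(1) by (simp add: z_def)
  note tb = trv_bounds(2,3)[of x, folded z_def] trv_bounds(4)[where x = x, folded z_def]
  let ?A = "sqrt (1 + (norm a)\<^sup>2)" and ?X = "sqrt (1 + (norm x)\<^sup>2)"
  define F where "F = a $ k2 - a $ k1 * (x $ k2 / (x $ k1 + 1))"
  have "\<bar>x $ k2 / (x $ k1 + 1)\<bar> \<le> (1 / 8) / 1"
    unfolding abs_divide using x' by (intro frac_le) auto
  then have "\<bar>a $ k1 * (x $ k2 / (x $ k1 + 1))\<bar> \<le> 2 * (1 / 8)"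
    unfolding abs_mult using a' by (intro mult_mono) auto
  then have F: "3 / 4 \<le> F" using a'(3) unfolding F_def by linarith
  have A: "0 \<le> ?A" "?A \<le> 9 + N"
  proof -
    show "?A \<le> 9 + N"
      using norm_centres[OF a] N by (intro sqrt_le_bound) (auto simp: N_def)
  qed simp
  have "rest x \<le> 3 * z"
  proof -
    have "sqrt (rest x) \<le> z" using tb(2) z by (intro real_le_lsqrt) auto
    moreover have "sqrt (rest x) \<le> 3"
    proof (rule real_le_lsqrt)
      have "rest x \<le> (norm x)\<^sup>2" unfolding norm2_split by simp
      also have "\<dots> \<le> 3\<^sup>2" using x' by (intro power_mono) auto
      finally show "rest x \<le> 3\<^sup>2" .
    qed simp
    ultimately have "sqrt (rest x) * sqrt (rest x) \<le> 3 * z" using rest_nonneg[of x] by (intro mult_mono) auto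
    then show ?thesis using rest_nonneg[of x] by simp
  qed
  then have "\<bar>(norm x)\<^sup>2 - 1\<bar> \<le> 4 * z" unfolding norm2_split using tb(1) rest_nonneg[of x] by linarith
  then have X: "\<bar>sqrt 2 - ?X\<bar> \<le> 4 * z"
    using abs_sqrt_diff_le[of 2 "1 + (norm x)\<^sup>2"] by simp
  have t1: "\<bar>?A * (sqrt 2 - ?X)\<bar> \<le> (9 + N) * (4 * z)"
    unfolding abs_mult using A X z N by (intro mult_mono) auto
  define R where "R = (x $ k1)\<^sup>2 + (x $ k2)\<^sup>2 - 1"
  have "\<bar>R / (x $ k1 + 1)\<bar> \<le> z / 1"
    unfolding abs_divide using x' tb(1) z by (intro frac_le) (auto simp: R_def)
  then have t2: "\<bar>a $ k1 * (R / (x $ k1 + 1))\<bar> \<le> 2 * z"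
    unfolding abs_mult using a' z by (intro mult_mono) auto
  have "\<bar>\<Sum>l\<in>UNIV - {k1, k2}. a $ l * x $ l\<bar> \<le> (\<Sum>l\<in>UNIV - {k1, k2}. \<bar>a $ l * x $ l\<bar>)" by (rule sum_abs)
  also have "\<dots> \<le> (\<Sum>l\<in>UNIV - {k1, k2}. 1 * z)"
    unfolding abs_mult using a'(5) tb(3) z by (intro sum_mono mult_mono) auto
  also have "\<dots> \<le> N * z"
    using z by (auto simp: N_def card_mono intro!: mult_right_mono)
  finally have t3: "\<bar>\<Sum>l\<in>UNIV - {k1, k2}. a $ l * x $ l\<bar> \<le> N * z" .
  have ip: "a \<bullet> x = a $ k1 * x $ k1 + a $ k2 * x $ k2 + (\<Sum>l\<in>UNIV - {k1, k2}. a $ l * x $ l)"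
    unfolding inner_vec_def inner_real_def by (rule sum_split_plane)
  \<comment> \<open>\<open>x $ k1\<close> is eliminated through R, which \<open>trv\<close>
    controls; the quadratic rest in \<open>x $ k2\<close> goes into F.\<close>
  have "x $ k1 - 1 = (R - x $ k2 * x $ k2) / (x $ k1 + 1)"
    using x' by (simp add: R_def field_simps power2_eq_square)
  then have "a $ k1 * (x $ k1 - 1) = a $ k1 * (R / (x $ k1 + 1)) - a $ k1 * (x $ k2 / (x $ k1 + 1)) * x $ k2"
    by (simp add: diff_divide_distrib right_diff_distrib)
  moreover have "hy a pole = ?A * sqrt 2 - a $ k1"
    by (simp add: hy_def pole_def norm_axis_1 inner_axis)
  ultimately have "(hy a pole - hy a x) - x $ k2 * F = ?A * (sqrt 2 - ?X) + a $ k1 * (R / (x $ k1 + 1)) + (\<Sum>l\<in>UNIV - {k1, k2}. a $ l * x $ l)"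
    unfolding hy_def[of a x] ip F_def by (simp add: algebra_simps)
  then have "\<bar>(hy a pole - hy a x) - x $ k2 * F\<bar> \<le> (9 + N) * (4 * z) + 2 * z + N * z"
    by (simp only: abs_add3_le[OF t1 t2 t3])
  also have "\<dots> = Cc * z" by (simp add: Cc_def N_def algebra_simps)
  finally show ?thesis using that[OF F] by (simp add: z_def)
qed

lemma Cc_ge: "Cc \<ge> 38" by (simp add: Cc_def)

text \<open>Inside the ball the expansion forces \<open>x $ k2 * F\<close> above
  \<open>- Cc * sqrt (trv x)\<close>, and (3/8) (3/4) \<ge> 1/4 turns this into a bound for
  \<open>ang\<close> with the factor 4.\<close>

lemma ang_lower_bound:
  assumes a: "a \<in> centres" and x: "x \<in> reg" and u: "hy a x < hy a pole"
  shows "ang x \<ge> - 4 * Cc * sqrt (trv x)"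
proof (rule ccontr)
  assume *: "\<not> ang x \<ge> - 4 * Cc * sqrt (trv x)"
  obtain F where F: "3 / 4 \<le> F" "\<bar>(hy a pole - hy a x) - x $ k2 * F\<bar> \<le> Cc * sqrt (trv x)"
    by (rule hy_estimate[OF a x])
  have s: "x $ k1 + x $ k2 > 3 / 8" by (rule wgt_bounds[OF a x])
  have z: "sqrt (trv x) \<ge> 0" using trv_bounds(1) by simp
  have "0 \<le> 4 * Cc * sqrt (trv x)" using Cc_ge z by simp
  then have "ang x < 0" using * by simp
  have sF: "1 / 4 \<le> (x $ k1 + x $ k2) * F"
  proof -
    have "(3 / 8) * (3 / 4) \<le> (x $ k1 + x $ k2) * F" using s F by (intro mult_mono) auto
    then show ?thesis by simp
  qed
  have "x $ k2 * F = ang x * ((x $ k1 + x $ k2) * F)" using s by (simp add: ang_def)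
  also have "\<dots> \<le> ang x * (1 / 4)" using sF \<open>ang x < 0\<close> by (intro mult_left_mono_neg) auto
  also have "\<dots> < - Cc * sqrt (trv x)" using * by simp
  finally show False using F(2) u by linarith
qed

text \<open>Chosen so that \<open>Lam * l\<^sup>2 * trv x\<close> is 8 t^2 for t =
  \<open>4 * Cc * (l * sqrt (trv x))\<close>, where -t bounds \<open>l * ang x\<close> from below
  inside the ball.\<close>

definition Lam :: real where "Lam = 128 * Cc\<^sup>2"

text \<open>The argument of the profile at scale 1/l. Along the flow it varies through
  \<open>ang\<close> alone, since \<open>trv\<close> is constant on orbits; the penalty on
  \<open>trv\<close> confines the support transversally.\<close>

definition arg :: "real \<Rightarrow> real ^ 'n \<Rightarrow> real" where
  "arg l x = 1 - l * ang x - Lam * l\<^sup>2 * trv x"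

text \<open>The ball only meets the part of the support where the cutoff is inactive.\<close>

lemma arg_bounds:
  assumes a: "a \<in> centres" and x: "x \<in> reg" and u: "hy a x < hy a pole" and l: "l > 0"
  shows "arg l x \<le> 2" "arg l x > 0 \<Longrightarrow> l * ang x \<ge> - 1 / 2"
proof -
  define t where "t = 4 * Cc * (l * sqrt (trv x))"
  have "l * ang x \<ge> l * (- 4 * Cc * sqrt (trv x))"
    using ang_lower_bound[OF a x u] l by (intro mult_left_mono) auto
  then have 1: "l * ang x \<ge> - t" by (simp add: t_def algebra_simps)
  have "Lam * l\<^sup>2 * trv x = 8 * t\<^sup>2"
    using trv_bounds(1)[of x] by (simp add: Lam_def t_def power_mult_distrib)
  then have r: "arg l x = 1 - l * ang x - 8 * t\<^sup>2" by (simp add: arg_def)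
  \<comment> \<open>The argument is at most 1 + t - 8 t^2, which never exceeds 2 and is negative for
    t > 1/2.\<close>
  have "0 \<le> 8 * (t - 1/16)\<^sup>2" by simp
  then have "8 * t\<^sup>2 - t + 1 \<ge> 0" by (simp add: power2_eq_square algebra_simps)
  then show "arg l x \<le> 2" using r 1 by linarith
  assume p: "arg l x > 0"
  show "l * ang x \<ge> - 1 / 2"
  proof (rule ccontr)
    assume "\<not> l * ang x \<ge> - 1 / 2"
    then have t: "t > 1 / 2" using 1 by linarith
    have "(1 / 2) * t \<le> t * t" using t by (intro mult_right_mono) auto
    then show False using p 1 t unfolding r power2_eq_square by linarith
  qed
qed

text \<open>For fixed \<open>trv\<close> the argument grows as \<open>ang\<close> becomes negative,
  so the step factor is what bounds the support on that side. The sign test keeps the denominator of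
  \<open>ang\<close> positive.\<close>

definition blob :: "real \<Rightarrow> real \<Rightarrow> real ^ 'n \<Rightarrow> real" where
  "blob \<kappa> l x = (if x $ k1 + x $ k2 > 0 then bump (\<kappa> * arg l x) * bump_step (l * ang x) else 0)"

lemma blob_bounds: "0 \<le> blob \<kappa> l x" "blob \<kappa> l x \<le> 1"
  using bump_nonneg[of "\<kappa> * arg l x"] bump_le_1[of "\<kappa> * arg l x"] bump_step_bounds[of "l * ang x"]
  by (auto simp: blob_def intro!: mult_le_one)

definition nbh :: "real \<Rightarrow> (real ^ 'n) set" where
  "nbh l = cbox (\<chi> j. pole $ j - 2 / l) (\<chi> j. pole $ j + 2 / l)"

lemma mem_nbh: "x \<in> nbh l \<longleftrightarrow> (\<forall>j. \<bar>x $ j - pole $ j\<bar> \<le> 2 / l)"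
proof -
  have "x \<in> nbh l \<longleftrightarrow> (\<forall>j. pole $ j - 2 / l \<le> x $ j \<and> x $ j \<le> pole $ j + 2 / l)"
    by (simp add: nbh_def mem_box_cart)
  also have "\<dots> \<longleftrightarrow> (\<forall>j. \<bar>x $ j - pole $ j\<bar> \<le> 2 / l)"
    by (intro iff_allI) linarith
  finally show ?thesis .
qed

lemma measure_nbh: "l > 0 \<Longrightarrow> measure lborel (nbh l) = (4 / l) ^ CARD('n)"
proof -
  assume l: "l > 0"
  have "pole \<in> nbh l" using l by (simp add: mem_nbh)
  then show ?thesis unfolding nbh_def by (subst content_cbox_cart) auto
qed

lemma pole_nth: "pole $ k1 = 1" "pole $ k2 = 0" "l \<noteq> k1 \<Longrightarrow> pole $ l = 0"
  using k12 by (auto simp: pole_def axis_def)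

text \<open>Where both factors are nonzero, \<open>l * ang x\<close> lies between -1 and 1, and then
  \<open>Lam \<ge> 2\<close> gives trv x \<le> 1/l^2. The angle controls \<open>x $ k2\<close>, and
  with it \<open>trv\<close> controls the remaining coordinates.\<close>

lemma blob_support:
  assumes l: "l \<ge> 64" and \<kappa>: "\<kappa> > 0" and nz: "blob \<kappa> l x \<noteq> 0"
  shows "x \<in> nbh l"
proof -
  have s: "x $ k1 + x $ k2 > 0" using nz by (auto simp: blob_def split: if_splits)
  have b: "bump (\<kappa> * arg l x) \<noteq> 0" "bump_step (l * ang x) \<noteq> 0" using nz s by (auto simp: blob_def)
  have "\<kappa> * arg l x > 0" using b(1) by (rule contrapos_np) (simp add: bumpd_eq_0)
  then have r: "arg l x > 0" using \<kappa> by (simp add: zero_less_mult_iff)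
  have t: "l * ang x > -1" using b(2) by (rule contrapos_np) (simp add: bump_step_eq_0)
  have L: "Lam \<ge> 2"
  proof -
    have "38 * 38 \<le> Cc * Cc" using Cc_ge by (intro mult_mono) auto
    then show ?thesis by (simp add: Lam_def power2_eq_square)
  qed
  have l0: "l > 0" "1 / l \<le> 1 / 64" using l by (auto simp: field_simps)
  have q0: "Lam * l\<^sup>2 * trv x \<ge> 0" using L trv_bounds(1)[of x] by simp
  then have t2: "l * ang x < 1" using r by (simp add: arg_def)
  have "2 * (l\<^sup>2 * trv x) \<le> Lam * (l\<^sup>2 * trv x)" using L trv_bounds(1)[of x] by (intro mult_right_mono) auto
  then have "l\<^sup>2 * trv x < 1" using r t by (simp add: arg_def mult.assoc)
  then have "trv x \<le> (1 / l)\<^sup>2" using l0 by (simp add: power_divide field_simps)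
  then have z: "sqrt (trv x) \<le> 1 / l" using l0 by (intro real_le_lsqrt) auto
  have rho: "\<bar>(x $ k1)\<^sup>2 + (x $ k2)\<^sup>2 - 1\<bar> \<le> 1 / l" using trv_bounds(2)[of x] z by linarith
  have sq: "(x $ k1 + x $ k2)\<^sup>2 \<le> 2\<^sup>2"
  proof -
    have "(x $ k1 + x $ k2)\<^sup>2 \<le> 2 * ((x $ k1)\<^sup>2 + (x $ k2)\<^sup>2)"
      using zero_le_power2[of "x $ k1 - x $ k2"] by (simp add: power2_eq_square algebra_simps)
    also have "\<dots> \<le> 2 * (1 + 1 / 64)"
    proof (rule mult_left_mono)
      show "(x $ k1)\<^sup>2 + (x $ k2)\<^sup>2 \<le> 1 + 1 / 64" using rho l0(2) by linarith
    qed simp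
    finally show ?thesis by simp
  qed
  then have s2: "x $ k1 + x $ k2 \<le> 2" by (rule power2_le_imp_le) simp
  have "\<bar>l * ang x\<bar> \<le> 1" using t t2 by linarith
  then have "\<bar>ang x\<bar> \<le> 1 / l" using l0 by (simp add: abs_mult field_simps)
  then have "\<bar>ang x\<bar> * (x $ k1 + x $ k2) \<le> 1 / l * (x $ k1 + x $ k2)"
    by (rule mult_right_mono) (use s in simp)
  moreover have "\<bar>x $ k2\<bar> = \<bar>ang x\<bar> * (x $ k1 + x $ k2)" using s by (simp add: ang_def)
  ultimately have "\<bar>x $ k2\<bar> \<le> 1 / l * (x $ k1 + x $ k2)" by (simp only:)
  moreover have "1 / l * (x $ k1 + x $ k2) \<le> 1 / l * 2" using s2 l0 by (intro mult_left_mono) auto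
  moreover have "1 / l * (x $ k1 + x $ k2) \<le> 1 / 64 * (x $ k1 + x $ k2)" using s l0 by (intro mult_right_mono) auto
  ultimately have x2: "\<bar>x $ k2\<bar> \<le> 2 / l" "\<bar>x $ k2\<bar> \<le> 1 / 64 * (x $ k1 + x $ k2)" by linarith+
  have x1: "x $ k1 > 0" using abs_ge_self[of "x $ k2"] x2(2) s by (simp add: field_simps)
  have "(x $ k2)\<^sup>2 \<le> (2 / l)\<^sup>2" using x2(1) by (metis abs_ge_zero power2_abs power_mono)
  also have "(2 / l)\<^sup>2 = 4 * (1 / l * (1 / l))" by (simp add: power2_eq_square)
  also have "\<dots> \<le> 4 * (1 / 64 * (1 / l))" using l0 by (intro mult_left_mono mult_right_mono) auto
  also have "\<dots> \<le> 1 / l" using l0(1) by (simp add: field_simps)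
  finally have "(x $ k2)\<^sup>2 \<le> 1 / l" .
  then have "\<bar>(x $ k1)\<^sup>2 - 1\<bar> \<le> 2 * (1 / l)" using rho zero_le_power2[of "x $ k2"] by linarith
  moreover have "(x $ k1)\<^sup>2 - 1 = (x $ k1 - 1) * (x $ k1 + 1)" by (simp add: power2_eq_square algebra_simps)
  moreover have "\<bar>x $ k1 - 1\<bar> * 1 \<le> \<bar>x $ k1 - 1\<bar> * \<bar>x $ k1 + 1\<bar>" using x1 by (intro mult_left_mono) auto
  ultimately have "\<bar>x $ k1 - 1\<bar> \<le> 2 / l" by (simp add: abs_mult)
  moreover have "\<bar>x $ j\<bar> \<le> 2 / l" if "j \<noteq> k1" "j \<noteq> k2" for j
    using trv_bounds(4)[OF that, of x] z l0 by simp
  ultimately have "\<bar>x $ j - pole $ j\<bar> \<le> 2 / l" for j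
    using x2(1) by (cases "j = k1"; cases "j = k2") (auto simp: pole_nth)
  then show ?thesis by (simp add: mem_nbh)
qed

lemma nbh_subset_reg:
  assumes l: "l \<ge> 64" "l \<ge> 2 * real CARD('n)" and x: "x \<in> nbh l"
  shows "x \<in> reg"
proof -
  have l0: "l > 0" "2 / l \<le> 1 / 32" using l by (auto simp: field_simps)
  have "\<bar>x $ k1 - 1\<bar> \<le> 2 / l" "\<bar>x $ k2\<bar> \<le> 2 / l" using x by (auto simp: mem_nbh pole_nth dest: spec[of _ k1] spec[of _ k2])
  then have 1: "1 / 2 < x $ k1" "\<bar>x $ k2\<bar> < 1 / 8" using l0 by linarith+
  have "(norm (x - pole))\<^sup>2 \<le> real CARD('n) * (2 / l)\<^sup>2"
    by (rule norm2_le_card) (use x in \<open>simp add: mem_nbh\<close>)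
  also have "\<dots> = (2 * real CARD('n)) * (1 / l) * (2 / l)" by (simp add: power2_eq_square)
  also have "\<dots> \<le> l * (1 / l) * (1 / 32)" using l l0 by (intro mult_mono) auto
  also have "\<dots> \<le> 1\<^sup>2" using l0 by simp
  finally have "norm (x - pole) \<le> 1" by (rule power2_le_imp_le) simp
  moreover have "norm x \<le> norm (x - pole) + norm pole" using norm_triangle_ineq[of "x - pole" pole] by simp
  moreover have "norm pole = 1" by (simp add: pole_def norm_axis_1)
  ultimately have "norm x < 3" by linarith
  then show ?thesis using 1 by (simp add: reg_def)
qed

lemma trv_smooth: "open S \<Longrightarrow> smooth_on S trv"
  unfolding trv_def[abs_def] rest_def
  by (intro smooth_on_add smooth_on_power smooth_on_diff smooth_on_nth smooth_on_const smooth_on_sum)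

lemma blob_smooth:
  assumes l: "l \<ge> 64" "l \<ge> 2 * real CARD('n)" and \<kappa>: "\<kappa> > 0"
  shows "smooth_on UNIV (blob \<kappa> l)"
proof (rule smooth_on_UNIV_extend)
  let ?S = "{x :: real^'n. 0 < x $ k1 + x $ k2}"
  show op: "open ?S" by (intro open_Collect_less continuous_intros)
  show "closed (nbh l)" unfolding nbh_def by (rule closed_cbox)
  show "nbh l \<subseteq> ?S"
  proof
    fix x assume "x \<in> nbh l"
    then have "x \<in> reg" by (rule nbh_subset_reg[OF l])
    then have "1 / 2 < x $ k1" "\<bar>x $ k2\<bar> < 1 / 8" by (auto simp: reg_def)
    then show "x \<in> ?S" unfolding mem_Collect_eq by linarith
  qed
  have ang: "smooth_on ?S ang"
    unfolding ang_def[abs_def] by (intro smooth_on_divide smooth_on_add smooth_on_nth op) auto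
  have "smooth_on ?S (\<lambda>x. bump (\<kappa> * arg l x) * bump_step (l * ang x))"
    unfolding arg_def[abs_def]
    by (intro smooth_on_mult smooth_on_bump smooth_on_bump_step smooth_on_diff smooth_on_const ang trv_smooth op)
  then show "smooth_on ?S (blob \<kappa> l)"
    by (subst smooth_on_cong[OF op, of _ "\<lambda>x. bump (\<kappa> * arg l x) * bump_step (l * ang x)"]) (auto simp: blob_def)
  show "blob \<kappa> l x = 0" if "x \<notin> nbh l" for x using blob_support[OF l(1) \<kappa>] that by blast
qed

end

text \<open>A partial geometric sum is at most A times its largest term, so its p-th power is at
  most A^p times the largest p-th power, with A independent of the index set.\<close>

lemma geometric_sum_powr_le:
  fixes l0 s p :: real
  assumes l0: "l0 > 0" and s: "s > 0" and p: "p > 0" and I: "finite I"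
  defines "A \<equiv> 2 powr (s / p) / (2 powr (s / p) - 1)"
  shows "(\<Sum>i\<in>I. (l0 * 2 ^ i) powr (s / p)) powr p \<le> A powr p * (\<Sum>i\<in>I. (l0 * 2 ^ i) powr s)"
proof (cases "I = {}")
  case False
  define r where "r = (2::real) powr (s / p)"
  have r: "r > 1" unfolding r_def using s p by (intro gr_one_powr) auto
  have A: "A = r / (r - 1)" by (simp add: A_def r_def)
  have w: "(l0 * 2 ^ i) powr (s / p) = l0 powr (s / p) * r ^ i" for i
    using l0 by (simp add: powr_mult r_def powr_powr mult.commute flip: powr_realpow)
  define m where "m = Max I"
  have m: "m \<in> I" "I \<subseteq> {..<Suc m}" using I False by (auto simp: m_def less_Suc_eq_le)
  have "(\<Sum>i\<in>I. r ^ i) \<le> (\<Sum>i<Suc m. r ^ i)" using m(2) r by (intro sum_mono2) auto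
  also have "\<dots> = (r ^ Suc m - 1) / (r - 1)" using r by (subst geometric_sum) auto
  also have "\<dots> \<le> A * r ^ m" using r by (simp add: A divide_right_mono)
  finally have "l0 powr (s / p) * (\<Sum>i\<in>I. r ^ i) \<le> l0 powr (s / p) * (A * r ^ m)" by (intro mult_left_mono) auto
  then have "(\<Sum>i\<in>I. (l0 * 2 ^ i) powr (s / p)) \<le> A * (l0 * 2 ^ m) powr (s / p)"
    unfolding w sum_distrib_left[symmetric] by (simp add: mult.left_commute)
  then have "(\<Sum>i\<in>I. (l0 * 2 ^ i) powr (s / p)) powr p \<le> (A * (l0 * 2 ^ m) powr (s / p)) powr p"
    using p by (intro powr_mono2 sum_nonneg) auto
  also have "\<dots> = A powr p * (l0 * 2 ^ m) powr s"
  proof -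
    define y where "y = (l0 * 2 ^ m) powr (s / p)"
    have "(A * y) powr p = A powr p * y powr p" by (rule powr_mult)
    moreover have "y powr p = (l0 * 2 ^ m) powr s" using p by (simp add: y_def powr_powr)
    ultimately show ?thesis by (simp only: y_def)
  qed
  also have "\<dots> \<le> A powr p * (\<Sum>i\<in>I. (l0 * 2 ^ i) powr s)"
    using m(1) I by (intro mult_left_mono member_le_sum) auto
  finally show ?thesis .
qed simp

section \<open>Cores of the pieces and superposition of dyadic scales\<close>

context plane
begin

text \<open>Makes \<open>Cc * (16 + N) * eps\<close> equal to 1/40. On \<open>core l\<close> the
  function \<open>trv\<close> is at most (16 + N) (eps/l)^2, with 16 from the planar term and N from
  the other coordinates.\<close>

definition eps :: real where "eps = 1 / (40 * Cc * (16 + real CARD('n)))"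

text \<open>The part of the support at scale 1/l that carries the lower bound: it lies at depth at
  least 1/(5l), measured by [z, w], inside the balls through \<open>pole\<close>, and
  \<open>arg\<close> stays in [1/4, 3/4] on it.\<close>

definition core :: "real \<Rightarrow> (real ^ 'n) set" where
  "core l = cbox (\<chi> j. if j = k2 then 2 / (5 * l) else pole $ j - eps / l)
     (\<chi> j. if j = k2 then 1 / (2 * l) else pole $ j + eps / l)"

lemma mem_core: "x \<in> core l \<longleftrightarrow> 2 / (5 * l) \<le> x $ k2 \<and> x $ k2 \<le> 1 / (2 * l) \<and> (\<forall>j. j \<noteq> k2 \<longrightarrow> \<bar>x $ j - pole $ j\<bar> \<le> eps / l)"
proof -
  have "x \<in> core l \<longleftrightarrow> (\<forall>j. (if j = k2 then 2 / (5 * l) else pole $ j - eps / l) \<le> x $ j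
      \<and> x $ j \<le> (if j = k2 then 1 / (2 * l) else pole $ j + eps / l))"
    by (simp add: core_def mem_box_cart)
  also have "\<dots> \<longleftrightarrow> (\<forall>j. if j = k2 then 2 / (5 * l) \<le> x $ k2 \<and> x $ k2 \<le> 1 / (2 * l) else \<bar>x $ j - pole $ j\<bar> \<le> eps / l)"
    by (intro iff_allI) (auto simp: abs_le_iff)
  also have "\<dots> \<longleftrightarrow> 2 / (5 * l) \<le> x $ k2 \<and> x $ k2 \<le> 1 / (2 * l) \<and> (\<forall>j. j \<noteq> k2 \<longrightarrow> \<bar>x $ j - pole $ j\<bar> \<le> eps / l)"
    by (rule iffI) (auto split: if_split_asm)
  finally show ?thesis .
qed

lemma eps_pos: "0 < eps" "eps \<le> 1 / 16"
proof -
  show "0 < eps" using Cc_ge by (simp add: eps_def)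
  have "40 * Cc * (16 + real CARD('n)) \<ge> 40 * 38 * 16" using Cc_ge by (intro mult_mono) auto
  then show "eps \<le> 1 / 16" unfolding eps_def by (intro divide_left_mono) auto
qed

lemma measure_core:
  assumes "l > 0"
  shows "measure lborel (core l) = (1 / 10 * (2 * eps) ^ (CARD('n) - 1)) * (1 / l) ^ CARD('n)"
proof -
  have "(\<chi> j. if j = k2 then 2 / (5 * l) else pole $ j) \<in> core l"
    using assms eps_pos by (simp add: mem_core field_simps)
  then have "measure lborel (core l) = (\<Prod>j\<in>UNIV. if j = k2 then 1 / 10 * (1 / l) else 2 * eps * (1 / l))"
    unfolding core_def by (subst content_cbox_cart) (use assms in \<open>auto intro!: prod.cong simp: field_simps\<close>)
  also have "\<dots> = (1 / 10 * (1 / l)) * (\<Prod>j\<in>UNIV - {k2}. 2 * eps * (1 / l))"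
    by (subst prod.remove[of _ k2]) auto
  also have "\<dots> = (1 / 10 * (1 / l)) * ((2 * eps) ^ (CARD('n) - 1) * (1 / l) ^ (CARD('n) - 1))"
  proof -
    have "card (UNIV - {k2}) = CARD('n) - 1" by simp
    then show ?thesis by (simp only: prod_constant power_mult_distrib[of "2 * eps" "1 / l"])
  qed
  also have "\<dots> = (1 / 10 * (2 * eps) ^ (CARD('n) - 1)) * (1 / l) ^ Suc (CARD('n) - 1)"
    by (simp only: power_Suc mult_ac)
  finally show ?thesis by simp
qed

text \<open>The first two terms put the cubes \<open>nbh l\<close> inside \<open>reg\<close>; 1/eps
  makes \<open>(x $ k2)\<^sup>2\<close>, which is of order 1/l^2, at most eps/l on the core.\<close>

definition base :: real where "base = 64 + 2 * real CARD('n) + 1 / eps"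

lemma base_ge: "base \<ge> 64" "base \<ge> 2 * real CARD('n)" "base > 0" "base \<ge> 1"
  using eps_pos by (auto simp: base_def add_nonneg_pos)

lemma core_props:
  assumes l: "l \<ge> base" and x: "x \<in> core l"
  shows "x \<in> reg" "1 / 4 \<le> arg l x" "arg l x \<le> 3 / 4"
    "\<And>a. a \<in> centres \<Longrightarrow> 1 / (5 * l) \<le> hy a pole - hy a x"
proof -
  define N where "N = real CARD('n)"
  have N: "N \<ge> 0" by (simp add: N_def)
  have l64: "l \<ge> 64" "l \<ge> 2 * real CARD('n)" using base_ge l by linarith+
  then have l0: "l > 0" by simp
  define t where "t = 1 / l"
  have t: "0 < t" "t \<le> 1 / 64" "l * t = 1" using l64 by (auto simp: t_def field_simps)
  have c: "2 / 5 * t \<le> x $ k2" "x $ k2 \<le> 1 / 2 * t" "\<And>j. j \<noteq> k2 \<Longrightarrow> \<bar>x $ j - pole $ j\<bar> \<le> eps * t"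
    using x by (auto simp: mem_core t_def)
  have et: "0 \<le> eps * t" "eps * t \<le> 1 / 16 * t" using eps_pos t by (auto intro: mult_right_mono)
  have "\<bar>x $ j - pole $ j\<bar> \<le> 2 / l" for j
  proof (cases "j = k2")
    case True
    then show ?thesis using c(1,2) t by (simp add: pole_nth t_def)
  next
    case False
    have "eps * t \<le> 2 * t" using et t by linarith
    then show ?thesis using c(3)[OF False] by (simp add: t_def)
  qed
  then have "x \<in> nbh l" by (simp add: mem_nbh)
  then show reg: "x \<in> reg" by (rule nbh_subset_reg[OF l64])
  have x1: "\<bar>x $ k1 - 1\<bar> \<le> eps * t" using c(3)[of k1] k12 by (simp add: pole_nth)
  have et1: "t * (1 / 4) \<le> eps"
  proof -
    have "1 / eps \<le> l" using l base_ge unfolding base_def by linarith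
    then have "t \<le> eps" using eps_pos l0 by (simp add: t_def field_simps)
    then show ?thesis using t by simp
  qed
  have "(x $ k2)\<^sup>2 \<le> (1 / 2 * t)\<^sup>2" using c t by (intro power_mono) auto
  also have "\<dots> = (t * (1 / 4)) * t" by (simp add: power2_eq_square)
  also have "\<dots> \<le> eps * t" using et1 t by (intro mult_right_mono) auto
  finally have x2: "(x $ k2)\<^sup>2 \<le> eps * t" .
  have "\<bar>(x $ k1)\<^sup>2 - 1\<bar> = \<bar>x $ k1 - 1\<bar> * \<bar>x $ k1 + 1\<bar>"
    unfolding abs_mult[symmetric] by (simp add: power2_eq_square algebra_simps)
  also have "\<dots> \<le> (eps * t) * 3"
  proof (rule mult_mono)
    show "\<bar>x $ k1 + 1\<bar> \<le> 3" using x1 et t(2) unfolding abs_le_iff by linarith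
  qed (use x1 et in auto)
  finally have "\<bar>(x $ k1)\<^sup>2 - 1\<bar> \<le> 3 * (eps * t)" by simp
  then have R: "\<bar>(x $ k1)\<^sup>2 + (x $ k2)\<^sup>2 - 1\<bar> \<le> 4 * (eps * t)"
    using x2 zero_le_power2[of "x $ k2"] by linarith
  have R2: "((x $ k1)\<^sup>2 + (x $ k2)\<^sup>2 - 1)\<^sup>2 \<le> (4 * (eps * t))\<^sup>2"
    using R by (metis abs_ge_zero power2_abs power_mono)
  have "rest x \<le> (\<Sum>j\<in>UNIV - {k1, k2}. (eps * t)\<^sup>2)"
    unfolding rest_def
  proof (rule sum_mono)
    fix j assume "j \<in> UNIV - {k1, k2}"
    then have "\<bar>x $ j\<bar> \<le> eps * t" using c(3)[of j] by (auto simp: pole_nth)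
    then show "(x $ j)\<^sup>2 \<le> (eps * t)\<^sup>2" by (metis abs_ge_zero power2_abs power_mono)
  qed
  also have "\<dots> \<le> N * (eps * t)\<^sup>2"
    by (auto simp: N_def card_mono intro!: mult_right_mono)
  finally have q: "trv x \<le> (16 + N) * (eps * t)\<^sup>2" using R2 by (simp add: trv_def power_mult_distrib algebra_simps)
  have ce: "Cc * ((16 + N) * eps) = 1 / 40" using Cc_ge N by (simp add: eps_def N_def)
  have "Lam * l\<^sup>2 * trv x \<le> Lam * l\<^sup>2 * ((16 + N) * (eps * t)\<^sup>2)"
    using q by (intro mult_left_mono) (auto simp: Lam_def)
  also have "\<dots> = 128 * (Cc\<^sup>2 * (16 + N) * eps\<^sup>2) * (l * t)\<^sup>2"
    by (simp add: Lam_def power_mult_distrib)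
  also have "\<dots> = 128 * (Cc\<^sup>2 * (16 + N) * eps\<^sup>2)" by (simp add: t(3))
  also have "\<dots> \<le> 128 * (Cc\<^sup>2 * (16 + N) * eps\<^sup>2 * (16 + N))"
    using N mult_left_mono[of 1 "16 + N" "Cc\<^sup>2 * (16 + N) * eps\<^sup>2"] by simp
  also have "\<dots> = 128 * (Cc * ((16 + N) * eps))\<^sup>2" by (simp add: power2_eq_square)
  also have "\<dots> = 128 * (1 / 40)\<^sup>2" by (simp only: ce)
  finally have Lq: "Lam * l\<^sup>2 * trv x \<le> 1 / 10" by (simp add: power2_eq_square)
  have Lq0: "Lam * l\<^sup>2 * trv x \<ge> 0" using trv_bounds(1)[of x] by (simp add: Lam_def)
  have "trv x \<le> ((16 + N) * (eps * t))\<^sup>2"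
  proof -
    have "(16 + N) * (eps * t)\<^sup>2 \<le> (16 + N) * ((16 + N) * (eps * t)\<^sup>2)"
      using N mult_right_mono[of 1 "16 + N" "(eps * t)\<^sup>2"] by (intro mult_left_mono) auto
    moreover have "((16 + N) * (eps * t))\<^sup>2 = (16 + N) * ((16 + N) * (eps * t)\<^sup>2)"
      by (simp add: power_mult_distrib power2_eq_square)
    ultimately show ?thesis using q by linarith
  qed
  then have "sqrt (trv x) \<le> (16 + N) * (eps * t)" using N et by (intro real_le_lsqrt) auto
  then have "Cc * sqrt (trv x) \<le> Cc * ((16 + N) * (eps * t))" using Cc_ge by (intro mult_left_mono) auto
  also have "\<dots> = Cc * ((16 + N) * eps) * t" by simp
  also have "\<dots> = 1 / 40 * t" by (simp only: ce)
  finally have Cz: "Cc * sqrt (trv x) \<le> 1 / 40 * t" .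
  define s where "s = x $ k1 + x $ k2"
  have s: "9 / 10 \<le> s" "s \<le> 11 / 10" using x1 et t c(1,2) unfolding s_def abs_le_iff by linarith+
  have la: "l * ang x = (l * x $ k2) / s" by (simp add: ang_def s_def)
  have "l * (2 / 5 * t) \<le> l * x $ k2" "l * x $ k2 \<le> l * (1 / 2 * t)" using c(1,2) l0 by (auto intro: mult_left_mono)
  then have lx: "2 / 5 \<le> l * x $ k2" "l * x $ k2 \<le> 1 / 2" using t(3) by auto
  define Q where "Q = (l * x $ k2) / s"
  have "Q \<le> (1 / 2) / (9 / 10)" unfolding Q_def using lx s by (intro frac_le) auto
  then have Q1: "Q \<le> 5 / 9" by simp
  have "(2 / 5) / (11 / 10) \<le> Q" unfolding Q_def using lx s by (intro frac_le) auto
  then have Q2: "4 / 11 \<le> Q" by simp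
  define D where "D = Lam * l\<^sup>2 * trv x"
  have D: "0 \<le> D" "D \<le> 1 / 10" using Lq Lq0 by (simp_all add: D_def)
  have arg: "arg l x = 1 - Q - D" by (simp only: arg_def la Q_def D_def)
  show "1 / 4 \<le> arg l x" using Q1 D unfolding arg by linarith
  show "arg l x \<le> 3 / 4" using Q2 D unfolding arg by linarith
  fix a assume a: "a \<in> centres"
  obtain F where F: "3 / 4 \<le> F" "\<bar>(hy a pole - hy a x) - x $ k2 * F\<bar> \<le> Cc * sqrt (trv x)"
    by (rule hy_estimate[OF a reg])
  \<comment> \<open>The main term is at least (3/10) t and the error at most (1/40) t, which leaves
    more than t/5.\<close>
  have "(2 / 5 * t) * (3 / 4) \<le> x $ k2 * F" using c(1) F(1) t by (intro mult_mono) auto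
  then have "1 / 5 * t \<le> hy a pole - hy a x" using F(2) Cz t unfolding abs_le_iff by linarith
  then show "1 / (5 * l) \<le> hy a pole - hy a x" by (simp add: t_def)
qed

definition lev :: "nat \<Rightarrow> real" where "lev i = base * 2 ^ i"

lemma lev_ge: "lev i \<ge> base" "lev i \<ge> 64" "lev i \<ge> 2 * real CARD('n)" "lev i > 0" "lev i \<ge> 1"
proof -
  have "base * 1 \<le> base * 2 ^ i" using base_ge by (intro mult_left_mono) auto
  then show 1: "lev i \<ge> base" by (simp add: lev_def)
  then show "lev i \<ge> 64" "lev i \<ge> 2 * real CARD('n)" "lev i > 0" "lev i \<ge> 1" using base_ge by linarith+
qed

lemma nbh_mono: "0 < l \<Longrightarrow> l \<le> l' \<Longrightarrow> nbh l' \<subseteq> nbh l"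
proof
  fix x assume l: "0 < l" "l \<le> l'" and x: "x \<in> nbh l'"
  have "2 / l' \<le> 2 / l" using l by (intro divide_left_mono) auto
  then show "x \<in> nbh l" using x unfolding mem_nbh by (meson order_trans)
qed

text \<open>With r = n/p the pieces have comparable norms. They are all centred at
  \<open>pole\<close>, so their supports overlap.\<close>

definition tst :: "real \<Rightarrow> real \<Rightarrow> nat \<Rightarrow> real ^ 'n \<Rightarrow> real" where
  "tst \<kappa> r K x = (\<Sum>i<K. lev i powr r * blob \<kappa> (lev i) x)"

lemma tst_props:
  assumes \<kappa>: "\<kappa> > 0"
  shows "smooth_on UNIV (tst \<kappa> r K)" "tst \<kappa> r K x \<ge> 0" "x \<notin> nbh base \<Longrightarrow> tst \<kappa> r K x = 0"
proof -
  show "smooth_on UNIV (tst \<kappa> r K)"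
    unfolding tst_def[abs_def]
    by (intro smooth_on_sum smooth_on_mult smooth_on_const blob_smooth lev_ge \<kappa> open_UNIV)
  show "tst \<kappa> r K x \<ge> 0" unfolding tst_def by (intro sum_nonneg mult_nonneg_nonneg blob_bounds) auto
  assume x: "x \<notin> nbh base"
  have "blob \<kappa> (lev i) x = 0" for i
    using blob_support[OF lev_ge(2) \<kappa>, of i x] nbh_mono[OF base_ge(3) lev_ge(1)[of i]] x by blast
  then show "tst \<kappa> r K x = 0" by (simp add: tst_def)
qed

text \<open>At each point the heights of the active levels form part of a geometric sum, so the p-th
  power of the sum is controlled by the sum of the p-th powers. One level contributes lev^n
  (4/lev)^n = 4^n, whence growth linear in K.\<close>

lemma tst_norm:
  assumes \<kappa>: "\<kappa> > 0" and p: "p > 0"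
  defines "s \<equiv> real CARD('n)"
  defines "A \<equiv> 2 powr (s / p) / (2 powr (s / p) - 1)"
  shows "(\<integral>\<^sup>+x. ennreal (dens x * \<bar>tst \<kappa> (s / p) K x\<bar> powr p) \<partial>lborel) \<le> ennreal (A powr p * 4 ^ CARD('n) * real K)"
proof -
  have s: "s > 0" by (simp add: s_def)
  have int: "integrable lborel (\<lambda>x. indicator (nbh l) x :: real)" for l
    unfolding nbh_def by (intro integrable_real_indicator emeasure_lborel_cbox_finite) auto
  have "dens x * \<bar>tst \<kappa> (s / p) K x\<bar> powr p \<le> A powr p * (\<Sum>i<K. lev i powr s * indicator (nbh (lev i)) x)" for x
  proof -
    define I where "I = {i. i < K \<and> x \<in> nbh (lev i)}"
    have I: "finite I" by (simp add: I_def)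
    have "tst \<kappa> (s / p) K x = (\<Sum>i\<in>I. lev i powr (s / p) * blob \<kappa> (lev i) x)"
      unfolding tst_def I_def
      by (rule sum.mono_neutral_right) (use blob_support[OF lev_ge(2) \<kappa>] in auto)
    also have "\<dots> \<le> (\<Sum>i\<in>I. lev i powr (s / p) * 1)"
      by (intro sum_mono mult_left_mono blob_bounds) auto
    finally have "\<bar>tst \<kappa> (s / p) K x\<bar> \<le> (\<Sum>i\<in>I. (base * 2 ^ i) powr (s / p))"
      using tst_props(2)[OF \<kappa>, of "s / p" K x] by (simp add: lev_def)
    then have "\<bar>tst \<kappa> (s / p) K x\<bar> powr p \<le> (\<Sum>i\<in>I. (base * 2 ^ i) powr (s / p)) powr p"
      using p by (intro powr_mono2) auto
    also have "\<dots> \<le> A powr p * (\<Sum>i\<in>I. (base * 2 ^ i) powr s)"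
      unfolding A_def by (rule geometric_sum_powr_le[OF base_ge(3) s p I])
    also have "(\<Sum>i\<in>I. (base * 2 ^ i) powr s) = (\<Sum>i<K. lev i powr s * indicator (nbh (lev i)) x)"
      unfolding I_def lev_def by (rule sum.mono_neutral_cong_left) (auto simp: indicator_def)
    finally have "\<bar>tst \<kappa> (s / p) K x\<bar> powr p \<le> A powr p * (\<Sum>i<K. lev i powr s * indicator (nbh (lev i)) x)" .
    moreover have "dens x * \<bar>tst \<kappa> (s / p) K x\<bar> powr p \<le> 1 * \<bar>tst \<kappa> (s / p) K x\<bar> powr p"
      by (intro mult_right_mono dens_le_1) auto
    ultimately show ?thesis by simp
  qed
  then have "(\<integral>\<^sup>+x. ennreal (dens x * \<bar>tst \<kappa> (s / p) K x\<bar> powr p) \<partial>lborel)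
      \<le> (\<integral>\<^sup>+x. ennreal (A powr p * (\<Sum>i<K. lev i powr s * indicator (nbh (lev i)) x)) \<partial>lborel)"
    by (intro nn_integral_mono ennreal_leI) auto
  also have "\<dots> = ennreal (integral\<^sup>L lborel (\<lambda>x. A powr p * (\<Sum>i<K. lev i powr s * indicator (nbh (lev i)) x)))"
    by (intro nn_integral_eq_integral integrable_mult_right Bochner_Integration.integrable_sum int
        AE_I2 mult_nonneg_nonneg sum_nonneg) auto
  also have "integral\<^sup>L lborel (\<lambda>x. A powr p * (\<Sum>i<K. lev i powr s * indicator (nbh (lev i)) x))
      = A powr p * (\<Sum>i<K. integral\<^sup>L lborel (\<lambda>x. lev i powr s * indicator (nbh (lev i)) x))"
    by (subst Bochner_Integration.integral_mult_right_zero, subst Bochner_Integration.integral_sum)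
      (auto simp only: intro!: integrable_mult_right int)
  also have "(\<Sum>i<K. integral\<^sup>L lborel (\<lambda>x. lev i powr s * indicator (nbh (lev i)) x)) = (\<Sum>i<K. 4 ^ CARD('n))"
  proof (rule sum.cong)
    fix i
    have "integral\<^sup>L lborel (\<lambda>x. lev i powr s * indicator (nbh (lev i)) x) = lev i powr s * measure lborel (nbh (lev i))"
      by (simp add: nbh_def)
    also have "\<dots> = 4 ^ CARD('n)"
      unfolding measure_nbh[OF lev_ge(4)] using lev_ge(4)[of i] by (simp add: s_def powr_realpow power_divide)
    finally show "integral\<^sup>L lborel (\<lambda>x. lev i powr s * indicator (nbh (lev i)) x) = 4 ^ CARD('n)" .
  qed simp
  finally show ?thesis by (simp add: mult.assoc mult.commute[of "real K"])
qed

end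

section \<open>Lower bound for the superposition and the critical exponent\<close>

lemma powr_exponent_le_nat:
  fixes A B r s :: real
  assumes "A > 0" "\<And>K::nat. K \<ge> 1 \<Longrightarrow> A * real K powr r \<le> B * real K powr s"
  shows "r \<le> s"
proof (rule ccontr)
  assume "\<not> r \<le> s"
  then have rs: "r - s > 0" by simp
  have "filterlim (\<lambda>K::nat. real K powr (r - s)) at_top at_top" using rs by real_asymp
  then have "\<forall>\<^sub>F K in at_top. real K powr (r - s) > B / A" by (simp add: filterlim_at_top_dense)
  then obtain K :: nat where K: "K \<ge> 1" "real K powr (r - s) > B / A"
    using eventually_happens'[OF _ eventually_conj[OF _ eventually_ge_at_top[of 1]]]
    by (metis sequentially_bot)
  have "A * real K powr (r - s) * real K powr s \<le> B * real K powr s"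
    using assms(2)[OF K(1)] K(1) by (simp add: powr_diff)
  then have "A * real K powr (r - s) \<le> B" using K(1) by simp
  then show False using K(2) assms(1) by (simp add: field_simps)
qed

context plane
begin

lemma arg_vfd:
  assumes "x $ k1 + x $ k2 \<noteq> 0"
  shows "has_vf_derivative rot (arg l) x (- (l * ang' x))"
  using has_vf_derivative_diff[OF has_vf_derivative_diff[OF has_vf_derivative_const[of rot 1 x]
      has_vf_derivative_cmult[OF vfd_ang[OF assms], of l]] has_vf_derivative_cmult[OF vfd_trv, of "Lam * l\<^sup>2"]]
  by (simp add: arg_def[abs_def])

lemma ang'_ge: "ang' x \<ge> 1 / 2"
  by (simp add: ang'_def)

text \<open>On the core of scale 1/l the kernel is at least of order l^(-(\<alpha>+k)), the
  amplitude is l^r, the k + 1 derivatives give l^(k+1) and the volume is of order l^(-n). The total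
  exponent 1 - \<alpha> + r - n is nonnegative, and nothing cancels between scales, so K
  contributions add up.\<close>

lemma tst_max_op:
  fixes \<alpha> r \<kappa> c c0 :: real and K k :: nat
  defines "g \<equiv> tst \<kappa> r K"
  assumes \<alpha>: "\<alpha> > (1 - real CARD('n)) / 2" and k: "real k \<ge> (real CARD('n) - 1) / 2" "\<alpha> + real k > 0"
    and r: "0 \<le> 1 - \<alpha> + r - real CARD('n)"
    and \<kappa>: "\<kappa> > 0" "\<And>j s. j \<le> Suc k \<Longrightarrow> 0 < s \<Longrightarrow> s \<le> 2 * \<kappa> \<Longrightarrow> bumpd j s > 0"
    and c: "c > 0" "\<And>s. 1 / 4 \<le> s \<Longrightarrow> s \<le> 3 / 4 \<Longrightarrow> c \<le> bumpd (Suc k) (\<kappa> * s)"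
    and a: "a \<in> centres" and c0: "0 < c0" "c0 \<le> coef CARD('n) (arcosh (hy a pole)) \<alpha>" and v1: "hy a pole > 1"
  shows "max_op (of_real \<alpha>) (lift_fun g) (hchart a) \<ge> ennreal (c0 * (rGamma (\<alpha> + real (Suc k))
     * ((1 / 5) powr (\<alpha> + real k) * (c * ((\<kappa> / 16) ^ Suc k * (1 / 4))) * (1 / 10 * (2 * eps) ^ (CARD('n) - 1)) * real K)))"
proof -
  \<comment> \<open>The derivative of \<open>hy a\<close> along \<open>rot\<close> is
    \<open>- wgt a\<close>, so this field has the required normalisation.\<close>
  define Y where "Y x = (1 / wgt a x) *\<^sub>R rot x" for x
  let ?S = "{x. 0 < wgt a x}"
  have wgt_smooth: "smooth_on T (wgt a)" if "open T" for T
    unfolding wgt_def[abs_def] by (intro smooth_on_diff smooth_on_mult smooth_on_const smooth_on_nth that)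
  have opS: "open ?S"
    using smooth_on_continuous_on[OF wgt_smooth[OF open_UNIV]] by (intro open_Collect_less continuous_on_const)
  have base_reg: "nbh base \<subseteq> reg" using nbh_subset_reg[OF base_ge(1,2)] by blast
  have sub: "nbh base \<subseteq> ?S" using base_reg wgt_bounds(1)[OF a] by blast
  interpret chart_transport a g Y "nbh base" ?S
  proof unfold_locales
    show "smooth_on UNIV (hy a)" by (rule hy_smooth)
    show "smooth_on UNIV g" unfolding g_def by (rule tst_props(1)[OF \<kappa>(1)])
    then show "smooth_on UNIV (\<lambda>x. g x * dens x)" by (intro smooth_on_mult dens_smooth open_UNIV)
    show "compact (nbh base)" by (simp add: nbh_def)
    show "g x * dens x = 0" if "x \<notin> nbh base" for x using tst_props(3)[OF \<kappa>(1) that] by (simp add: g_def)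
    show "0 \<le> g x * dens x" for x
      using tst_props(2)[OF \<kappa>(1), of r K x] dens_pos[of x] by (simp add: g_def less_imp_le)
    show "smooth_on ?S (\<lambda>x. Y x \<bullet> e)" for e :: "real ^ 'n"
    proof -
      have "smooth_on ?S (\<lambda>x. (e $ k2 * x $ k1 - e $ k1 * x $ k2) / wgt a x)"
        by (intro smooth_on_divide smooth_on_diff smooth_on_mult smooth_on_const smooth_on_nth wgt_smooth opS) auto
      moreover have "Y x \<bullet> e = (e $ k2 * x $ k1 - e $ k1 * x $ k2) / wgt a x" for x
        unfolding Y_def by (simp add: inner_commute[of "rot x"] inner_rot)
      ultimately show ?thesis by simp
    qed
    fix x assume "x \<in> nbh base"
    then have w: "wgt a x > 0" using sub by blast
    have "frechet_derivative (hy a) (at x) = (\<lambda>v. ((sqrt (1 + (norm a)\<^sup>2) / sqrt (1 + (norm x)\<^sup>2)) *\<^sub>R x - a) \<bullet> v)"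
      by (rule frechet_derivative_at[OF hy_has_derivative, symmetric])
    moreover have "x \<bullet> rot x = 0" "a \<bullet> rot x = wgt a x" by (simp_all add: inner_rot wgt_def)
    ultimately show "frechet_derivative (hy a) (at x) (Y x) = - 1"
      using w by (simp add: Y_def inner_diff_left)
  qed (rule opS sub)+
  \<comment> \<open>Positivity of the iterated adjoint is claimed only inside the ball; outside it
    the kernel vanishes, and outside \<open>reg\<close> so does the adjoint.\<close>
  define Op where "Op = reg \<inter> {x. hy a x < hy a pole}"
  have opO: "open Op"
    unfolding Op_def by (intro open_Int open_reg open_Collect_less y_continuous continuous_on_const)
  have inO: "x \<in> reg" "hy a x < hy a pole" "wgt a x > 0" "wgt a x \<le> 8" "x $ k1 + x $ k2 > 0" if "x \<in> Op" for x
    using that wgt_bounds[OF a, of x] unfolding Op_def by auto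
  have cm_b: "cm_along j Op rot (\<lambda>x. 1 / wgt a x)" for j
  proof (rule cm_along_csc_cot[where w' = "\<lambda>x. - (a $ k2 * x $ k2) - a $ k1 * x $ k1", THEN conjunct1])
    show "- (a $ k2 * x $ k2) - a $ k1 * x $ k1 \<ge> 0" if "x \<in> Op" for x
      by (rule wgt_bounds(3)[OF a inO(1)[OF that]])
  qed (use inO vfd_wgt in auto)
  have cm_dens: "cm_along j Op rot dens" for j
    by (rule cm_along_invariant) (use dens_pos vfd_dens in \<open>auto intro: less_imp_le\<close>)
  \<comment> \<open>In the polar angle \<theta> this quotient is cot(\<theta> + pi/4).\<close>
  have cm_cot: "cm_along j Op rot (\<lambda>x. (x $ k1 - x $ k2) / (x $ k1 + x $ k2))" for j
  proof (rule cm_along_csc_cot[THEN conjunct2])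
    show "x $ k1 - x $ k2 \<ge> 0" if "x \<in> Op" for x by (rule wgt_bounds(5)[OF a inO(1)[OF that]])
  qed (use inO vfd_sum_12 in auto)
  have cm_ang': "cm_along j Op rot ang'" for j
    unfolding ang'_def[abs_def] divide_inverse[of _ 2]
    by (intro cm_along_mult cm_along_add cm_along_power cm_along_const cm_cot) auto
  define \<Psi> where "\<Psi> j i x = lev i powr r * bumpd j (\<kappa> * arg (lev i) x)" for j i x
  define \<tau> where "\<tau> i x = \<kappa> * (lev i * ang' x)" for i x
  have lead: "(\<Sum>i<K. \<Psi> (Suc k) i x * ((\<tau> i x * (1 / wgt a x)) ^ Suc k * dens x)) \<le> hs (Suc k) x" if x: "x \<in> Op" for x
  proof -
    \<comment> \<open>All k + 1 orders are spent, so complete monotonicity of the difference has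
      order 0 and is mere nonnegativity.\<close>
    have "cm_along (Suc k - Suc k) Op rot (\<lambda>x. (vf_adjoint (\<lambda>x. (1 / wgt a x) *\<^sub>R rot x) ^^ Suc k) (\<lambda>x. g x * dens x) x
        - (\<Sum>i<K. \<Psi> (Suc k) i x * ((\<tau> i x * (1 / wgt a x)) ^ Suc k * dens x)))"
    proof (rule cm_along_iterated_adjoint[OF opO bounded_linear_rot rot_divergence cm_b cm_dens])
      show "cm_along j Op rot (\<tau> i)" for j i
        unfolding \<tau>_def[abs_def] using \<kappa>(1) lev_ge(4)[of i]
        by (intro cm_along_mult cm_along_const cm_ang') auto
      \<comment> \<open>Inside the ball \<open>arg\<close> is at most 2, so the argument of
        \<open>bumpd\<close> stays in the range up to \<open>2 * \<kappa>\<close> where these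
        derivatives are positive.\<close>
      show "\<Psi> j i x \<ge> 0" if "j \<le> Suc k" "x \<in> Op" for j i x
      proof (cases "arg (lev i) x > 0")
        case True
        have "arg (lev i) x \<le> 2" by (rule arg_bounds(1)[OF a inO(1,2)[OF that(2)] lev_ge(4)])
        then have "\<kappa> * arg (lev i) x \<le> 2 * \<kappa>" using \<kappa>(1) by simp
        then show ?thesis using \<kappa>(2)[OF that(1)] True \<kappa>(1) by (simp add: \<Psi>_def less_imp_le)
      next
        case False
        then have "\<kappa> * arg (lev i) x \<le> 0" using \<kappa>(1) by (simp add: mult_nonneg_nonpos)
        then show ?thesis by (simp add: \<Psi>_def bumpd_eq_0)
      qed
      show "has_vf_derivative rot (\<Psi> j i) x (- (\<Psi> (Suc j) i x * \<tau> i x))" if "x \<in> Op" for j i x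
      proof -
        have "x $ k1 + x $ k2 \<noteq> 0" using inO(5)[OF that] by simp
        from has_vf_derivative_cmult[OF has_vf_derivative_compose[OF bumpd_has_derivative
              has_vf_derivative_cmult[OF arg_vfd[OF this]]]]
        have "has_vf_derivative rot (\<lambda>x. lev i powr r * bumpd j (\<kappa> * arg (lev i) x)) x
          (lev i powr r * (bumpd (Suc j) (\<kappa> * arg (lev i) x) * (\<kappa> * - (lev i * ang' x))))" .
        then show ?thesis by (simp add: \<Psi>_def[abs_def] \<tau>_def mult.assoc)
      qed
      show "g x * dens x = (\<Sum>i<K. \<Psi> 0 i x * dens x)" if "x \<in> Op" for x
      proof -
        have "blob \<kappa> (lev i) x = bump (\<kappa> * arg (lev i) x)" for i
        proof (cases "arg (lev i) x > 0")
          case True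
          then have "lev i * ang x \<ge> - 1 / 2"
            by (rule arg_bounds(2)[OF a inO(1,2)[OF that] lev_ge(4)])
          then show ?thesis using inO(5)[OF that] by (simp add: blob_def bump_step_eq_1)
        next
          case False
          then have "\<kappa> * arg (lev i) x \<le> 0" using \<kappa>(1) by (simp add: mult_nonneg_nonpos)
          then show ?thesis by (simp add: blob_def bumpd_eq_0)
        qed
        then show ?thesis by (simp add: g_def tst_def \<Psi>_def sum_distrib_right)
      qed
    qed simp
    moreover have "(\<lambda>x. (1 / wgt a x) *\<^sub>R rot x) = Y" by (simp add: Y_def[abs_def])
    ultimately have "cm_along 0 Op rot (\<lambda>x. hs (Suc k) x
        - (\<Sum>i<K. \<Psi> (Suc k) i x * ((\<tau> i x * (1 / wgt a x)) ^ Suc k * dens x)))"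
      unfolding hs_def by (simp only: diff_self_eq_0)
    then have "0 \<le> hs (Suc k) x - (\<Sum>i<K. \<Psi> (Suc k) i x * ((\<tau> i x * (1 / wgt a x)) ^ Suc k * dens x))"
      using x unfolding cm_along.simps by (rule bspec)
    then show ?thesis by (simp only: diff_ge_0_iff_ge)
  qed
  \<comment> \<open>The denominator 16 combines ang' \<ge> 1/2 with wgt \<le> 8, and 1/4 is the
    lower bound for \<open>dens\<close> where |x| < 3.\<close>
  define low where "low i = (1 / (5 * lev i)) powr (\<alpha> + real k) * (lev i powr r * c * ((\<kappa> * lev i / 16) ^ Suc k * (1 / 4)))" for i
  define f where "f x = max (hy a pole - hy a x) 0 powr (\<alpha> + real k) * hs (Suc k) x" for x
  have f_lower: "(\<Sum>i<K. low i * indicator (core (lev i)) x) \<le> f x" for x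
  proof (cases "x \<in> Op")
    case True
    define u where "u = hy a pole - hy a x"
    have u: "u > 0" using inO(2)[OF True] by (simp add: u_def)
    have "low i * indicator (core (lev i)) x \<le> u powr (\<alpha> + real k) * (\<Psi> (Suc k) i x * ((\<tau> i x * (1 / wgt a x)) ^ Suc k * dens x))"
      for i
    proof (cases "x \<in> core (lev i)")
      case x: True
      note cp = core_props[OF lev_ge(1) x]
      have l: "lev i > 0" by (rule lev_ge)
      have fu: "(1 / (5 * lev i)) powr (\<alpha> + real k) \<le> u powr (\<alpha> + real k)"
        using cp(4)[OF a] l k by (intro powr_mono2) (auto simp: u_def)
      have f\<Psi>: "lev i powr r * c \<le> \<Psi> (Suc k) i x"
        unfolding \<Psi>_def using c(2)[OF cp(2,3)] by (intro mult_left_mono) auto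
      define R T where "R = (\<kappa> * lev i / 16) ^ Suc k" and "T = (\<tau> i x * (1 / wgt a x)) ^ Suc k"
      have R: "0 \<le> R" unfolding R_def using \<kappa>(1) l by (intro zero_le_power) auto
      have fT: "R \<le> T"
        unfolding R_def T_def
      proof (rule power_mono)
        have "1 / 8 \<le> 1 / wgt a x" using inO(3,4)[OF True] by (intro divide_left_mono) auto
        moreover have "\<kappa> * lev i * (1 / 2) \<le> \<tau> i x"
          unfolding \<tau>_def using mult_left_mono[OF ang'_ge[of x], of "\<kappa> * lev i"] \<kappa>(1) l by (simp add: mult.assoc)
        ultimately have "(\<kappa> * lev i * (1 / 2)) * (1 / 8) \<le> \<tau> i x * (1 / wgt a x)"
          using \<kappa>(1) l ang'_ge[of x] by (intro mult_mono) (auto simp: \<tau>_def)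
        then show "\<kappa> * lev i / 16 \<le> \<tau> i x * (1 / wgt a x)" by simp
      qed (use \<kappa>(1) l in auto)
      have fd: "1 / 4 \<le> dens x"
      proof -
        have "norm x < 3" using inO(1)[OF True] by (simp add: reg_def)
        then have "(norm x)\<^sup>2 \<le> 3\<^sup>2" by (intro power_mono) auto
        then have "sqrt (1 + (norm x)\<^sup>2) \<le> 4" by (intro real_le_lsqrt) auto
        then show ?thesis using one_plus_norm2_pos[of x] unfolding dens_def by (intro divide_left_mono) auto
      qed
      have q: "0 \<le> lev i powr r * c" using c(1) by simp
      have s1: "R * (1 / 4) \<le> T * dens x"
        by (rule mult_mono[OF fT fd order_trans[OF R fT]]) simp
      have s2: "(lev i powr r * c) * (R * (1 / 4)) \<le> \<Psi> (Suc k) i x * (T * dens x)"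
        by (rule mult_mono[OF f\<Psi> s1 order_trans[OF q f\<Psi>]]) (use R in simp)
      have "(1 / (5 * lev i)) powr (\<alpha> + real k) * ((lev i powr r * c) * (R * (1 / 4)))
          \<le> u powr (\<alpha> + real k) * (\<Psi> (Suc k) i x * (T * dens x))"
        by (rule mult_mono[OF fu s2]) (use R q in simp_all)
      then have "low i \<le> u powr (\<alpha> + real k) * (\<Psi> (Suc k) i x * ((\<tau> i x * (1 / wgt a x)) ^ Suc k * dens x))"
        unfolding low_def R_def T_def .
      then show ?thesis using x by simp
    next
      case False
      have "arg (lev i) x \<le> 2" by (rule arg_bounds(1)[OF a inO(1,2)[OF True] lev_ge(4)])
      then have s2: "\<kappa> * arg (lev i) x \<le> 2 * \<kappa>" using \<kappa>(1) by simp
      have "0 \<le> bumpd (Suc k) (\<kappa> * arg (lev i) x)"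
        using \<kappa>(2)[OF order_refl _ s2] bumpd_eq_0[of "\<kappa> * arg (lev i) x"] by (cases "\<kappa> * arg (lev i) x > 0") (auto intro: less_imp_le)
      moreover have "0 \<le> \<tau> i x * (1 / wgt a x)"
        using \<kappa>(1) lev_ge(4)[of i] ang'_ge[of x] inO(3)[OF True] by (simp add: \<tau>_def)
      then have "0 \<le> (\<tau> i x * (1 / wgt a x)) ^ Suc k" by (rule zero_le_power)
      ultimately have "0 \<le> u powr (\<alpha> + real k) * (\<Psi> (Suc k) i x * ((\<tau> i x * (1 / wgt a x)) ^ Suc k * dens x))"
        unfolding \<Psi>_def by (intro mult_nonneg_nonneg less_imp_le[OF dens_pos]) auto
      then show ?thesis using False by simp
    qed
    then have "(\<Sum>i<K. low i * indicator (core (lev i)) x)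
        \<le> (\<Sum>i<K. u powr (\<alpha> + real k) * (\<Psi> (Suc k) i x * ((\<tau> i x * (1 / wgt a x)) ^ Suc k * dens x)))"
      by (intro sum_mono)
    also have "\<dots> \<le> u powr (\<alpha> + real k) * hs (Suc k) x"
      unfolding sum_distrib_left[symmetric] using lead[OF True] by (intro mult_left_mono) auto
    also have "\<dots> = f x" using u by (simp add: f_def u_def)
    finally show ?thesis .
  next
    case False
    have "x \<notin> core (lev i)" for i
    proof
      assume x: "x \<in> core (lev i)"
      note cp = core_props[OF lev_ge(1) x]
      have "0 < 1 / (5 * lev i)" using lev_ge(4)[of i] by simp
      then have "hy a x < hy a pole" using cp(4)[OF a] by linarith
      then show False using False cp(1) by (simp add: Op_def)
    qed
    moreover have "f x = 0"
    proof (cases "x \<in> reg")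
      case True
      then have "max (hy a pole - hy a x) 0 = 0" using False by (simp add: Op_def)
      then show ?thesis by (simp add: f_def)
    next
      case False
      then have "x \<notin> nbh base" using base_reg by blast
      then show ?thesis by (simp add: f_def hs_supp)
    qed
    ultimately show ?thesis by simp
  qed
  have f_int: "integrable lborel f"
  proof (rule integrable_continuous_compact[OF _ C_compact])
    show "continuous_on UNIV f"
      unfolding f_def[abs_def] using k(2)
      by (intro continuous_intros continuous_on_powr' hs_continuous y_continuous) auto
    show "f x = 0" if "x \<notin> nbh base" for x using hs_supp[OF that] by (simp add: f_def)
  qed
  have core_int: "integrable lborel (\<lambda>x. indicator (core l) x :: real)" for l
    unfolding core_def by (intro integrable_real_indicator emeasure_lborel_cbox_finite) auto
  define c5 where "c5 = (1 / 5) powr (\<alpha> + real k) * (c * ((\<kappa> / 16) ^ Suc k * (1 / 4))) * (1 / 10 * (2 * eps) ^ (CARD('n) - 1))"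
  have c5: "c5 \<ge> 0" unfolding c5_def using c \<kappa>(1) eps_pos by (intro mult_nonneg_nonneg zero_le_power) auto
  have "c5 \<le> low i * measure lborel (core (lev i))" for i
  proof -
    define l where "l = lev i"
    have l: "l > 0" "l \<ge> 1" using lev_ge by (auto simp: l_def)
    have e1: "(1 / (5 * l)) powr (\<alpha> + real k) = (1 / 5) powr (\<alpha> + real k) * l powr (- (\<alpha> + real k))"
    proof -
      have "1 / (5 * l) = (1 / 5) * (1 / l)" by simp
      then have "(1 / (5 * l)) powr (\<alpha> + real k) = (1 / 5) powr (\<alpha> + real k) * (1 / l) powr (\<alpha> + real k)"
        by (simp only: powr_mult)
      also have "(1 / l) powr (\<alpha> + real k) = l powr (- (\<alpha> + real k))"
        by (simp only: powr_divide powr_minus_divide powr_one_eq_one)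
      finally show ?thesis .
    qed
    have "(\<kappa> * l / 16) ^ Suc k = (\<kappa> / 16) ^ Suc k * l ^ Suc k"
      unfolding power_mult_distrib[symmetric] by simp
    also have "l ^ Suc k = l powr (real (Suc k))" using l by (simp only: powr_realpow)
    finally have e2: "(\<kappa> * l / 16) ^ Suc k = (\<kappa> / 16) ^ Suc k * l powr (real (Suc k))" .
    have e3: "(1 / l) ^ CARD('n) = l powr (- real CARD('n))"
      using l by (simp add: power_one_over powr_minus_divide powr_realpow)
    have "low i * measure lborel (core l)
        = c5 * (l powr (- (\<alpha> + real k)) * l powr r * l powr (real (Suc k)) * l powr (- real CARD('n)))"
      unfolding low_def measure_core[OF l(1)] l_def[symmetric] e1 e2 e3 c5_def by (simp only: mult_ac)
    also have "l powr (- (\<alpha> + real k)) * l powr r * l powr (real (Suc k)) * l powr (- real CARD('n))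
        = l powr (- (\<alpha> + real k) + r + real (Suc k) + - real CARD('n))"
      by (simp only: powr_add)
    also have "- (\<alpha> + real k) + r + real (Suc k) + - real CARD('n) = 1 - \<alpha> + r - real CARD('n)" by simp
    finally have "low i * measure lborel (core l) = c5 * l powr (1 - \<alpha> + r - real CARD('n))" .
    moreover have "1 \<le> l powr (1 - \<alpha> + r - real CARD('n))" using l r by (intro ge_one_powr_ge_zero) auto
    ultimately show ?thesis using c5 mult_left_mono[of 1 _ c5] by (simp add: l_def)
  qed
  then have "c5 * real K \<le> (\<Sum>i<K. low i * measure lborel (core (lev i)))"
    using sum_mono[of "{..<K}" "\<lambda>_. c5" "\<lambda>i. low i * measure lborel (core (lev i))"] by (simp add: mult.commute)
  also have "\<dots> = (\<Sum>i<K. integral\<^sup>L lborel (\<lambda>x. low i * indicator (core (lev i)) x))"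
    by (rule sum.cong) (simp_all add: core_def)
  also have "\<dots> = integral\<^sup>L lborel (\<lambda>x. \<Sum>i<K. low i * indicator (core (lev i)) x)"
    by (rule Bochner_Integration.integral_sum[symmetric]) (intro integrable_mult_right core_int)
  also have "\<dots> \<le> integral\<^sup>L lborel f"
    by (rule integral_mono[OF _ f_int f_lower])
      (intro Bochner_Integration.integrable_sum integrable_mult_right core_int)
  finally have If: "c5 * real K \<le> integral\<^sup>L lborel f" .
  have rG: "rGamma (\<alpha> + real (Suc k)) > 0"
  proof -
    have "Gamma (\<alpha> + real (Suc k)) > 0" using k(2) by (intro Gamma_real_pos) simp
    then show ?thesis by (simp add: rGamma_inverse_Gamma)
  qed
  have "c0 * (rGamma (\<alpha> + real (Suc k)) * (c5 * real K)) \<le> c0 * \<bar>Sr \<alpha> k (hy a pole)\<bar>"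
  proof (intro mult_left_mono)
    have "rGamma (\<alpha> + real (Suc k)) * (c5 * real K) \<le> rGamma (\<alpha> + real (Suc k)) * integral\<^sup>L lborel f"
      using If rG by (intro mult_left_mono) auto
    also have "\<dots> = Sr \<alpha> k (hy a pole)" by (simp only: Sr_def f_def[abs_def])
    finally show "rGamma (\<alpha> + real (Suc k)) * (c5 * real K) \<le> \<bar>Sr \<alpha> k (hy a pole)\<bar>" by simp
  qed (use c0 in simp)
  then have "ennreal (c0 * (rGamma (\<alpha> + real (Suc k)) * (c5 * real K))) \<le> ennreal (c0 * \<bar>Sr \<alpha> k (hy a pole)\<bar>)"
    by (rule ennreal_leI)
  also have "\<dots> \<le> max_op (of_real \<alpha>) (lift_fun g) (hchart a)"
    by (rule max_op_ge[OF \<alpha> k(1) v1 less_imp_le[OF c0(1)] c0(2)])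
  finally show ?thesis by (simp only: c5_def)
qed

text \<open>The upper bound on \<alpha> is the condition 0 \<le> 1 - \<alpha> + r - n of
  \<open>tst_max_op\<close> for r = n/p. The maximal function is then at least \<open>c6 * K\<close>
  on the fixed set \<open>centres\<close>, so testing gives a bound of K^p by a multiple of
  K.\<close>

lemma endpoint_unbounded:
  assumes \<alpha>: "\<alpha> > (1 - real CARD('n)) / 2" and p: "p > 1" and \<alpha>p: "\<alpha> \<le> 1 - real CARD('n) + real CARD('n) / p"
  shows "\<not> max_op_bounded TYPE('n) (of_real \<alpha>) p"
proof
  assume bd: "max_op_bounded TYPE('n) (of_real \<alpha>) p"
  define N where "N = real CARD('n)"
  have N: "N \<ge> 1" by (simp add: N_def Suc_leI)
  define k where "k = CARD('n)"
  have k: "real k \<ge> (real CARD('n) - 1) / 2" "\<alpha> + real k > 0" using \<alpha> N by (auto simp: k_def N_def)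
  obtain s where s: "s > 0" "\<And>j r. j \<le> Suc k \<Longrightarrow> 0 < r \<Longrightarrow> r \<le> s \<Longrightarrow> bumpd j r > 0"
    using bumpd_pos_near_0[of "Suc k"] by blast
  \<comment> \<open>Since \<open>arg\<close> is at most 2 inside the balls, halving keeps
    \<open>\<kappa> * arg\<close> in the interval where the derivatives up to order k + 1 are
    positive.\<close>
  define \<kappa> where "\<kappa> = s / 2"
  have \<kappa>: "\<kappa> > 0" "\<And>j r. j \<le> Suc k \<Longrightarrow> 0 < r \<Longrightarrow> r \<le> 2 * \<kappa> \<Longrightarrow> bumpd j r > 0"
    using s by (auto simp: \<kappa>_def)
  obtain c where c: "c > 0" "\<And>r. 1 / 4 \<le> r \<Longrightarrow> r \<le> 3 / 4 \<Longrightarrow> c \<le> bumpd (Suc k) (\<kappa> * r)"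
  proof -
    have "continuous_on {1/4..3/4::real} (\<lambda>r. bumpd (Suc k) (\<kappa> * r))"
      by (intro continuous_at_imp_continuous_on ballI)
        (rule DERIV_isCont, rule DERIV_chain2[OF bumpd_has_derivative DERIV_cmult_Id])
    then obtain r0 where r0: "r0 \<in> {1/4..3/4}" "\<And>r. r \<in> {1/4..3/4} \<Longrightarrow> bumpd (Suc k) (\<kappa> * r0) \<le> bumpd (Suc k) (\<kappa> * r)"
      using continuous_attains_inf[of "{1/4..3/4::real}" "\<lambda>r. bumpd (Suc k) (\<kappa> * r)"] by auto
    have "bumpd (Suc k) (\<kappa> * r0) > 0" using r0(1) \<kappa>(1) by (intro \<kappa>(2)) auto
    then show ?thesis using that r0(2) by auto
  qed
  \<comment> \<open>The sphere about each centre is made to pass through \<open>pole\<close>; [2, V]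
    contains all the corresponding values of cosh t.\<close>
  define V where "V = 2 * (9 + N) + 2"
  obtain c0 where c0: "c0 > 0" "\<And>v. v \<in> {2..V} \<Longrightarrow> coef CARD('n) (arcosh v) \<alpha> \<ge> c0"
    using coef_lower_bound[of 2 V "CARD('n)" \<alpha>] by auto
  have v: "hy a pole \<in> {2..V}" if a: "a \<in> centres" for a
  proof -
    let ?A = "sqrt (1 + (norm a)\<^sup>2)"
    have h: "hy a pole = ?A * sqrt 2 - a $ k1" by (simp add: hy_def pole_def norm_axis_1 inner_axis)
    have a1: "-2 \<le> a $ k1" "a $ k1 \<le> -1" using a by (auto simp: mem_centres)
    have "?A \<le> 9 + N"
      using norm_centres[OF a] N by (intro sqrt_le_bound) (auto simp: N_def)
    moreover have s2: "1 \<le> sqrt (2::real)" "sqrt (2::real) \<le> 2" by (auto intro: real_le_lsqrt)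
    ultimately have "?A * sqrt 2 \<le> (9 + N) * 2" using N by (intro mult_mono) auto
    moreover have "1 * 1 \<le> ?A * sqrt 2" using s2 by (intro mult_mono) auto
    ultimately show ?thesis unfolding h V_def using a1 by simp
  qed
  obtain C where C: "C > 0" "testing_bound TYPE('n) (of_real \<alpha>) p C"
    by (rule max_op_bounded_testing[OF bd]) (use p in auto)
  define c6 where "c6 = c0 * (rGamma (\<alpha> + real (Suc k)) * ((1 / 5) powr (\<alpha> + real k)
      * (c * ((\<kappa> / 16) ^ Suc k * (1 / 4))) * (1 / 10 * (2 * eps) ^ (CARD('n) - 1))))"
  have c6: "c6 > 0"
  proof -
    have "Gamma (\<alpha> + real (Suc k)) > 0" using k(2) by (intro Gamma_real_pos) simp
    then have "rGamma (\<alpha> + real (Suc k)) > 0" by (simp add: rGamma_inverse_Gamma)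
    then show ?thesis unfolding c6_def using c0(1) c(1) \<kappa>(1) eps_pos by (intro mult_pos_pos zero_less_power) auto
  qed
  define d where "d = 1 / sqrt (9 + N)"
  have d: "d > 0" using N by (simp add: d_def)
  define m where "m = d * measure lborel centres"
  have m: "m > 0" using d measure_centres_pos by (simp add: m_def)
  define A where "A = 2 powr (N / p) / (2 powr (N / p) - 1)"
  have main: "(c6 powr p * m) * real K powr p \<le> (C * (A powr p * 4 ^ CARD('n))) * real K powr 1" if K: "K \<ge> 1" for K :: nat
  proof -
    have "(c6 * real K) powr p * m \<le> C * (A powr p * 4 ^ CARD('n) * real K)"
    proof (rule testing_boundD[OF C(2), of "tst \<kappa> (N / p) K" "nbh base" centres])
      show "smooth_on UNIV (tst \<kappa> (N / p) K)" by (rule tst_props(1)[OF \<kappa>(1)])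
      show "compact (nbh base)" by (simp add: nbh_def)
      show "tst \<kappa> (N / p) K x = 0" if "x \<notin> nbh base" for x by (rule tst_props(3)[OF \<kappa>(1) that])
      show "centres \<in> sets borel" by (simp add: centres_def)
      show "0 \<le> c6 * real K" using c6 by simp
      show "0 \<le> A powr p * 4 ^ CARD('n) * real K" by simp
      show "(\<integral>\<^sup>+x. ennreal (dens x * \<bar>tst \<kappa> (N / p) K x\<bar> powr p) \<partial>lborel) \<le> ennreal (A powr p * 4 ^ CARD('n) * real K)"
        unfolding A_def N_def by (rule tst_norm) (use \<kappa> p in auto)
      show "0 \<le> m" using m by simp
      have "d \<le> dens a" if "a \<in> centres" for a
        unfolding d_def dens_def using norm_centres[OF that] one_plus_norm2_pos[of a] N
        by (intro divide_left_mono) (auto simp: N_def)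
      then show "ennreal m \<le> (\<integral>\<^sup>+x. ennreal (dens x) * indicator centres x \<partial>lborel)"
        unfolding m_def using d by (intro measure_mult_le_nn_integral) (auto simp: centres_def)
      show "ennreal (c6 * real K) \<le> max_op (of_real \<alpha>) (lift_fun (tst \<kappa> (N / p) K)) (hchart a)" if a: "a \<in> centres" for a
      proof -
        have "ennreal (c6 * real K) = ennreal (c0 * (rGamma (\<alpha> + real (Suc k))
          * ((1 / 5) powr (\<alpha> + real k) * (c * ((\<kappa> / 16) ^ Suc k * (1 / 4))) * (1 / 10 * (2 * eps) ^ (CARD('n) - 1)) * real K)))"
          unfolding c6_def by (simp only: mult.assoc)
        also have "\<dots> \<le> max_op (of_real \<alpha>) (lift_fun (tst \<kappa> (N / p) K)) (hchart a)"
          by (rule tst_max_op[OF \<alpha> k _ \<kappa> c a c0(1) c0(2)[OF v[OF a]]]) (use \<alpha>p v[OF a] in \<open>auto simp: N_def\<close>)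
        finally show ?thesis .
      qed
    qed
    then show ?thesis using c6 by (simp add: powr_mult mult_ac)
  qed
  have "p \<le> 1"
  proof (rule powr_exponent_le_nat[OF _ main])
    show "c6 powr p * m > 0" using c6 m by simp
  qed
  then show False using p by simp
qed

end

theorem theorem1p1:
  fixes \<alpha> p :: real
  assumes "CARD('n::finite) \<ge> 2"
    and "\<alpha> > (1 - real CARD('n)) / 2"
    and "1 < p"
    and "max_op_bounded TYPE('n) (complex_of_real \<alpha>) p"
  shows "(p \<le> 2 \<longrightarrow> \<alpha> > 1 - real CARD('n) + real CARD('n) / p) \<and>
         (2 < p \<longrightarrow> \<alpha> \<ge> max (1 / p - (real CARD('n) - 1) / 2) (- (real CARD('n) - 1) / p))"
proof (intro conjI impI)
  \<comment> \<open>The plane of rotation is spanned by two distinct coordinates, which exist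
    because n \<ge> 2.\<close>
  obtain k1 k2 :: 'n where "k1 \<noteq> k2"
    using assms(1) card_2_iff'[of "UNIV :: 'n set"] card_le_Suc0_iff_eq[of "UNIV :: 'n set"] by auto
  then interpret plane k1 k2 by unfold_locales
  show "\<alpha> > 1 - real CARD('n) + real CARD('n) / p"
    using endpoint_unbounded[OF assms(2,3)] assms(4) by (meson not_le)
next
  assume p: "2 < p"
  show "\<alpha> \<ge> max (1 / p - (real CARD('n) - 1) / 2) (- (real CARD('n) - 1) / p)"
  proof (cases "\<alpha> < 0")
    case True
    have "\<alpha> \<ge> 1 / p - (real CARD('n) - 1) / 2"
      by (rule necessary_cap[OF assms(2) True _ assms(4)]) (use p in simp)
    moreover have "\<alpha> \<ge> - (real CARD('n) - 1) / p"
      by (rule necessary_sphere[OF assms(2) True _ assms(4)]) (use p in simp)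
    ultimately show ?thesis by simp
  next
    case False
    \<comment> \<open>For \<alpha> \<ge> 0 no testing is called for: with p > 2 and n \<ge> 2 both
      lower bounds are at most 0.\<close>
    have "1 / p \<le> 1 / 2" using p by simp
    moreover have "1 / 2 \<le> (real CARD('n) - 1) / 2" using assms(1) by simp
    moreover have "- (real CARD('n) - 1) / p \<le> 0" using assms(1) p by (simp add: divide_nonpos_pos)
    ultimately show ?thesis using False by (intro max.boundedI) linarith+
  qed
qed

end
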